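(* Let $M$ be a matroid on a finite ground set. The independence polytope $P(M)$ is Gorenstein if and only if there exists an integer $\delta\geq 2$ such that $M$ is a direct sum of loops and $(\delta-1)$-blow ups of connected $F_\delta$-matroids (the number of summands of each kind may be zero).
   Context: **Independence polytope.** For a matroid $M$ on a finite ground set $E$, $P(M)\subset\mathbb{R}^E$ is the convex hull of the indicator vectors $\sum_{e\in I}\chi_e$ of all independent sets $I$ of $M$. **Gorenstein polytopes.** A lattice polytope $P\subset\mathbb{R}^d$ has the integer decomposition property if for every positive integer $k$ each vector of $kP\cap\mathbb{Z}^d$ is a sum of $k$ vectors of $P\cap\mathbb{Z}^d$ (matroid independence polytopes have this property). Let $\delta$ be a positive integer. A full-dimensional lattice polytope $P\subset\mathbb{R}^d$ with the integer decomposition property is $\delta$-Gorenstein if there is a lattice point $v\in\delta P\cap\mathbb{Z}^d$ such that for every facet $Q$ of $P$ one has $h_Q(v,\delta)=1$, where $h_Q:\mathbb{Z}^d\times\mathbb{Z}\to\mathbb{Z}$ is the unique surjective (reduced) linear form which is nonnegative on $P\times\{1\}$ and vanishes on $Q\times\{1\}$. (In other words, $v$ is at lattice distance $1$ from every facet of $\delta P$.) A lattice polytope that is not full-dimensional is $\delta$-Gorenstein if it is so with respect to the affine lattice it spans; a polytope consisting of a single lattice point has no facets and is $\delta$-Gorenstein for every $\delta$. $P$ is Gorenstein if it is $\delta$-Gorenstein for some positive integer $\delta$. **$F_\delta$-families.** Fix an integer $\delta\ge2$. A family $\mathcal{F}$ of subsets of a finite set $E$ is an $F_\delta$-family if: (1)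 $\{e\}\in\mathcal{F}$ for every $e\in E$; (2) for all $F_i,F_j\in\mathcal{F}$ with $F_i\cap F_j\ne\emptyset$, both $F_i\cap F_j$ and $F_i\cup F_j$ belong to $\mathcal{F}$; (3) every $F_i\in\mathcal{F}$ has cardinality $\frac{\delta f_i-1}{\delta-1}$ for some integer $f_i\equiv1\pmod{\delta-1}$. It is connected if $E\in\mathcal{F}$. **$F_\delta$-matroids.** For an $F_\delta$-family $\mathcal{F}$, $M_{\mathcal{F}}$ is the matroid on $E$ whose circuits are the inclusion-minimal sets among all $(f_i+1)$-element subsets of $F_i$, over all $F_i\in\mathcal{F}$ (this does define a matroid). Matroids of this form are called $F_\delta$-matroids. **Connectedness.** A matroid is connected if its ground set is nonempty and it is not a direct sum of two matroids with nonempty ground sets. **Blow up.** The $k$-blow up of an element $e$ in a matroid adds $k-1$ new elements $e_2,\dots,e_k$ to the ground set and adds, for every basis $B$ containing $e$ and every $i=2,\dots,k$, the basis $(B\setminus e)\cup e_i$ (so $e,e_2,\dots,e_k$ become parallel). The $k$-blow up of a matroid is obtained by performing the $k$-blow up of every element of its ground set; the $1$-blow up is the matroid itself. *)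

theory Defs
  imports "HOL-Analysis.Analysis" "HOL-Number_Theory.Cong"
begin

section \<open>Matroids\<close>

record 'a set_system =
  ground :: "'a set"
  indep :: "'a set set"

definition matroid :: "'a set_system \<Rightarrow> bool" where
  "matroid M \<longleftrightarrow>
     finite (ground M) \<and> indep M \<subseteq> Pow (ground M) \<and> {} \<in> indep M \<and>
     (\<forall>I\<in>indep M. \<forall>J. J \<subseteq> I \<longrightarrow> J \<in> indep M) \<and>
     (\<forall>I\<in>indep M. \<forall>J\<in>indep M. card I < card J \<longrightarrow> (\<exists>e\<in>J - I. insert e I \<in> indep M))"

definition minimal_sets :: "'a set set \<Rightarrow> 'a set set" where
  "minimal_sets \<A> = {A \<in> \<A>. \<forall>B\<in>\<A>. B \<subseteq> A \<longrightarrow> B = A}"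

definition maximal_sets :: "'a set set \<Rightarrow> 'a set set" where
  "maximal_sets \<A> = {A \<in> \<A>. \<forall>B\<in>\<A>. A \<subseteq> B \<longrightarrow> B = A}"

definition bases :: "'a set_system \<Rightarrow> 'a set set" where
  "bases M = maximal_sets (indep M)"

definition circuits :: "'a set_system \<Rightarrow> 'a set set" where
  "circuits M = minimal_sets (Pow (ground M) - indep M)"

definition direct_sum2 :: "'a set_system \<Rightarrow> 'a set_system \<Rightarrow> 'a set_system" where
  "direct_sum2 M N =
     \<lparr>ground = ground M \<union> ground N, indep = {I \<union> J |I J. I \<in> indep M \<and> J \<in> indep N}\<rparr>"

text \<open>The empty list gives the matroid with empty ground set, the unit of the direct sum.\<close>

definition direct_sum :: "'a set_system list \<Rightarrow> 'a set_system" where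
  "direct_sum Ms = foldr direct_sum2 Ms \<lparr>ground = {}, indep = {{}}\<rparr>"

definition pairwise_disjoint_grounds :: "'a set_system list \<Rightarrow> bool" where
  "pairwise_disjoint_grounds Ms \<longleftrightarrow>
     (\<forall>i<length Ms. \<forall>j<length Ms. i \<noteq> j \<longrightarrow> ground (Ms ! i) \<inter> ground (Ms ! j) = {})"

definition matroid_connected :: "'a set_system \<Rightarrow> bool" where
  "matroid_connected M \<longleftrightarrow>
     ground M \<noteq> {} \<and>
     \<not> (\<exists>N1 N2. matroid N1 \<and> matroid N2 \<and> ground N1 \<noteq> {} \<and> ground N2 \<noteq> {} \<and>
            ground N1 \<inter> ground N2 = {} \<and> M = direct_sum2 N1 N2)"

definition loop :: "'a \<Rightarrow> 'a set_system" where
  "loop e = \<lparr>ground = {e}, indep = {{}}\<rparr>"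


section \<open>Blow-ups\<close>

text \<open>\<open>S\<close> is the set of the new elements \<open>e\<^sub>2, \<dots>, e\<^sub>k\<close>.\<close>

definition blow_up_element :: "'a \<Rightarrow> 'a set \<Rightarrow> 'a set_system \<Rightarrow> 'a set_system" where
  "blow_up_element e S M =
     \<lparr>ground = ground M \<union> S,
      indep = {I. \<exists>B \<in> bases M \<union> {insert e' (B - {e}) |B e'. B \<in> bases M \<and> e \<in> B \<and> e' \<in> S}.
                 I \<subseteq> B}\<rparr>"

text \<open>Blow-ups depend on the choice of names for the new elements, hence are relations.\<close>

primrec blow_up_elements ::
    "nat \<Rightarrow> 'a list \<Rightarrow> 'a set_system \<Rightarrow> 'a set_system \<Rightarrow> bool" where
  "blow_up_elements k [] N M \<longleftrightarrow> M = N"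
| "blow_up_elements k (e # es) N M \<longleftrightarrow>
     (\<exists>S. finite S \<and> card S = k - 1 \<and> S \<inter> ground N = {} \<and>
          blow_up_elements k es (blow_up_element e S N) M)"

definition is_blow_up :: "nat \<Rightarrow> 'a set_system \<Rightarrow> 'a set_system \<Rightarrow> bool" where
  "is_blow_up k N M \<longleftrightarrow>
     (\<exists>es. distinct es \<and> set es = ground N \<and> blow_up_elements k es N M)"


section \<open>\<open>F\<^sub>\<delta>\<close>-families and \<open>F\<^sub>\<delta>\<close>-matroids\<close>

text \<open>For \<open>\<delta> \<ge> 2\<close> this determines the number \<open>f\<close> attached to \<open>F\<close> uniquely.\<close>

definition F_number :: "nat \<Rightarrow> 'a set \<Rightarrow> int \<Rightarrow> bool" where
  "F_number \<delta> F f \<longleftrightarrow>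
     [f = 1] (mod int \<delta> - 1) \<and>
     real (card F) = (real \<delta> * real_of_int f - 1) / (real \<delta> - 1)"

definition F_family :: "nat \<Rightarrow> 'a set \<Rightarrow> 'a set set \<Rightarrow> bool" where
  "F_family \<delta> E \<F> \<longleftrightarrow>
     finite E \<and> \<F> \<subseteq> Pow E \<and>
     (\<forall>e\<in>E. {e} \<in> \<F>) \<and>
     (\<forall>F\<in>\<F>. \<forall>G\<in>\<F>. F \<inter> G \<noteq> {} \<longrightarrow> F \<inter> G \<in> \<F> \<and> F \<union> G \<in> \<F>) \<and>
     (\<forall>F\<in>\<F>. \<exists>f. F_number \<delta> F f)"

definition F_matroid :: "nat \<Rightarrow> 'a set_system \<Rightarrow> bool" where
  "F_matroid \<delta> M \<longleftrightarrow>
     matroid M \<and>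
     (\<exists>\<F>. F_family \<delta> (ground M) \<F> \<and>
          circuits M =
            minimal_sets {C. \<exists>F\<in>\<F>. \<exists>f. F_number \<delta> F f \<and> C \<subseteq> F \<and> int (card C) = f + 1})"


section \<open>Gorenstein polytopes\<close>

definition lattice_points :: "(real ^ 'n) set" where
  "lattice_points = {x. \<forall>i. x $ i \<in> \<int>}"

definition lattice_polytope :: "(real ^ 'n) set \<Rightarrow> bool" where
  "lattice_polytope P \<longleftrightarrow> (\<exists>V. finite V \<and> V \<subseteq> lattice_points \<and> P = convex hull V)"

definition dilate :: "nat \<Rightarrow> (real ^ 'n) set \<Rightarrow> (real ^ 'n) set" where
  "dilate k P = (\<lambda>x. real k *\<^sub>R x) ` P"

definition integer_decomposition_property :: "(real ^ 'n) set \<Rightarrow> bool" where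
  "integer_decomposition_property P \<longleftrightarrow>
     (\<forall>k>0. \<forall>x \<in> dilate k P \<inter> lattice_points.
        \<exists>p. (\<forall>i<k. p i \<in> P \<inter> lattice_points) \<and> x = (\<Sum>i<k. p i))"

text \<open>
  The lattice on which the facet forms of \<open>P\<close> are normalised. If \<open>P \<subseteq> \<real>\<^sup>d\<close> is full-dimensional,
  then \<open>span (P \<times> {1})\<close> is the whole space and this is \<open>\<int>\<^sup>d \<times> \<int>\<close>. In general its slice at
  height \<open>1\<close> is the affine lattice \<open>aff P \<inter> \<int>\<^sup>d\<close> spanned by \<open>P\<close>, which generates it when \<open>P\<close>
  is a lattice polytope.
\<close>

definition cone_lattice :: "(real ^ 'n) set \<Rightarrow> ((real ^ 'n) \<times> real) set" where
  "cone_lattice P = span (P \<times> {1}) \<inter> (lattice_points \<times> \<int>)"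

text \<open>
  Forms are represented by their real-linear extensions. On \<open>span (P \<times> {1})\<close>, the only place
  where its values matter, the form of a facet \<open>Q\<close> is unique.
\<close>

definition facet_form ::
    "(real ^ 'n) set \<Rightarrow> (real ^ 'n) set \<Rightarrow> ((real ^ 'n) \<times> real \<Rightarrow> real) \<Rightarrow> bool" where
  "facet_form P Q h \<longleftrightarrow>
     linear h \<and> h ` cone_lattice P = \<int> \<and>
     (\<forall>z \<in> P \<times> {1}. h z \<ge> 0) \<and> (\<forall>z \<in> Q \<times> {1}. h z = 0)"

definition delta_Gorenstein :: "nat \<Rightarrow> (real ^ 'n) set \<Rightarrow> bool" where
  "delta_Gorenstein \<delta> P \<longleftrightarrow>
     \<delta> > 0 \<and> lattice_polytope P \<and> integer_decomposition_property P \<and>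
     (\<exists>v \<in> dilate \<delta> P \<inter> lattice_points.
        \<forall>Q. Q facet_of P \<longrightarrow> (\<exists>h. facet_form P Q h \<and> h (v, real \<delta>) = 1))"

definition Gorenstein :: "(real ^ 'n) set \<Rightarrow> bool" where
  "Gorenstein P \<longleftrightarrow> (\<exists>\<delta>. delta_Gorenstein \<delta> P)"

text \<open>
  The ground set may be any subset \<open>E\<close> of the index type, in which case \<open>\<real>\<^sup>E\<close> is identified with
  the coordinate subspace of vectors vanishing outside \<open>E\<close>.
\<close>

definition independence_polytope :: "'n::finite set_system \<Rightarrow> (real ^ 'n) set" where
  "independence_polytope M = convex hull ((\<lambda>I. \<Sum>e\<in>I. axis e 1) ` indep M)"

end

theory Submission
  imports Defs
begin

text \<open>
  The inequalities \<open>x\<^sub>e \<ge> 0\<close> and \<open>x(A) \<le> r(A)\<close>, where \<open>r\<close> is the rank function and \<open>x(A)\<close> is the sum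
  of the coordinates in \<open>A\<close>, describe \<open>P(M)\<close> (\<open>independence_polytope_inequalities\<close>). Its facets come
  from \<open>x\<^sub>e \<ge> 0\<close> for nonloops \<open>e\<close> and from \<open>x(F) \<le> r(F)\<close> for the connected flats \<open>F\<close> of the part of \<open>M\<close>
  without loops, and the associated reduced forms are \<open>x\<^sub>e\<close> and \<open>r(F) t - x(F)\<close>. A point at lattice
  distance \<open>1\<close> from all facets of \<open>\<delta>P(M)\<close> therefore has all nonloop coordinates equal to \<open>1\<close>, and it
  exists if and only if \<open>\<delta> r(F) - |F| = 1\<close> for every connected flat \<open>F\<close>. This condition is called
  balanced below. The equivalence consists of \<open>delta_Gorenstein_imp_balanced\<close> and
  \<open>balanced_imp_delta_Gorenstein\<close>. Both the description by inequalities and the integer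
  decomposition property rest on \<open>independent_decomposition\<close>: a nonnegative integer vector with
  \<open>x(A) \<le> k r(A)\<close> for all \<open>A\<close> is a sum of \<open>k\<close> indicator vectors of independent sets. It follows from
  \<open>discrete_sandwich\<close>, the theorem that an integer-valued modular function fits between a
  supermodular and a submodular one.

  The rest is matroid theory (\<open>balanced_iff_direct_sum\<close>). A connected flat of a direct sum lies in one
  summand, so being balanced can be checked on the connected summands. A connected summand is either
  a loop or has no loops. In the latter case the parallel classes are the connected flats of rank \<open>1\<close>,
  so they have \<open>\<delta> - 1\<close> elements, and the summand is the \<open>(\<delta> - 1)\<close>-blow up of its simplification \<open>N\<close>,
  whose connected flats \<open>F\<close> satisfy \<open>\<delta> r(F) - (\<delta> - 1)|F| = 1\<close>.

  It remains to see that the loopless matroids \<open>N\<close> with this property are the \<open>F\<^sub>\<delta>\<close>-matroids, with the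
  connected flats as the family and \<open>f = r(F)\<close>. The defect \<open>d(X) = \<delta> r(X) - (\<delta> - 1)|X|\<close> of a flat
  counts its connected components. For two intersecting connected flats, submodularity of the rank
  bounds the sum of the defects of the intersection and of the span of the union by \<open>2\<close>, so that both
  are connected and the union is already a flat (\<open>connected_flat_Int_Un\<close>). The circuits come out
  right because the span of a circuit is a connected flat (\<open>balanced_imp_F_matroid\<close>). Conversely, in
  the matroid of an \<open>F\<^sub>\<delta>\<close>-family, \<open>I\<close> can only be independent if \<open>|I \<inter> F| \<le> f\<close> for all members of the
  family, and uncrossing the members that are tight for a basis of a connected flat shows that this
  flat belongs to the family with \<open>f\<close> equal to its rank (\<open>F_matroid_imp_balanced\<close>).
\<close>


section \<open>Rank, flats and inseparable sets\<close>

definition rank_of :: "'a set_system \<Rightarrow> 'a set \<Rightarrow> nat" where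
  "rank_of M A = Max (card ` {I \<in> indep M. I \<subseteq> A})"

definition nonloops :: "'a set_system \<Rightarrow> 'a set" where
  "nonloops M = {e. {e} \<in> indep M}"

text \<open>
  Flats, spans and connected flats are those of the matroid without its loops, because the
  independence polytope spans exactly the coordinates of the nonloops.
\<close>

definition flat :: "'a set_system \<Rightarrow> 'a set \<Rightarrow> bool" where
  "flat M F \<longleftrightarrow> F \<subseteq> nonloops M \<and> (\<forall>e\<in>nonloops M - F. rank_of M F < rank_of M (insert e F))"

definition span_of :: "'a set_system \<Rightarrow> 'a set \<Rightarrow> 'a set" where
  "span_of M A = {e \<in> nonloops M. rank_of M (insert e A) = rank_of M A}"

text \<open>
  This is connectedness of the restriction to \<open>A\<close>, in the rank formulation: \<open>A = Y \<union> Z\<close> is a direct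
  sum decomposition if and only if the ranks of \<open>Y\<close> and \<open>Z\<close> add up.
\<close>

definition inseparable :: "'a set_system \<Rightarrow> 'a set \<Rightarrow> bool" where
  "inseparable M A \<longleftrightarrow> A \<noteq> {} \<and>
     (\<forall>Y Z. Y \<union> Z = A \<and> Y \<inter> Z = {} \<and> Y \<noteq> {} \<and> Z \<noteq> {} \<longrightarrow> rank_of M A < rank_of M Y + rank_of M Z)"

definition connected_flat :: "'a set_system \<Rightarrow> 'a set \<Rightarrow> bool" where
  "connected_flat M F \<longleftrightarrow> flat M F \<and> inseparable M F"

text \<open>
  For \<open>c = 1\<close>, the vector with all nonloop coordinates equal to \<open>1\<close> has distance \<open>1\<close> from the facets
  of the \<open>\<delta>\<close>-th dilate of the independence polytope that belong to connected flats. The factor \<open>c\<close>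
  says that every element counts for a parallel class of \<open>c\<close> elements.
\<close>

definition balanced :: "nat \<Rightarrow> nat \<Rightarrow> 'a set_system \<Rightarrow> bool" where
  "balanced \<delta> c M \<longleftrightarrow> (\<forall>F. connected_flat M F \<longrightarrow> c * card F + 1 = \<delta> * rank_of M F)"

context
  fixes M :: "'a set_system"
  assumes M: "matroid M"
begin

lemma finite_ground: "finite (ground M)"
  using M by (simp add: matroid_def)

lemma indep_subset_ground: "I \<in> indep M \<Longrightarrow> I \<subseteq> ground M"
  using M by (auto simp: matroid_def)

lemma finite_indep: "I \<in> indep M \<Longrightarrow> finite I"
  using finite_ground indep_subset_ground finite_subset by blast

lemma finite_indeps: "finite (indep M)"
  using finite_ground indep_subset_ground by (meson Pow_iff finite_Pow_iff finite_subset subsetI)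

lemma empty_indep: "{} \<in> indep M"
  using M by (simp add: matroid_def)

lemma indep_subset: "I \<in> indep M \<Longrightarrow> J \<subseteq> I \<Longrightarrow> J \<in> indep M"
  using M by (auto simp: matroid_def)

lemma augment: "I \<in> indep M \<Longrightarrow> J \<in> indep M \<Longrightarrow> card I < card J \<Longrightarrow> \<exists>e\<in>J - I. insert e I \<in> indep M"
  using M by (auto simp: matroid_def)

lemma nonloops_subset_ground: "nonloops M \<subseteq> ground M"
  using indep_subset_ground by (auto simp: nonloops_def)

lemma finite_nonloops: "finite (nonloops M)"
  using nonloops_subset_ground finite_ground finite_subset by blast

lemma indep_subset_nonloops: "I \<in> indep M \<Longrightarrow> I \<subseteq> nonloops M"
  using indep_subset by (auto simp: nonloops_def)

lemma card_le_rank: "I \<in> indep M \<Longrightarrow> I \<subseteq> A \<Longrightarrow> card I \<le> rank_of M A"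
  unfolding rank_of_def using finite_indeps by (intro Max_ge) auto

lemma rank_witness: "\<exists>I\<in>indep M. I \<subseteq> A \<and> card I = rank_of M A"
proof -
  have "rank_of M A \<in> card ` {I \<in> indep M. I \<subseteq> A}"
    unfolding rank_of_def using finite_indeps empty_indep by (intro Max_in) auto
  then show ?thesis by auto
qed

lemma extend_to_rank:
  assumes "I \<in> indep M" "I \<subseteq> A"
  shows "\<exists>B\<in>indep M. I \<subseteq> B \<and> B \<subseteq> A \<and> card B = rank_of M A"
  using assms
proof (induction "rank_of M A - card I" arbitrary: I rule: less_induct)
  case less
  show ?case
  proof (cases "card I < rank_of M A")
    case True
    obtain J where J: "J \<in> indep M" "J \<subseteq> A" "card J = rank_of M A"
      using rank_witness by blast
    obtain e where e: "e \<in> J - I" "insert e I \<in> indep M"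
      using augment less.prems J True by metis
    have "card (insert e I) = Suc (card I)"
      using e finite_indep less.prems by simp
    then have "rank_of M A - card (insert e I) < rank_of M A - card I"
      using True by simp
    then obtain B where "B \<in> indep M" "insert e I \<subseteq> B" "B \<subseteq> A" "card B = rank_of M A"
      using less.hyps[of "insert e I"] e J less.prems by blast
    then show ?thesis by blast
  next
    case False
    then show ?thesis using less.prems card_le_rank[of I A] by force
  qed
qed

lemma rank_mono: "A \<subseteq> B \<Longrightarrow> rank_of M A \<le> rank_of M B"
  using rank_witness[of A] card_le_rank by (metis subset_trans)

lemma rank_empty: "rank_of M {} = 0"
  using rank_witness[of "{}"] by auto

lemma rank_submodular: "rank_of M (A \<union> B) + rank_of M (A \<inter> B) \<le> rank_of M A + rank_of M B"
proof -
  obtain I where I: "I \<in> indep M" "I \<subseteq> A \<inter> B" "card I = rank_of M (A \<inter> B)"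
    using rank_witness by blast
  obtain J where J: "J \<in> indep M" "I \<subseteq> J" "J \<subseteq> A \<union> B" "card J = rank_of M (A \<union> B)"
    using extend_to_rank[of I "A \<union> B"] I by blast
  have fJ: "finite J" using J finite_indep by blast
  have "card J + card I \<le> card J + card (J \<inter> A \<inter> B)"
    using I J fJ by (intro add_left_mono card_mono) auto
  also have "\<dots> = card (J \<inter> A) + card (J \<inter> B)"
    using card_Un_Int[of "J \<inter> A" "J \<inter> B"] fJ J(3)
    by (metis Int_Un_distrib Int_absorb2 finite_Int inf_assoc inf_left_commute inf_left_idem)
  also have "\<dots> \<le> rank_of M A + rank_of M B"
    using J indep_subset by (intro add_mono card_le_rank) auto
  finally show ?thesis using I J by simp
qed

lemma rank_Un_le: "rank_of M (A \<union> B) \<le> rank_of M A + rank_of M B"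
  using rank_submodular[of A B] by simp

lemma rank_le_card: "finite A \<Longrightarrow> rank_of M A \<le> card A"
  using rank_witness[of A] card_mono by metis

lemma indep_iff_rank: "A \<in> indep M \<longleftrightarrow> finite A \<and> rank_of M A = card A"
proof
  assume "A \<in> indep M"
  then show "finite A \<and> rank_of M A = card A"
    using finite_indep card_le_rank[of A A] rank_le_card by (simp add: le_antisym)
next
  assume A: "finite A \<and> rank_of M A = card A"
  then show "A \<in> indep M"
    using rank_witness[of A] by (metis card_subset_eq)
qed

lemma rank_indep: "A \<in> indep M \<Longrightarrow> rank_of M A = card A"
  using indep_iff_rank by blast

lemma rank_Int_nonloops: "rank_of M (A \<inter> nonloops M) = rank_of M A"
proof -
  have "{I \<in> indep M. I \<subseteq> A \<inter> nonloops M} = {I \<in> indep M. I \<subseteq> A}"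
    using indep_subset_nonloops by blast
  then show ?thesis by (simp add: rank_of_def)
qed

lemma rank_nonloop: "e \<in> nonloops M \<Longrightarrow> rank_of M {e} = 1"
  using rank_indep by (fastforce simp: nonloops_def)

lemma rank_pos: "e \<in> nonloops M \<Longrightarrow> e \<in> A \<Longrightarrow> 0 < rank_of M A"
  using rank_nonloop[of e] rank_mono[of "{e}" A] by simp

lemma rank_absorb_mono:
  assumes "rank_of M (insert e A) = rank_of M A" "A \<subseteq> B"
  shows "rank_of M (insert e B) = rank_of M B"
proof -
  have "B \<union> insert e A = insert e B" using assms by blast
  then have "rank_of M (insert e B) + rank_of M (B \<inter> insert e A) \<le> rank_of M B + rank_of M A"
    using rank_submodular[of B "insert e A"] assms(1) by simp
  moreover have "rank_of M A \<le> rank_of M (B \<inter> insert e A)"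
    using assms by (intro rank_mono) blast
  ultimately show ?thesis using rank_mono[of B "insert e B"] by fastforce
qed

lemma rank_absorb:
  assumes "\<And>e. e \<in> B \<Longrightarrow> rank_of M (insert e A) = rank_of M A"
  shows "rank_of M (A \<union> B) = rank_of M A"
proof (rule ccontr)
  assume "rank_of M (A \<union> B) \<noteq> rank_of M A"
  then have less: "rank_of M A < rank_of M (A \<union> B)"
    using rank_mono[of A "A \<union> B"] by simp
  obtain I where I: "I \<in> indep M" "I \<subseteq> A \<union> B" "card I = rank_of M (A \<union> B)"
    using rank_witness by blast
  obtain J where J: "J \<in> indep M" "J \<subseteq> A" "card J = rank_of M A"
    using rank_witness by blast
  obtain e where e: "e \<in> I - J" "insert e J \<in> indep M"
    using augment I J less by metis
  have "card (insert e J) = Suc (rank_of M A)"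
    using e J finite_indep by simp
  moreover have "card (insert e J) \<le> rank_of M (insert e A)"
    using e J by (intro card_le_rank) auto
  moreover have "rank_of M (insert e A) = rank_of M A"
    using e I assms by (metis DiffD1 UnE insert_absorb subsetD)
  ultimately show False by simp
qed

lemma flat_subset_nonloops: "flat M F \<Longrightarrow> F \<subseteq> nonloops M"
  by (simp add: flat_def)

lemma flat_finite: "flat M F \<Longrightarrow> finite F"
  using flat_subset_nonloops finite_nonloops finite_subset by blast

lemma flat_absorbs:
  "flat M F \<Longrightarrow> e \<in> nonloops M \<Longrightarrow> rank_of M (insert e F) = rank_of M F \<Longrightarrow> e \<in> F"
  by (force simp: flat_def)

lemma subset_span_of: "A \<subseteq> nonloops M \<Longrightarrow> A \<subseteq> span_of M A"
  by (auto simp: span_of_def insert_absorb)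

lemma rank_Un_span_of: "rank_of M (A \<union> span_of M A) = rank_of M A"
  by (rule rank_absorb) (simp add: span_of_def)

lemma rank_span_of: "A \<subseteq> nonloops M \<Longrightarrow> rank_of M (span_of M A) = rank_of M A"
  using rank_Un_span_of[of A] subset_span_of[of A] by (simp add: sup.absorb2)

lemma flat_span_of: "A \<subseteq> nonloops M \<Longrightarrow> flat M (span_of M A)"
proof -
  assume A: "A \<subseteq> nonloops M"
  have "rank_of M (span_of M A) < rank_of M (insert e (span_of M A))"
    if e: "e \<in> nonloops M - span_of M A" for e
  proof -
    have "rank_of M (insert e A) \<noteq> rank_of M A"
      using e by (simp add: span_of_def)
    then have "rank_of M A < rank_of M (insert e A)"
      using rank_mono[of A "insert e A"] by (simp add: order.strict_iff_order subset_insertI)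
    also have "\<dots> \<le> rank_of M (insert e (span_of M A))"
      using subset_span_of[OF A] by (intro rank_mono) blast
    finally show ?thesis using rank_span_of[OF A] by simp
  qed
  then show ?thesis by (auto simp: flat_def span_of_def)
qed

lemma flat_Int:
  assumes "flat M F" "flat M G"
  shows "flat M (F \<inter> G)"
proof -
  have "rank_of M (F \<inter> G) < rank_of M (insert e (F \<inter> G))"
    if e: "e \<in> nonloops M - F \<inter> G" for e
  proof (rule ccontr)
    assume "\<not> ?thesis"
    then have "rank_of M (insert e (F \<inter> G)) = rank_of M (F \<inter> G)"
      using rank_mono[of "F \<inter> G" "insert e (F \<inter> G)"] by (simp add: subset_insertI)
    then have "rank_of M (insert e F) = rank_of M F" "rank_of M (insert e G) = rank_of M G"
      using rank_absorb_mono by blast+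
    then show False using e assms flat_absorbs by blast
  qed
  then show ?thesis using assms by (auto simp: flat_def)
qed

lemma flat_rank_pos: "flat M F \<Longrightarrow> F \<noteq> {} \<Longrightarrow> 0 < rank_of M F"
  using flat_subset_nonloops rank_pos by blast

lemma inseparable_nonempty: "inseparable M A \<Longrightarrow> A \<noteq> {}"
  by (simp add: inseparable_def)

lemma inseparableD:
  "inseparable M A \<Longrightarrow> Y \<union> Z = A \<Longrightarrow> Y \<inter> Z = {} \<Longrightarrow> rank_of M Y + rank_of M Z \<le> rank_of M A
    \<Longrightarrow> Y = {} \<or> Z = {}"
proof (rule ccontr)
  assume *: "inseparable M A" "Y \<union> Z = A" "Y \<inter> Z = {}" "rank_of M Y + rank_of M Z \<le> rank_of M A"
    "\<not> (Y = {} \<or> Z = {})"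
  then have "rank_of M A < rank_of M Y + rank_of M Z"
    unfolding inseparable_def by blast
  then show False using * by simp
qed

lemma separableE:
  assumes "A \<noteq> {}" "\<not> inseparable M A"
  obtains Y Z where "Y \<union> Z = A" "Y \<inter> Z = {}" "Y \<noteq> {}" "Z \<noteq> {}"
    "rank_of M Y + rank_of M Z = rank_of M A"
proof -
  obtain Y Z where YZ: "Y \<union> Z = A" "Y \<inter> Z = {}" "Y \<noteq> {}" "Z \<noteq> {}"
    "rank_of M Y + rank_of M Z \<le> rank_of M A"
    using assms unfolding inseparable_def by (auto simp: not_less)
  moreover have "rank_of M A \<le> rank_of M Y + rank_of M Z"
    using rank_Un_le[of Y Z] YZ by simp
  ultimately show ?thesis using that by (simp add: le_antisym)
qed

text \<open>
  A nonloop \<open>e\<close> of the other part raises the rank by submodularity: \<open>Z\<close> meets \<open>insert e Y\<close> only in \<open>e\<close>.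
\<close>

lemma flat_separation_part:
  assumes "flat M X" "Y \<union> Z = X" "Y \<inter> Z = {}" "rank_of M Y + rank_of M Z = rank_of M X"
  shows "flat M Y"
proof -
  have "rank_of M Y < rank_of M (insert e Y)" if e: "e \<in> nonloops M - Y" for e
  proof (cases "e \<in> Z")
    case True
    have "rank_of M (insert e Y \<union> Z) + rank_of M (insert e Y \<inter> Z) \<le> rank_of M (insert e Y) + rank_of M Z"
      by (rule rank_submodular)
    moreover have "insert e Y \<union> Z = X" "insert e Y \<inter> Z = {e}" using True assms by auto
    moreover have "rank_of M {e} = 1" using e rank_nonloop by blast
    ultimately show ?thesis using assms(4) by simp
  next
    case False
    show ?thesis
    proof (rule ccontr)
      assume "\<not> ?thesis"
      then have "rank_of M (insert e Y) = rank_of M Y"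
        using rank_mono[of Y "insert e Y"] by (simp add: subset_insertI)
      then have "rank_of M (insert e X) = rank_of M X"
        using rank_absorb_mono assms(2) by blast
      then show False using flat_absorbs[OF assms(1)] e False assms(2) by blast
    qed
  qed
  then show ?thesis using assms flat_subset_nonloops[OF assms(1)] by (auto simp: flat_def)
qed

lemma inseparable_nonloops_unless_singleton:
  assumes "inseparable M A" "e \<in> A" "e \<notin> nonloops M"
  shows "A = {e}"
proof -
  have "{e} \<inter> nonloops M = {}" using assms by blast
  then have "rank_of M {e} = 0" using rank_Int_nonloops[of "{e}"] rank_empty by simp
  then have "rank_of M {e} + rank_of M (A - {e}) \<le> rank_of M A"
    using rank_mono[of "A - {e}" A] by auto
  then have "A - {e} = {}"
    using inseparableD[OF assms(1), of "{e}" "A - {e}"] assms(2) by blast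
  then show ?thesis using assms(2) by blast
qed

text \<open>
  A basis \<open>B\<close> of \<open>F\<close> that contains a basis of \<open>A\<close> has too few elements in \<open>C\<close> to span \<open>C\<close>; adding
  a missing element \<open>j\<close> of \<open>C\<close> to the part of \<open>B\<close> in \<open>C\<close> and completing inside \<open>insert j B\<close> drops
  an element of \<open>A\<close>.
\<close>

lemma exchange_across_nonseparator:
  assumes "inseparable M F" "A \<union> C = F" "A \<inter> C = {}" "A \<noteq> {}" "C \<noteq> {}"
  shows "\<exists>B i j. B \<in> indep M \<and> B \<subseteq> F \<and> card B = rank_of M F \<and> i \<in> A \<inter> B \<and> j \<in> C - B \<and>
           insert j (B - {i}) \<in> indep M"
proof -
  have sep: "rank_of M F < rank_of M A + rank_of M C"
    using inseparableD[OF assms(1-3)] assms(4,5) by (meson not_less)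
  obtain B1 where B1: "B1 \<in> indep M" "B1 \<subseteq> A" "card B1 = rank_of M A"
    using rank_witness by blast
  obtain B where B: "B \<in> indep M" "B1 \<subseteq> B" "B \<subseteq> F" "card B = rank_of M F"
    using extend_to_rank[of B1 F] B1 assms by blast
  have fB: "finite B" using B finite_indep by blast
  have "B \<inter> A \<in> indep M" using B indep_subset by blast
  then have "card (B \<inter> A) \<le> rank_of M A" by (intro card_le_rank) auto
  moreover have "card B1 \<le> card (B \<inter> A)" using B B1 fB by (intro card_mono) auto
  ultimately have cA: "card (B \<inter> A) = rank_of M A" using B1 by simp
  have "card B = card (B \<inter> A) + card (B \<inter> C)"
  proof -
    have "B = (B \<inter> A) \<union> (B \<inter> C)" using B(3) assms(2) by blast
    moreover have "(B \<inter> A) \<inter> (B \<inter> C) = {}" using assms(3) by blast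
    ultimately show ?thesis using card_Un_disjoint[of "B \<inter> A" "B \<inter> C"] fB by simp
  qed
  then have cC: "card (B \<inter> C) < rank_of M C" using cA sep B by linarith
  have BC: "B \<inter> C \<in> indep M" using B indep_subset by blast
  obtain D where D: "D \<in> indep M" "D \<subseteq> C" "card D = rank_of M C" using rank_witness by blast
  obtain j where j: "j \<in> D - B \<inter> C" "insert j (B \<inter> C) \<in> indep M"
    using augment[OF BC D(1)] cC D by auto
  have jC: "j \<in> C" "j \<notin> B" using j D by auto
  have "rank_of M (insert j B) = rank_of M F"
  proof (rule antisym)
    show "rank_of M (insert j B) \<le> rank_of M F" using B jC assms by (intro rank_mono) auto
    show "rank_of M F \<le> rank_of M (insert j B)" using B card_le_rank[of B "insert j B"] by auto
  qed
  then obtain B' where B': "B' \<in> indep M" "insert j (B \<inter> C) \<subseteq> B'" "B' \<subseteq> insert j B" "card B' = card B"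
    using extend_to_rank[OF j(2), of "insert j B"] B by auto
  have "\<not> B \<subseteq> B'"
  proof
    assume "B \<subseteq> B'"
    then have "insert j B \<subseteq> B'" using B' by blast
    then have "card (insert j B) \<le> card B'" using B' finite_indep card_mono by blast
    then show False using B' jC fB by simp
  qed
  then obtain i where i: "i \<in> B" "i \<notin> B'" by blast
  then have iA: "i \<in> A" using B B' assms by blast
  have "B' \<subseteq> insert j (B - {i})" using B' i by blast
  moreover have "card (insert j (B - {i})) = card B'"
  proof -
    have "card (insert j (B - {i})) = Suc (card (B - {i}))" using jC fB by simp
    also have "\<dots> = card B" using i fB by (metis card_Suc_Diff1)
    finally show ?thesis using B' by simp
  qed
  ultimately have "B' = insert j (B - {i})" using fB by (intro card_subset_eq) auto
  then show ?thesis using B B' i iA jC by blast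
qed

end

section \<open>Integer decomposition\<close>

text \<open>
  The Hahn-Banach argument: the value at a new point \<open>e\<close> may be any \<open>t\<close> between
  \<open>max\<^sub>A (g (A + e) - r A)\<close> and \<open>min\<^sub>B (r (B + e) - g B)\<close>, and the two semimodularities say that this
  interval is nonempty. The maximum is an integer. For every such \<open>t\<close>, the pair
  \<open>A \<mapsto> max (g A) (g (A + e) - t)\<close> and \<open>A \<mapsto> min (r A) (r (A + e) - t)\<close> satisfies the hypotheses on
  the smaller ground set.
\<close>

lemma discrete_sandwich:
  fixes r g :: "'a set \<Rightarrow> int"
  assumes "finite E"
    and "\<And>A B. A \<subseteq> E \<Longrightarrow> B \<subseteq> E \<Longrightarrow> r (A \<union> B) + r (A \<inter> B) \<le> r A + r B"
    and "\<And>A B. A \<subseteq> E \<Longrightarrow> B \<subseteq> E \<Longrightarrow> g A + g B \<le> g (A \<union> B) + g (A \<inter> B)"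
    and "\<And>A. A \<subseteq> E \<Longrightarrow> g A \<le> r A"
    and "r {} = 0" and "g {} = 0"
  shows "\<exists>m. \<forall>A\<subseteq>E. g A \<le> sum m A \<and> sum m A \<le> r A"
  using assms
proof (induction E arbitrary: r g rule: finite_induct)
  case empty
  then show ?case by simp
next
  case (insert e E r g)
  note sub = insert.prems(1) and sup = insert.prems(2) and le = insert.prems(3)
  define t where "t = Max ((\<lambda>A. g (insert e A) - r A) ` Pow E)"
  have fin: "finite ((\<lambda>A. g (insert e A) - r A) ` Pow E)" using insert by simp
  have lower: "g (insert e A) - r A \<le> t" if "A \<subseteq> E" for A
    unfolding t_def using fin that by (intro Max_ge) auto
  have "t \<in> (\<lambda>A. g (insert e A) - r A) ` Pow E"
    unfolding t_def using fin by (intro Max_in) auto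
  then obtain A0 where A0: "A0 \<subseteq> E" "t = g (insert e A0) - r A0" by auto
  have upper: "t \<le> r (insert e B) - g B" if B: "B \<subseteq> E" for B
  proof -
    have un: "insert e A0 \<union> B = insert e (A0 \<union> B)" "A0 \<union> insert e B = insert e (A0 \<union> B)"
      by auto
    have int: "insert e A0 \<inter> B = A0 \<inter> B" "A0 \<inter> insert e B = A0 \<inter> B"
      using A0 B insert.hyps by auto
    have "g (insert e A0) + g B \<le> g (insert e (A0 \<union> B)) + g (A0 \<inter> B)"
      using sup[of "insert e A0" B] A0 B un int by auto
    also have "\<dots> \<le> r (insert e (A0 \<union> B)) + r (A0 \<inter> B)"
      using A0 B by (intro add_mono le) auto
    also have "\<dots> \<le> r A0 + r (insert e B)"
      using sub[of A0 "insert e B"] A0 B un int by auto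
    finally show ?thesis using A0 by simp
  qed
  define r' where "r' = (\<lambda>A. min (r A) (r (insert e A) - t))"
  define g' where "g' = (\<lambda>A. max (g A) (g (insert e A) - t))"
  have "\<exists>m. \<forall>A\<subseteq>E. g' A \<le> sum m A \<and> sum m A \<le> r' A"
  proof (rule insert.IH)
    fix A B assume AB: "A \<subseteq> E" "B \<subseteq> E"
    have int: "insert e A \<inter> B = A \<inter> B" "A \<inter> insert e B = A \<inter> B"
        "insert e A \<inter> insert e B = insert e (A \<inter> B)"
      using AB insert.hyps by auto
    have un: "insert e A \<union> B = insert e (A \<union> B)" "A \<union> insert e B = insert e (A \<union> B)"
        "insert e A \<union> insert e B = insert e (A \<union> B)"
      by auto
    have sets: "A \<subseteq> insert e E" "B \<subseteq> insert e E" "insert e A \<subseteq> insert e E"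
        "insert e B \<subseteq> insert e E"
      using AB by auto
    show "r' (A \<union> B) + r' (A \<inter> B) \<le> r' A + r' B"
      using sub[OF sets(1,2)] sub[OF sets(1,4)] sub[OF sets(3,2)] sub[OF sets(3,4)]
      unfolding int un r'_def by linarith
    show "g' A + g' B \<le> g' (A \<union> B) + g' (A \<inter> B)"
      using sup[OF sets(1,2)] sup[OF sets(1,4)] sup[OF sets(3,2)] sup[OF sets(3,4)]
      unfolding int un g'_def by linarith
  next
    fix A assume A: "A \<subseteq> E"
    have "A \<subseteq> insert e E" "insert e A \<subseteq> insert e E" using A by auto
    then show "g' A \<le> r' A"
      using le[of A] le[of "insert e A"] lower[OF A] upper[OF A] unfolding g'_def r'_def by linarith
  next
    show "r' {} = 0" "g' {} = 0"
      using lower[of "{}"] upper[of "{}"] insert.prems(4,5) unfolding g'_def r'_def by auto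
  qed
  then obtain m where m: "\<And>A. A \<subseteq> E \<Longrightarrow> g' A \<le> sum m A \<and> sum m A \<le> r' A" by blast
  have "g A \<le> sum (m(e := t)) A \<and> sum (m(e := t)) A \<le> r A" if A: "A \<subseteq> insert e E" for A
  proof (cases "e \<in> A")
    case True
    define A' where "A' = A - {e}"
    have A': "A = insert e A'" "e \<notin> A'" "A' \<subseteq> E" using True A by (auto simp: A'_def)
    then have "sum (m(e := t)) A = t + sum m A'"
      using insert.hyps finite_subset[of A' E] by (auto intro!: sum.cong)
    then show ?thesis using m[of A'] A' unfolding g'_def r'_def by auto
  next
    case False
    then have "sum (m(e := t)) A = sum m A" by (intro sum.cong) auto
    moreover have "A \<subseteq> E" using False A by blast
    ultimately show ?thesis using m[of A] unfolding g'_def r'_def by auto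
  qed
  then show ?case by blast
qed

context
  fixes M :: "'a set_system"
  assumes M: "matroid M"
begin

text \<open>
  An independent set \<open>J\<close> in the support of \<open>x\<close> can be subtracted if \<open>card (A \<inter> J) \<ge> h A\<close> for all
  \<open>A\<close>, where \<open>h A = x(A) - k * rank A\<close> is supermodular. The sandwich theorem is applied to the rank function of the support of
  \<open>x\<close>, which keeps \<open>J\<close> in the support, and to the monotone hull of \<open>h\<close>, which makes the modular
  function in between nonnegative, hence the indicator of a set.
\<close>

lemma peel_off_independent_set:
  fixes x :: "'a \<Rightarrow> nat"
  assumes x: "\<And>A. A \<subseteq> ground M \<Longrightarrow> sum x A \<le> Suc k * rank_of M A"
  shows "\<exists>J\<in>indep M. (\<forall>e\<in>J. 0 < x e) \<and>
           (\<forall>A\<subseteq>ground M. (\<Sum>e\<in>A. x e - of_bool (e \<in> J)) \<le> k * rank_of M A)"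
proof -
  define S where "S = {e. 0 < x e}"
  define r where "r = (\<lambda>A. int (rank_of M (A \<inter> S)))"
  define h where "h = (\<lambda>A. int (sum x A) - int k * int (rank_of M A))"
  define g where "g = (\<lambda>A. Max (h ` Pow A))"
  note fin = finite_subset[OF _ finite_ground[OF M]]
  have h_le_g: "h B \<le> g A" if "B \<subseteq> A" "A \<subseteq> ground M" for A B
    unfolding g_def using that fin by (intro Max_ge) auto
  have g_attained: "\<exists>B\<subseteq>A. g A = h B" if "A \<subseteq> ground M" for A
  proof -
    have "g A \<in> h ` Pow A" unfolding g_def using fin[OF that] by (intro Max_in) auto
    then show ?thesis by auto
  qed
  have h_super: "h A + h B \<le> h (A \<union> B) + h (A \<inter> B)" if "A \<subseteq> ground M" "B \<subseteq> ground M" for A B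
  proof -
    have "sum x (A \<union> B) + sum x (A \<inter> B) = sum x A + sum x B"
      using that fin by (intro sum.union_inter) auto
    then have "int (sum x (A \<union> B)) + int (sum x (A \<inter> B)) = int (sum x A) + int (sum x B)"
      by (simp only: flip: of_nat_add)
    moreover have "int (rank_of M (A \<union> B)) + int (rank_of M (A \<inter> B))
        \<le> int (rank_of M A) + int (rank_of M B)"
      using rank_submodular[OF M, of A B] by simp
    then have "int k * int (rank_of M (A \<union> B)) + int k * int (rank_of M (A \<inter> B))
        \<le> int k * int (rank_of M A) + int k * int (rank_of M B)"
      unfolding distrib_left[symmetric] by (intro mult_left_mono) auto
    ultimately show ?thesis unfolding h_def by linarith
  qed
  have "\<exists>m. \<forall>A\<subseteq>ground M. g A \<le> sum m A \<and> sum m A \<le> r A"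
  proof (rule discrete_sandwich[OF finite_ground[OF M]])
    fix A B
    have "(A \<union> B) \<inter> S = (A \<inter> S) \<union> (B \<inter> S)" "A \<inter> B \<inter> S = (A \<inter> S) \<inter> (B \<inter> S)" by auto
    then show "r (A \<union> B) + r (A \<inter> B) \<le> r A + r B"
      using rank_submodular[OF M, of "A \<inter> S" "B \<inter> S"] unfolding r_def by simp
  next
    fix A B assume AB: "A \<subseteq> ground M" "B \<subseteq> ground M"
    obtain A' where A': "A' \<subseteq> A" "g A = h A'" using g_attained[OF AB(1)] by blast
    obtain B' where B': "B' \<subseteq> B" "g B = h B'" using g_attained[OF AB(2)] by blast
    note A'B' = A' B'
    have "g A + g B \<le> h (A' \<union> B') + h (A' \<inter> B')"
      using h_super[of A' B'] A'B' AB by simp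
    also have "\<dots> \<le> g (A \<union> B) + g (A \<inter> B)"
      using A'B' AB by (intro add_mono h_le_g) auto
    finally show "g A + g B \<le> g (A \<union> B) + g (A \<inter> B)" .
  next
    fix A assume A: "A \<subseteq> ground M"
    obtain B where B: "B \<subseteq> A" "g A = h B" using g_attained[OF A] by blast
    have "sum x B = sum x (B \<inter> S)"
      using B A fin by (intro sum.mono_neutral_right) (auto simp: S_def)
    also have "\<dots> \<le> Suc k * rank_of M (B \<inter> S)" using A B by (intro x) auto
    also have "\<dots> = rank_of M (B \<inter> S) + k * rank_of M (B \<inter> S)" by simp
    also have "\<dots> \<le> rank_of M (A \<inter> S) + k * rank_of M B"
      using B by (intro add_mono mult_le_mono2 rank_mono[OF M]) auto
    finally show "g A \<le> r A" unfolding B(2) h_def r_def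
      by (metis diff_le_eq of_nat_add of_nat_le_iff of_nat_mult)
  next
    show "r {} = 0" "g {} = 0" using rank_empty[OF M] by (simp_all add: r_def g_def h_def)
  qed
  then obtain m where m: "\<And>A. A \<subseteq> ground M \<Longrightarrow> g A \<le> sum m A \<and> sum m A \<le> r A" by blast
  define J where "J = {e \<in> ground M. m e = 1}"
  have m01: "m e = of_bool (e \<in> J)" "e \<in> J \<longrightarrow> 0 < x e" if e: "e \<in> ground M" for e
  proof -
    have "0 \<le> m e" using m[of "{e}"] h_le_g[of "{}" "{e}"] e rank_empty[OF M] by (simp add: h_def)
    moreover have "m e \<le> r {e}" using m[of "{e}"] e by simp
    moreover have "r {e} \<le> of_bool (0 < x e)"
      using rank_le_card[OF M, of "{e} \<inter> S"] by (auto simp: r_def S_def)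
    ultimately show "m e = of_bool (e \<in> J)" "e \<in> J \<longrightarrow> 0 < x e" using e by (auto simp: J_def of_bool_def split: if_splits)
  qed
  have sum_m: "sum m A = int (card (A \<inter> J))" if "A \<subseteq> ground M" for A
  proof -
    have "sum m A = (\<Sum>e\<in>A. of_bool (e \<in> J))" using m01 that by (intro sum.cong) auto
    then show ?thesis using fin[OF that] by (simp add: sum_of_bool_eq Int_def)
  qed
  have J: "J \<subseteq> ground M" by (auto simp: J_def)
  have "int (card J) \<le> int (rank_of M J)"
    using m[OF J] sum_m[OF J] rank_mono[OF M, of "J \<inter> S" J] unfolding r_def by simp
  then have "J \<in> indep M" using indep_iff_rank[OF M, of J] rank_le_card[OF M, of J] fin[OF J] by simp
  moreover have "(\<Sum>e\<in>A. x e - of_bool (e \<in> J)) \<le> k * rank_of M A" if A: "A \<subseteq> ground M" for A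
  proof -
    have "int (\<Sum>e\<in>A. x e - of_bool (e \<in> J)) = (\<Sum>e\<in>A. int (x e) - m e)"
      unfolding of_nat_sum using m01 A by (intro sum.cong) (auto simp: of_nat_diff Suc_le_eq)
    also have "\<dots> = int (sum x A) - sum m A" by (simp add: sum_subtractf)
    also have "\<dots> \<le> int (sum x A) - h A" using m[OF A] h_le_g[of A A] A by simp
    also have "\<dots> = int (k * rank_of M A)" by (simp add: h_def)
    finally show ?thesis by (simp only: of_nat_le_iff)
  qed
  ultimately show ?thesis using m01 J by blast
qed

lemma independent_decomposition:
  fixes x :: "'a \<Rightarrow> nat"
  assumes "\<And>A. A \<subseteq> ground M \<Longrightarrow> sum x A \<le> k * rank_of M A"
  shows "\<exists>I. (\<forall>i<k. I i \<in> indep M) \<and> (\<forall>e\<in>ground M. x e = (\<Sum>i<k. of_bool (e \<in> I i)))"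
  using assms
proof (induction k arbitrary: x)
  case 0
  have "x e = 0" if "e \<in> ground M" for e using 0[of "{e}"] that by simp
  then show ?case by simp
next
  case (Suc k)
  obtain J where J: "J \<in> indep M" "\<And>e. e \<in> J \<Longrightarrow> 0 < x e"
    "\<And>A. A \<subseteq> ground M \<Longrightarrow> (\<Sum>e\<in>A. x e - of_bool (e \<in> J)) \<le> k * rank_of M A"
    using peel_off_independent_set[OF Suc.prems] by blast
  obtain I where I: "\<forall>i<k. I i \<in> indep M"
    "\<And>e. e \<in> ground M \<Longrightarrow> x e - of_bool (e \<in> J) = (\<Sum>i<k. of_bool (e \<in> I i))"
    using Suc.IH[OF J(3)] by blast
  have "x e = (\<Sum>i<Suc k. of_bool (e \<in> (I(k := J)) i))" if "e \<in> ground M" for e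
  proof -
    have "(\<Sum>i<k. of_bool (e \<in> (I(k := J)) i)) = x e - of_bool (e \<in> J)"
      using I(2)[OF that] by simp
    then show ?thesis using J(2)[of e] by (auto simp: of_bool_def)
  qed
  moreover have "\<forall>i<Suc k. (I(k := J)) i \<in> indep M" using I J by (simp add: less_Suc_eq)
  ultimately show ?case by blast
qed

end

section \<open>Direct sums\<close>

lemma direct_sum2_commute: "direct_sum2 N1 N2 = direct_sum2 N2 N1"
  unfolding direct_sum2_def by (auto simp: Un_commute)

lemma ground_direct_sum2: "ground (direct_sum2 N1 N2) = ground N1 \<union> ground N2"
  by (simp add: direct_sum2_def)

lemma direct_sum2_assoc: "direct_sum2 (direct_sum2 N1 N2) N3 = direct_sum2 N1 (direct_sum2 N2 N3)"
proof -
  have "{I \<union> J |I J. I \<in> {I \<union> J |I J. I \<in> indep N1 \<and> J \<in> indep N2} \<and> J \<in> indep N3} =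
    {I \<union> J |I J. I \<in> indep N1 \<and> J \<in> {I \<union> J |I J. I \<in> indep N2 \<and> J \<in> indep N3}}"
    (is "?L = ?R")
  proof
    show "?L \<subseteq> ?R" using Un_assoc by blast
    show "?R \<subseteq> ?L" using Un_assoc by (smt (verit, best) mem_Collect_eq subsetI)
  qed
  then show ?thesis by (simp add: direct_sum2_def Un_assoc)
qed

lemma direct_sum_Nil: "direct_sum [] = \<lparr>ground = {}, indep = {{}}\<rparr>"
  by (simp add: direct_sum_def)

lemma direct_sum_Cons: "direct_sum (M # Ms) = direct_sum2 M (direct_sum Ms)"
  by (simp add: direct_sum_def)

lemma direct_sum_append: "direct_sum (Ms @ Ns) = direct_sum2 (direct_sum Ms) (direct_sum Ns)"
  by (induction Ms) (simp_all add: direct_sum_Cons direct_sum2_assoc, simp add: direct_sum_Nil direct_sum2_def)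

lemma direct_sum_singleton: "direct_sum [M] = M"
  by (simp add: direct_sum_def direct_sum2_def)

lemma ground_direct_sum: "ground (direct_sum Ms) = \<Union> (ground ` set Ms)"
  by (induction Ms) (simp_all add: direct_sum_Nil direct_sum_Cons ground_direct_sum2)

lemma pairwise_disjoint_grounds_sorted_wrt:
  "pairwise_disjoint_grounds Ms \<longleftrightarrow> sorted_wrt (\<lambda>M N. ground M \<inter> ground N = {}) Ms"
  unfolding pairwise_disjoint_grounds_def sorted_wrt_iff_nth_less
proof (intro iffI allI impI)
  fix i j
  assume *: "\<forall>i j. i < j \<longrightarrow> j < length Ms \<longrightarrow> ground (Ms ! i) \<inter> ground (Ms ! j) = {}"
    "i < length Ms" "j < length Ms" "i \<noteq> j"
  then consider "i < j" | "j < i" by linarith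
  then show "ground (Ms ! i) \<inter> ground (Ms ! j) = {}" using * by cases blast+
next
  fix i j
  assume *: "\<forall>i<length Ms. \<forall>j<length Ms. i \<noteq> j \<longrightarrow> ground (Ms ! i) \<inter> ground (Ms ! j) = {}"
    "i < j" "j < length Ms"
  then have "i < length Ms" "i \<noteq> j" by auto
  then show "ground (Ms ! i) \<inter> ground (Ms ! j) = {}" using * by blast
qed

context
  fixes N1 N2 :: "'a set_system"
  assumes N1: "matroid N1" and N2: "matroid N2" and disj: "ground N1 \<inter> ground N2 = {}"
begin

lemma indep_direct_sum2:
  "I \<in> indep (direct_sum2 N1 N2) \<longleftrightarrow>
     I \<subseteq> ground N1 \<union> ground N2 \<and> I \<inter> ground N1 \<in> indep N1 \<and> I \<inter> ground N2 \<in> indep N2"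
proof
  assume "I \<in> indep (direct_sum2 N1 N2)"
  then obtain I1 I2 where I: "I = I1 \<union> I2" "I1 \<in> indep N1" "I2 \<in> indep N2"
    by (auto simp: direct_sum2_def)
  moreover have "I1 \<subseteq> ground N1" "I2 \<subseteq> ground N2"
    using I indep_subset_ground N1 N2 by blast+
  ultimately have "I \<inter> ground N1 = I1" "I \<inter> ground N2 = I2" using disj by auto
  then show "I \<subseteq> ground N1 \<union> ground N2 \<and> I \<inter> ground N1 \<in> indep N1 \<and> I \<inter> ground N2 \<in> indep N2"
    using I \<open>I1 \<subseteq> ground N1\<close> \<open>I2 \<subseteq> ground N2\<close> by auto
next
  assume *: "I \<subseteq> ground N1 \<union> ground N2 \<and> I \<inter> ground N1 \<in> indep N1 \<and> I \<inter> ground N2 \<in> indep N2"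
  then have "I = (I \<inter> ground N1) \<union> (I \<inter> ground N2)" by blast
  then show "I \<in> indep (direct_sum2 N1 N2)" using * unfolding direct_sum2_def by auto
qed

lemma card_direct_sum2:
  assumes "I \<in> indep (direct_sum2 N1 N2)"
  shows "card I = card (I \<inter> ground N1) + card (I \<inter> ground N2)"
proof -
  have "I = (I \<inter> ground N1) \<union> (I \<inter> ground N2)" using assms indep_direct_sum2 by blast
  then show ?thesis
    using card_Un_disjoint[of "I \<inter> ground N1" "I \<inter> ground N2"] disj finite_ground[OF N1] finite_ground[OF N2]
    by (metis finite_Int inf_assoc inf_bot_right inf_left_commute)
qed

lemma matroid_direct_sum2: "matroid (direct_sum2 N1 N2)"
  unfolding matroid_def
proof (intro conjI ballI allI impI)
  show "finite (ground (direct_sum2 N1 N2))"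
    using finite_ground[OF N1] finite_ground[OF N2] by (simp add: ground_direct_sum2)
  show "indep (direct_sum2 N1 N2) \<subseteq> Pow (ground (direct_sum2 N1 N2))"
    using indep_direct_sum2 by (auto simp: ground_direct_sum2)
  show "{} \<in> indep (direct_sum2 N1 N2)"
    using indep_direct_sum2 empty_indep N1 N2 by auto
next
  fix I J assume "I \<in> indep (direct_sum2 N1 N2)" "J \<subseteq> I"
  then show "J \<in> indep (direct_sum2 N1 N2)"
    unfolding indep_direct_sum2 using indep_subset[OF N1] indep_subset[OF N2]
    by (meson Int_mono subset_refl subset_trans)
next
  fix I J assume IJ: "I \<in> indep (direct_sum2 N1 N2)" "J \<in> indep (direct_sum2 N1 N2)" "card I < card J"
  then consider "card (I \<inter> ground N1) < card (J \<inter> ground N1)" | "card (I \<inter> ground N2) < card (J \<inter> ground N2)"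
    using card_direct_sum2 by (metis add_mono leI leD)
  then show "\<exists>e\<in>J - I. insert e I \<in> indep (direct_sum2 N1 N2)"
  proof cases
    case 1
    then obtain e where e: "e \<in> J \<inter> ground N1 - I \<inter> ground N1" "insert e (I \<inter> ground N1) \<in> indep N1"
      using augment[OF N1] IJ indep_direct_sum2 by metis
    then have "insert e I \<inter> ground N1 = insert e (I \<inter> ground N1)" "insert e I \<inter> ground N2 = I \<inter> ground N2"
      using disj by auto
    then have "insert e I \<in> indep (direct_sum2 N1 N2)" using e IJ indep_direct_sum2 by auto
    then show ?thesis using e by blast
  next
    case 2
    then obtain e where e: "e \<in> J \<inter> ground N2 - I \<inter> ground N2" "insert e (I \<inter> ground N2) \<in> indep N2"
      using augment[OF N2] IJ indep_direct_sum2 by metis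
    then have "insert e I \<inter> ground N2 = insert e (I \<inter> ground N2)" "insert e I \<inter> ground N1 = I \<inter> ground N1"
      using disj by auto
    then have "insert e I \<in> indep (direct_sum2 N1 N2)" using e IJ indep_direct_sum2 by auto
    then show ?thesis using e by blast
  qed
qed

lemma rank_direct_sum2: "rank_of (direct_sum2 N1 N2) A = rank_of N1 A + rank_of N2 A"
proof (rule antisym)
  obtain I where I: "I \<in> indep (direct_sum2 N1 N2)" "I \<subseteq> A" "card I = rank_of (direct_sum2 N1 N2) A"
    using rank_witness[OF matroid_direct_sum2] by blast
  then have "card (I \<inter> ground N1) \<le> rank_of N1 A" "card (I \<inter> ground N2) \<le> rank_of N2 A"
    using indep_direct_sum2 card_le_rank N1 N2 by (metis le_infI1)+
  then show "rank_of (direct_sum2 N1 N2) A \<le> rank_of N1 A + rank_of N2 A"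
    using I card_direct_sum2 by simp
next
  obtain I1 where I1: "I1 \<in> indep N1" "I1 \<subseteq> A" "card I1 = rank_of N1 A" using rank_witness[OF N1] by blast
  obtain I2 where I2: "I2 \<in> indep N2" "I2 \<subseteq> A" "card I2 = rank_of N2 A" using rank_witness[OF N2] by blast
  have "I1 \<union> I2 \<in> indep (direct_sum2 N1 N2)" using I1 I2 by (auto simp: direct_sum2_def)
  then have "card (I1 \<union> I2) \<le> rank_of (direct_sum2 N1 N2) A"
    using I1 I2 card_le_rank[OF matroid_direct_sum2] by simp
  moreover have "card (I1 \<union> I2) = card I1 + card I2"
    using I1 I2 finite_indep N1 N2 disj indep_subset_ground[OF N1 I1(1)] indep_subset_ground[OF N2 I2(1)]
    by (intro card_Un_disjoint) auto
  ultimately show "rank_of N1 A + rank_of N2 A \<le> rank_of (direct_sum2 N1 N2) A"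
    using I1 I2 by simp
qed

lemma nonloops_direct_sum2: "nonloops (direct_sum2 N1 N2) = nonloops N1 \<union> nonloops N2"
proof -
  have g: "e \<in> ground N1" if "{e} \<in> indep N1" for e using indep_subset_ground[OF N1 that] by simp
  have h: "e \<in> ground N2" if "{e} \<in> indep N2" for e using indep_subset_ground[OF N2 that] by simp
  have "{e} \<in> indep (direct_sum2 N1 N2) \<longleftrightarrow> {e} \<in> indep N1 \<or> {e} \<in> indep N2" for e
    unfolding indep_direct_sum2
    using disj empty_indep[OF N1] empty_indep[OF N2] g[of e] h[of e]
    by (cases "e \<in> ground N1"; cases "e \<in> ground N2") auto
  then show ?thesis by (auto simp: nonloops_def)
qed

lemma rank_direct_sum2_left: "A \<subseteq> ground N1 \<Longrightarrow> rank_of (direct_sum2 N1 N2) A = rank_of N1 A"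
proof -
  assume "A \<subseteq> ground N1"
  then have "A \<inter> nonloops N2 = {}" using disj nonloops_subset_ground[OF N2] by blast
  then show ?thesis
    using rank_direct_sum2 rank_Int_nonloops[OF N2, of A] rank_empty[OF N2] by simp
qed

lemma inseparable_direct_sum2_left:
  "A \<subseteq> ground N1 \<Longrightarrow> inseparable (direct_sum2 N1 N2) A \<longleftrightarrow> inseparable N1 A"
proof -
  assume A: "A \<subseteq> ground N1"
  have "rank_of (direct_sum2 N1 N2) B = rank_of N1 B" if "B \<subseteq> A" for B
    using rank_direct_sum2_left A that by simp
  then show ?thesis unfolding inseparable_def by (metis Un_upper1 Un_upper2 order_refl)
qed

lemma connected_flat_direct_sum2_left:
  assumes "F \<subseteq> nonloops N1"
  shows "connected_flat (direct_sum2 N1 N2) F \<longleftrightarrow> connected_flat N1 F"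
proof -
  have F: "F \<subseteq> ground N1" using assms nonloops_subset_ground[OF N1] by blast
  have up: "rank_of (direct_sum2 N1 N2) F < rank_of (direct_sum2 N1 N2) (insert e F)"
    if e: "e \<in> nonloops N2" for e
  proof -
    have "rank_of N2 F = 0" using rank_direct_sum2_left[OF F] rank_direct_sum2[of F] by simp
    moreover have "0 < rank_of N2 (insert e F)" using rank_pos[OF N2 e] by simp
    moreover have "rank_of N1 F \<le> rank_of N1 (insert e F)" by (intro rank_mono[OF N1]) auto
    ultimately show ?thesis using rank_direct_sum2 by simp
  qed
  have eq: "rank_of (direct_sum2 N1 N2) (insert e F) = rank_of N1 (insert e F)" if "e \<in> nonloops N1" for e
    using that F nonloops_subset_ground[OF N1] by (intro rank_direct_sum2_left) auto
  have "flat (direct_sum2 N1 N2) F \<longleftrightarrow> flat N1 F"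
    unfolding flat_def nonloops_direct_sum2
    using assms rank_direct_sum2_left[OF F] up eq by (metis Diff_iff Un_iff le_supI1)
  then show ?thesis unfolding connected_flat_def using inseparable_direct_sum2_left[OF F] by simp
qed

lemma connected_flat_direct_sum2_cases:
  assumes "connected_flat (direct_sum2 N1 N2) F"
  shows "F \<subseteq> nonloops N1 \<or> F \<subseteq> nonloops N2"
proof -
  have F: "F \<subseteq> nonloops N1 \<union> nonloops N2"
    using assms nonloops_direct_sum2 by (simp add: connected_flat_def flat_def)
  have *: "F \<inter> nonloops N1 \<inter> nonloops N2 = {}" "F \<inter> nonloops N2 \<inter> nonloops N1 = {}"
    using disj nonloops_subset_ground[OF N1] nonloops_subset_ground[OF N2] by auto
  have "rank_of N2 (F \<inter> nonloops N1) = 0" "rank_of N1 (F \<inter> nonloops N2) = 0"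
    using rank_Int_nonloops[OF N2, of "F \<inter> nonloops N1"] rank_Int_nonloops[OF N1, of "F \<inter> nonloops N2"]
      rank_empty[OF N1] rank_empty[OF N2] * by simp_all
  then have "rank_of (direct_sum2 N1 N2) (F \<inter> nonloops N1) + rank_of (direct_sum2 N1 N2) (F \<inter> nonloops N2)
      = rank_of (direct_sum2 N1 N2) F"
    unfolding rank_direct_sum2 by (simp add: rank_Int_nonloops[OF N1] rank_Int_nonloops[OF N2])
  then have "F \<inter> nonloops N1 = {} \<or> F \<inter> nonloops N2 = {}"
    using assms F * unfolding connected_flat_def
    by (intro inseparableD[OF matroid_direct_sum2, of F]) auto
  then show ?thesis using F by blast
qed

end

lemma balanced_direct_sum2:
  assumes "matroid N1" "matroid N2" "ground N1 \<inter> ground N2 = {}"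
  shows "balanced \<delta> c (direct_sum2 N1 N2) \<longleftrightarrow> balanced \<delta> c N1 \<and> balanced \<delta> c N2"
proof -
  have disj': "ground N2 \<inter> ground N1 = {}" using assms(3) by blast
  have left: "connected_flat (direct_sum2 N1 N2) F \<longleftrightarrow> connected_flat N1 F"
      "rank_of (direct_sum2 N1 N2) F = rank_of N1 F" if "F \<subseteq> nonloops N1" for F
    using connected_flat_direct_sum2_left[OF assms that] rank_direct_sum2_left[OF assms]
      that nonloops_subset_ground[OF assms(1)] by auto
  have right: "connected_flat (direct_sum2 N1 N2) F \<longleftrightarrow> connected_flat N2 F"
      "rank_of (direct_sum2 N1 N2) F = rank_of N2 F" if "F \<subseteq> nonloops N2" for F
    using connected_flat_direct_sum2_left[OF assms(2,1) disj' that] rank_direct_sum2_left[OF assms(2,1) disj']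
      that nonloops_subset_ground[OF assms(2)] by (auto simp: direct_sum2_commute[of N1])
  have sub: "F \<subseteq> nonloops N" if "connected_flat N F" for N :: "'a set_system" and F
    using that by (simp add: connected_flat_def flat_def)
  show ?thesis
    unfolding balanced_def using connected_flat_direct_sum2_cases[OF assms] left right sub by metis
qed

lemma balanced_direct_sum:
  assumes "pairwise_disjoint_grounds Ms" "\<And>L. L \<in> set Ms \<Longrightarrow> matroid L"
  shows "matroid (direct_sum Ms) \<and> (balanced \<delta> c (direct_sum Ms) \<longleftrightarrow> (\<forall>L\<in>set Ms. balanced \<delta> c L))"
  using assms unfolding pairwise_disjoint_grounds_sorted_wrt
proof (induction Ms)
  case Nil
  have "\<not> connected_flat (direct_sum []) F" for F :: "'a set"
    by (auto simp: connected_flat_def flat_def inseparable_def nonloops_def direct_sum_Nil)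
  then show ?case by (simp add: balanced_def) (simp add: direct_sum_Nil matroid_def)
next
  case (Cons L Ms)
  have "ground L \<inter> ground (direct_sum Ms) = {}"
    using Cons.prems by (auto simp: ground_direct_sum)
  moreover have "matroid L" using Cons.prems by simp
  moreover have "matroid (direct_sum Ms)"
    and IH: "balanced \<delta> c (direct_sum Ms) \<longleftrightarrow> (\<forall>L\<in>set Ms. balanced \<delta> c L)"
    using Cons.IH Cons.prems by simp_all
  ultimately show ?case
    using matroid_direct_sum2[of L "direct_sum Ms"] balanced_direct_sum2[of L "direct_sum Ms" \<delta> c]
    by (simp add: direct_sum_Cons IH)
qed

lemma matroid_loop: "matroid (loop e)"
  by (simp add: matroid_def loop_def)

lemma balanced_loop: "balanced \<delta> c (loop e)"
  by (auto simp: balanced_def connected_flat_def flat_def inseparable_def nonloops_def loop_def)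

section \<open>Decomposition into connected summands\<close>

definition restriction :: "'a set_system \<Rightarrow> 'a set \<Rightarrow> 'a set_system" where
  "restriction M A = \<lparr>ground = A, indep = {I \<in> indep M. I \<subseteq> A}\<rparr>"

context
  fixes M :: "'a set_system"
  assumes M: "matroid M"
begin

lemma matroid_restriction:
  assumes "A \<subseteq> ground M"
  shows "matroid (restriction M A)"
proof -
  have "finite A" using assms finite_ground[OF M] finite_subset by blast
  moreover have "\<exists>e\<in>J - I. insert e I \<in> indep M \<and> insert e I \<subseteq> A"
    if "I \<in> indep M" "I \<subseteq> A" "J \<in> indep M" "J \<subseteq> A" "card I < card J" for I J
    using augment[OF M that(1,3,5)] that(2,4) by blast
  ultimately show ?thesis
    using empty_indep[OF M] indep_subset[OF M] by (auto simp: matroid_def restriction_def)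
qed

text \<open>
  Bases of \<open>Y\<close> and \<open>Z\<close> have together as many elements as the rank of their union, so the union is
  independent.
\<close>

lemma separation_direct_sum2:
  assumes "Y \<union> Z = ground M" "Y \<inter> Z = {}" "rank_of M Y + rank_of M Z = rank_of M (ground M)"
  shows "M = direct_sum2 (restriction M Y) (restriction M Z)"
proof -
  have "I \<union> J \<in> indep M" if I: "I \<in> indep M" "I \<subseteq> Y" and J: "J \<in> indep M" "J \<subseteq> Z" for I J
  proof -
    obtain B where B: "B \<in> indep M" "I \<subseteq> B" "B \<subseteq> Y" "card B = rank_of M Y"
      using extend_to_rank[OF M] I by blast
    obtain C where C: "C \<in> indep M" "J \<subseteq> C" "C \<subseteq> Z" "card C = rank_of M Z"
      using extend_to_rank[OF M] J by blast
    have fin: "finite B" "finite C" using B C finite_indep[OF M] by auto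
    have "rank_of M ((B \<union> C) \<union> ground M) = rank_of M (B \<union> C)"
    proof (rule rank_absorb[OF M])
      fix e assume "e \<in> ground M"
      then consider "e \<in> Y" | "e \<in> Z" using assms by blast
      then show "rank_of M (insert e (B \<union> C)) = rank_of M (B \<union> C)"
      proof cases
        case 1
        have "rank_of M (insert e B) \<le> rank_of M Y" using 1 B by (intro rank_mono[OF M]) auto
        then have "rank_of M (insert e B) = rank_of M B"
          using rank_indep[OF M B(1)] B(4) rank_mono[OF M subset_insertI[of B e]] by auto
        then show ?thesis using rank_absorb_mono[OF M] by blast
      next
        case 2
        have "rank_of M (insert e C) \<le> rank_of M Z" using 2 C by (intro rank_mono[OF M]) auto
        then have "rank_of M (insert e C) = rank_of M C"
          using rank_indep[OF M C(1)] C(4) rank_mono[OF M subset_insertI[of C e]] by auto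
        then show ?thesis using rank_absorb_mono[OF M] by blast
      qed
    qed
    moreover have "B \<union> C \<union> ground M = ground M" using B C indep_subset_ground[OF M] by blast
    moreover have "card (B \<union> C) = card B + card C"
      using B C assms(2) fin by (intro card_Un_disjoint) auto
    ultimately have "B \<union> C \<in> indep M" using indep_iff_rank[OF M] assms(3) B C fin by simp
    moreover have "I \<union> J \<subseteq> B \<union> C" using B C by blast
    ultimately show ?thesis by (rule indep_subset[OF M])
  qed
  moreover have "\<exists>J K. I = J \<union> K \<and> (J \<in> indep M \<and> J \<subseteq> Y) \<and> K \<in> indep M \<and> K \<subseteq> Z" if "I \<in> indep M" for I
    using that indep_subset_ground[OF M that] assms(1) indep_subset[OF M that]
    by (intro exI[of _ "I \<inter> Y"] exI[of _ "I \<inter> Z"]) auto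
  ultimately have "indep M = {I \<union> J |I J. (I \<in> indep M \<and> I \<subseteq> Y) \<and> J \<in> indep M \<and> J \<subseteq> Z}"
    by blast
  then show ?thesis by (simp add: direct_sum2_def restriction_def assms(1))
qed

lemma inseparable_imp_matroid_connected:
  assumes "inseparable M (ground M)"
  shows "matroid_connected M"
  unfolding matroid_connected_def
proof (intro conjI notI)
  show False if "ground M = {}" using inseparable_nonempty[OF M assms] that by simp
next
  assume "\<exists>N1 N2. matroid N1 \<and> matroid N2 \<and> ground N1 \<noteq> {} \<and> ground N2 \<noteq> {} \<and>
            ground N1 \<inter> ground N2 = {} \<and> M = direct_sum2 N1 N2"
  then obtain N1 N2 where N: "matroid N1" "matroid N2" "ground N1 \<noteq> {}" "ground N2 \<noteq> {}"
    "ground N1 \<inter> ground N2 = {}" "M = direct_sum2 N1 N2" by blast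
  have "ground N2 \<inter> ground N1 = {}" using N by blast
  then have "rank_of M (ground N1) = rank_of N1 (ground N1)" "rank_of M (ground N2) = rank_of N2 (ground N2)"
    using rank_direct_sum2_left[OF N(1,2,5)] rank_direct_sum2_left[OF N(2,1)] N(6)
    by (auto simp: direct_sum2_commute[of N1])
  moreover have "rank_of N1 (ground N1) \<le> rank_of N1 (ground M)" "rank_of N2 (ground N2) \<le> rank_of N2 (ground M)"
    using N by (auto intro!: rank_mono simp: ground_direct_sum2)
  ultimately have "rank_of M (ground N1) + rank_of M (ground N2) \<le> rank_of M (ground M)"
    using rank_direct_sum2[OF N(1,2,5), of "ground M"] N(6) by simp
  then show False
    using inseparableD[OF M assms, of "ground N1" "ground N2"] N ground_direct_sum2 by metis
qed

end

lemma connected_decomposition: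
  assumes "matroid M"
  shows "\<exists>Ms. pairwise_disjoint_grounds Ms \<and> M = direct_sum Ms \<and>
           (\<forall>L\<in>set Ms. matroid L \<and> inseparable L (ground L))"
  using assms
proof (induction "card (ground M)" arbitrary: M rule: less_induct)
  case less
  consider "ground M = {}" | "inseparable M (ground M)" | "ground M \<noteq> {}" "\<not> inseparable M (ground M)"
    by blast
  then show ?case
  proof cases
    case 1
    then have "indep M = {{}}" using less.prems indep_subset_ground empty_indep by blast
    then have "M = direct_sum []" using 1 by (simp add: direct_sum_Nil)
    then show ?thesis by (intro exI[of _ "[]"]) (auto simp: pairwise_disjoint_grounds_def)
  next
    case 2
    then show ?thesis using less.prems
      by (intro exI[of _ "[M]"]) (auto simp: pairwise_disjoint_grounds_def direct_sum_singleton)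
  next
    case 3
    then obtain Y Z where YZ: "Y \<union> Z = ground M" "Y \<inter> Z = {}" "Y \<noteq> {}" "Z \<noteq> {}"
      "rank_of M Y + rank_of M Z = rank_of M (ground M)"
      using separableE[OF less.prems] by metis
    have fin: "finite (ground M)" using finite_ground less.prems by blast
    have part: "\<exists>Ms. pairwise_disjoint_grounds Ms \<and> restriction M A = direct_sum Ms \<and>
        (\<forall>L\<in>set Ms. matroid L \<and> inseparable L (ground L))" if "A \<subset> ground M" for A
    proof (rule less.hyps)
      show "card (ground (restriction M A)) < card (ground M)"
        using that fin psubset_card_mono by (simp add: restriction_def)
      show "matroid (restriction M A)" using that matroid_restriction[OF less.prems] by blast
    qed
    have "Y \<subset> ground M" "Z \<subset> ground M" using YZ by auto
    obtain Ms where Ms: "pairwise_disjoint_grounds Ms" "restriction M Y = direct_sum Ms"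
        "\<forall>L\<in>set Ms. matroid L \<and> inseparable L (ground L)"
      using part[OF \<open>Y \<subset> ground M\<close>] by blast
    obtain Ns where Ns: "pairwise_disjoint_grounds Ns" "restriction M Z = direct_sum Ns"
        "\<forall>L\<in>set Ns. matroid L \<and> inseparable L (ground L)"
      using part[OF \<open>Z \<subset> ground M\<close>] by blast
    have "\<Union> (ground ` set Ms) = Y" "\<Union> (ground ` set Ns) = Z"
      using Ms(2) Ns(2) ground_direct_sum[of Ms] ground_direct_sum[of Ns] by (simp_all add: restriction_def flip: Ms(2) Ns(2))
    then have "pairwise_disjoint_grounds (Ms @ Ns)"
      using Ms(1) Ns(1) YZ(2) unfolding pairwise_disjoint_grounds_sorted_wrt sorted_wrt_append by blast
    moreover have "M = direct_sum (Ms @ Ns)"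
      using separation_direct_sum2[OF less.prems YZ(1,2,5)] Ms(2) Ns(2) by (simp add: direct_sum_append)
    ultimately show ?thesis using Ms Ns by (intro exI[of _ "Ms @ Ns"]) auto
  qed
qed

section \<open>Parallel extensions and blow-ups\<close>

text \<open>
  Every element \<open>e\<close> of \<open>N\<close> is replaced by a class of parallel elements, the fibre of \<open>\<pi>\<close> over \<open>e\<close>.
  Blow-ups are of this form, and unlike the recursive definition of a blow-up, this one is symmetric
  in the elements of \<open>N\<close>.
\<close>

definition parallel_extension :: "'a set_system \<Rightarrow> 'a set \<Rightarrow> ('a \<Rightarrow> 'a) \<Rightarrow> 'a set_system" where
  "parallel_extension N G \<pi> = \<lparr>ground = G, indep = {I. I \<subseteq> G \<and> inj_on \<pi> I \<and> \<pi> ` I \<in> indep N}\<rparr>"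

lemma ground_parallel_extension: "ground (parallel_extension N G \<pi>) = G"
  by (simp add: parallel_extension_def)

lemma indep_parallel_extension:
  "I \<in> indep (parallel_extension N G \<pi>) \<longleftrightarrow> I \<subseteq> G \<and> inj_on \<pi> I \<and> \<pi> ` I \<in> indep N"
  by (simp add: parallel_extension_def)

lemma parallel_extension_comp:
  assumes "\<pi>' ` G' \<subseteq> G"
  shows "parallel_extension (parallel_extension N G \<pi>) G' \<pi>' = parallel_extension N G' (\<pi> \<circ> \<pi>')"
proof -
  have "(I \<subseteq> G' \<and> inj_on \<pi>' I \<and> \<pi>' ` I \<subseteq> G \<and> inj_on \<pi> (\<pi>' ` I) \<and> \<pi> ` \<pi>' ` I \<in> indep N) \<longleftrightarrow>
        (I \<subseteq> G' \<and> inj_on (\<pi> \<circ> \<pi>') I \<and> (\<pi> \<circ> \<pi>') ` I \<in> indep N)" for I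
    using assms inj_on_imageI2[of \<pi> \<pi>' I] comp_inj_on[of \<pi>' I \<pi>] inj_on_imageI[of \<pi> \<pi>' I]
    by (auto simp: image_comp)
  then show ?thesis by (simp add: parallel_extension_def)
qed

lemma parallel_extension_cong:
  assumes "\<And>x. x \<in> G \<Longrightarrow> \<pi> x = \<pi>' x"
  shows "parallel_extension N G \<pi> = parallel_extension N G \<pi>'"
proof -
  have "(inj_on \<pi> I \<and> \<pi> ` I \<in> indep N) \<longleftrightarrow> (inj_on \<pi>' I \<and> \<pi>' ` I \<in> indep N)" if "I \<subseteq> G" for I
    using assms that inj_on_cong[of I \<pi> \<pi>'] image_cong[of I I \<pi> \<pi>'] by (metis subsetD)
  then show ?thesis by (auto simp: parallel_extension_def)
qed

context
  fixes N :: "'a set_system" and G :: "'a set" and \<pi> :: "'a \<Rightarrow> 'a"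
  assumes N: "matroid N" and G: "finite G"
begin

lemma matroid_parallel_extension: "matroid (parallel_extension N G \<pi>)"
proof -
  have "J \<in> indep (parallel_extension N G \<pi>)"
    if "I \<in> indep (parallel_extension N G \<pi>)" "J \<subseteq> I" for I J
    using that indep_subset[OF N, of "\<pi> ` I" "\<pi> ` J"] inj_on_subset
    unfolding indep_parallel_extension by blast
  moreover have "\<exists>e\<in>J - I. insert e I \<in> indep (parallel_extension N G \<pi>)"
    if I: "I \<in> indep (parallel_extension N G \<pi>)" and J: "J \<in> indep (parallel_extension N G \<pi>)"
      and less: "card I < card J" for I J
  proof -
    have "card (\<pi> ` I) < card (\<pi> ` J)"
      using I J less by (simp add: indep_parallel_extension card_image)
    then obtain y where y: "y \<in> \<pi> ` J - \<pi> ` I" "insert y (\<pi> ` I) \<in> indep N"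
      using augment[OF N, of "\<pi> ` I" "\<pi> ` J"] I J unfolding indep_parallel_extension by blast
    then obtain e where e: "e \<in> J" "y = \<pi> e" by blast
    then have "e \<in> J - I" "insert e I \<in> indep (parallel_extension N G \<pi>)"
      using y I J by (auto simp: indep_parallel_extension)
    then show ?thesis by blast
  qed
  moreover have "{} \<in> indep (parallel_extension N G \<pi>)"
    using empty_indep[OF N] by (simp add: indep_parallel_extension)
  moreover have "indep (parallel_extension N G \<pi>) \<subseteq> Pow G"
    by (auto simp: indep_parallel_extension)
  ultimately show ?thesis
    unfolding matroid_def ground_parallel_extension using G by blast
qed

lemma rank_parallel_extension:
  assumes "A \<subseteq> G"
  shows "rank_of (parallel_extension N G \<pi>) A = rank_of N (\<pi> ` A)"
proof (rule antisym)
  obtain I where I: "I \<in> indep (parallel_extension N G \<pi>)" "I \<subseteq> A"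
    "card I = rank_of (parallel_extension N G \<pi>) A"
    using rank_witness[OF matroid_parallel_extension] by blast
  then have "card (\<pi> ` I) \<le> rank_of N (\<pi> ` A)"
    by (intro card_le_rank[OF N]) (auto simp: indep_parallel_extension)
  then show "rank_of (parallel_extension N G \<pi>) A \<le> rank_of N (\<pi> ` A)"
    using I by (simp add: indep_parallel_extension card_image)
next
  obtain J where J: "J \<in> indep N" "J \<subseteq> \<pi> ` A" "card J = rank_of N (\<pi> ` A)"
    using rank_witness[OF N] by blast
  obtain I where I: "I \<subseteq> A" "inj_on \<pi> I" "J = \<pi> ` I"
    using J(2) by (auto simp: subset_image_inj)
  then have "card I \<le> rank_of (parallel_extension N G \<pi>) A"
    using J assms by (intro card_le_rank[OF matroid_parallel_extension]) (auto simp: indep_parallel_extension)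
  then show "rank_of N (\<pi> ` A) \<le> rank_of (parallel_extension N G \<pi>) A"
    using I J by (simp add: card_image)
qed

lemma nonloops_parallel_extension: "nonloops (parallel_extension N G \<pi>) = {x \<in> G. \<pi> x \<in> nonloops N}"
  by (auto simp: nonloops_def indep_parallel_extension)

text \<open>
  If the images of the two parts of a separation of \<open>X\<close> overlapped, submodularity would make the
  rank drop by at least the rank of the overlap, which contains a nonloop.
\<close>

lemma inseparable_parallel_extension:
  assumes X: "X \<subseteq> nonloops (parallel_extension N G \<pi>)"
  shows "inseparable (parallel_extension N G \<pi>) X \<longleftrightarrow> inseparable N (\<pi> ` X)"
proof -
  have XG: "X \<subseteq> G" using X nonloops_parallel_extension by blast
  note rank = rank_parallel_extension[OF subset_trans[OF _ XG]]
  show ?thesis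
  proof
    assume insep: "inseparable (parallel_extension N G \<pi>) X"
    show "inseparable N (\<pi> ` X)"
    proof (rule ccontr)
      assume "\<not> ?thesis"
      moreover have "\<pi> ` X \<noteq> {}" using insep by (simp add: inseparable_def)
      ultimately obtain Y Z where YZ: "Y \<union> Z = \<pi> ` X" "Y \<inter> Z = {}" "Y \<noteq> {}" "Z \<noteq> {}"
        "rank_of N Y + rank_of N Z = rank_of N (\<pi> ` X)"
        using separableE[OF N] by metis
      define Y' Z' where "Y' = {x \<in> X. \<pi> x \<in> Y}" and "Z' = {x \<in> X. \<pi> x \<in> Z}"
      have im: "\<pi> ` Y' = Y" "\<pi> ` Z' = Z" using YZ(1) by (auto simp: Y'_def Z'_def)
      have YZ': "Y' \<union> Z' = X" "Y' \<inter> Z' = {}" using YZ(1,2) by (auto simp: Y'_def Z'_def)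
      have "rank_of (parallel_extension N G \<pi>) Y' + rank_of (parallel_extension N G \<pi>) Z'
          \<le> rank_of (parallel_extension N G \<pi>) X"
        using rank[of Y'] rank[of Z'] rank[of X] YZ' YZ(5) im by auto
      then have "Y' = {} \<or> Z' = {}"
        using inseparableD[OF matroid_parallel_extension insep YZ'] by blast
      then show False using im YZ(3,4) by auto
    qed
  next
    assume insep: "inseparable N (\<pi> ` X)"
    show "inseparable (parallel_extension N G \<pi>) X"
    proof (rule ccontr)
      assume "\<not> ?thesis"
      moreover have "X \<noteq> {}" using insep by (auto simp: inseparable_def)
      ultimately obtain Y Z where YZ: "Y \<union> Z = X" "Y \<inter> Z = {}" "Y \<noteq> {}" "Z \<noteq> {}"
        "rank_of (parallel_extension N G \<pi>) Y + rank_of (parallel_extension N G \<pi>) Z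
          = rank_of (parallel_extension N G \<pi>) X"
        using separableE[OF matroid_parallel_extension] by metis
      have sum: "rank_of N (\<pi> ` Y) + rank_of N (\<pi> ` Z) = rank_of N (\<pi> ` X)"
        using YZ(5) rank[of Y] rank[of Z] rank[of X] YZ(1) by auto
      have un: "\<pi> ` Y \<union> \<pi> ` Z = \<pi> ` X" using YZ(1) by blast
      have "\<pi> ` Y \<inter> \<pi> ` Z = {}"
      proof (rule ccontr)
        assume "\<pi> ` Y \<inter> \<pi> ` Z \<noteq> {}"
        then obtain y where y: "y \<in> \<pi> ` Y \<inter> \<pi> ` Z" by blast
        then have "y \<in> nonloops N" using X YZ(1) nonloops_parallel_extension by auto
        then have "0 < rank_of N (\<pi> ` Y \<inter> \<pi> ` Z)" by (rule rank_pos[OF N _ y])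
        then show False using rank_submodular[OF N, of "\<pi> ` Y" "\<pi> ` Z"] sum un by simp
      qed
      then have "\<pi> ` Y = {} \<or> \<pi> ` Z = {}"
        using inseparableD[OF N insep un] sum by simp
      then show False using YZ by blast
    qed
  qed
qed

lemma connected_flat_preimage:
  assumes F: "connected_flat N F" and sub: "F \<subseteq> \<pi> ` G"
  shows "connected_flat (parallel_extension N G \<pi>) {x \<in> G. \<pi> x \<in> F}"
proof -
  have im: "\<pi> ` {x \<in> G. \<pi> x \<in> F} = F" using sub by auto
  have nl: "{x \<in> G. \<pi> x \<in> F} \<subseteq> nonloops (parallel_extension N G \<pi>)"
    using F by (auto simp: connected_flat_def flat_def nonloops_parallel_extension)
  have "rank_of (parallel_extension N G \<pi>) {x \<in> G. \<pi> x \<in> F}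
      < rank_of (parallel_extension N G \<pi>) (insert e {x \<in> G. \<pi> x \<in> F})"
    if e: "e \<in> nonloops (parallel_extension N G \<pi>) - {x \<in> G. \<pi> x \<in> F}" for e
  proof -
    have "e \<in> G" "\<pi> e \<in> nonloops N - F" using e by (auto simp: nonloops_parallel_extension)
    then have "rank_of N F < rank_of N (insert (\<pi> e) F)"
      using F by (auto simp: connected_flat_def flat_def)
    then show ?thesis
      using rank_parallel_extension[of "{x \<in> G. \<pi> x \<in> F}"] \<open>e \<in> G\<close>
        rank_parallel_extension[of "insert e {x \<in> G. \<pi> x \<in> F}"] im by simp
  qed
  then show ?thesis
    using nl inseparable_parallel_extension[OF nl] F im by (simp add: connected_flat_def flat_def)
qed

lemma connected_flat_image:
  assumes X: "connected_flat (parallel_extension N G \<pi>) X" and sub: "nonloops N \<subseteq> \<pi> ` G"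
  shows "connected_flat N (\<pi> ` X)" and "X = {x \<in> G. \<pi> x \<in> \<pi> ` X}"
proof -
  have flatX: "flat (parallel_extension N G \<pi>) X" using X by (simp add: connected_flat_def)
  have nl: "X \<subseteq> nonloops (parallel_extension N G \<pi>)" using flatX by (simp add: flat_def)
  have XG: "X \<subseteq> G" using nl nonloops_parallel_extension by blast
  have up: "rank_of N (\<pi> ` X) < rank_of N (insert (\<pi> e) (\<pi> ` X))"
    if "e \<in> G" "\<pi> e \<in> nonloops N" "e \<notin> X" for e
  proof -
    have "rank_of (parallel_extension N G \<pi>) X < rank_of (parallel_extension N G \<pi>) (insert e X)"
      using flatX that by (simp add: flat_def nonloops_parallel_extension)
    then show ?thesis
      using rank_parallel_extension[OF XG] rank_parallel_extension[of "insert e X"] XG that(1) by simp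
  qed
  show "X = {x \<in> G. \<pi> x \<in> \<pi> ` X}"
  proof (intro equalityI subsetI)
    fix x assume x: "x \<in> {x \<in> G. \<pi> x \<in> \<pi> ` X}"
    then have "\<pi> x \<in> nonloops N" using nl nonloops_parallel_extension by auto
    moreover have "insert (\<pi> x) (\<pi> ` X) = \<pi> ` X" using x by (auto simp: insert_absorb)
    ultimately show "x \<in> X" using up[of x] x by fastforce
  qed (use XG in auto)
  have "rank_of N (\<pi> ` X) < rank_of N (insert y (\<pi> ` X))" if y: "y \<in> nonloops N - \<pi> ` X" for y
  proof -
    obtain e where "e \<in> G" "y = \<pi> e" using y sub by blast
    then show ?thesis using up[of e] y by blast
  qed
  then show "connected_flat N (\<pi> ` X)"
    using nl X inseparable_parallel_extension[OF nl]
    by (auto simp: connected_flat_def flat_def nonloops_parallel_extension)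
qed

lemma card_fibres:
  assumes "finite F" "\<And>e. e \<in> F \<Longrightarrow> card {x \<in> G. \<pi> x = e} = c"
  shows "card {x \<in> G. \<pi> x \<in> F} = c * card F"
proof -
  have "{x \<in> G. \<pi> x \<in> F} = (\<Union>e\<in>F. {x \<in> G. \<pi> x = e})" by auto
  also have "card \<dots> = (\<Sum>e\<in>F. card {x \<in> G. \<pi> x = e})"
    using assms(1) G by (intro card_UN_disjoint) auto
  finally show ?thesis using assms(2) by simp
qed

text \<open>Passing to preimages multiplies cardinalities by \<open>c\<close> and keeps ranks.\<close>

lemma balanced_parallel_extension:
  assumes c: "0 < c" and fibre: "\<And>e. e \<in> nonloops N \<Longrightarrow> card {x \<in> G. \<pi> x = e} = c"
  shows "balanced \<delta> 1 (parallel_extension N G \<pi>) \<longleftrightarrow> balanced \<delta> c N"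
proof -
  have sub: "nonloops N \<subseteq> \<pi> ` G"
  proof
    fix e assume "e \<in> nonloops N"
    then have "{x \<in> G. \<pi> x = e} \<noteq> {}" using fibre c by fastforce
    then show "e \<in> \<pi> ` G" by blast
  qed
  have card: "card {x \<in> G. \<pi> x \<in> F} = c * card F" if "F \<subseteq> nonloops N" for F
    using that fibre finite_nonloops[OF N] finite_subset by (intro card_fibres) blast+
  show ?thesis
  proof
    assume L: "balanced \<delta> 1 (parallel_extension N G \<pi>)"
    show "balanced \<delta> c N"
      unfolding balanced_def
    proof (intro allI impI)
      fix F assume F: "connected_flat N F"
      then have nl: "F \<subseteq> nonloops N" by (simp add: connected_flat_def flat_def)
      have "\<pi> ` {x \<in> G. \<pi> x \<in> F} = F" using nl sub by auto
      moreover have "connected_flat (parallel_extension N G \<pi>) {x \<in> G. \<pi> x \<in> F}"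
        using connected_flat_preimage[OF F subset_trans[OF nl sub]] .
      then have "card {x \<in> G. \<pi> x \<in> F} + 1 = \<delta> * rank_of (parallel_extension N G \<pi>) {x \<in> G. \<pi> x \<in> F}"
        using L by (simp add: balanced_def)
      ultimately show "c * card F + 1 = \<delta> * rank_of N F"
        using card[OF nl] rank_parallel_extension[of "{x \<in> G. \<pi> x \<in> F}"] by simp
    qed
  next
    assume R: "balanced \<delta> c N"
    show "balanced \<delta> 1 (parallel_extension N G \<pi>)"
      unfolding balanced_def
    proof (intro allI impI)
      fix X assume X: "connected_flat (parallel_extension N G \<pi>) X"
      have im: "connected_flat N (\<pi> ` X)" "X = {x \<in> G. \<pi> x \<in> \<pi> ` X}"
        using connected_flat_image[OF X sub] by auto
      then have "c * card (\<pi> ` X) + 1 = \<delta> * rank_of N (\<pi> ` X)" using R by (simp add: balanced_def)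
      moreover have "\<pi> ` X \<subseteq> nonloops N" using im by (simp add: connected_flat_def flat_def)
      then have "card X = c * card (\<pi> ` X)" using card[of "\<pi> ` X"] im(2) by simp
      moreover have "X \<subseteq> G" using im(2) by blast
      ultimately show "1 * card X + 1 = \<delta> * rank_of (parallel_extension N G \<pi>) X"
        using rank_parallel_extension by simp
    qed
  qed
qed

end

lemma indep_iff_subset_base:
  assumes "matroid N"
  shows "I \<in> indep N \<longleftrightarrow> (\<exists>B\<in>bases N. I \<subseteq> B)"
proof
  assume I: "I \<in> indep N"
  then obtain B where B: "B \<in> indep N" "I \<subseteq> B" "card B = rank_of N (ground N)"
    using extend_to_rank[OF assms I indep_subset_ground[OF assms I]] by blast
  have "C = B" if "C \<in> indep N" "B \<subseteq> C" for C
    using that B card_le_rank[OF assms, of C "ground N"] indep_subset_ground[OF assms, of C]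
      finite_indep[OF assms, of C] by (metis card_seteq)
  then have "B \<in> bases N" using B by (auto simp: bases_def maximal_sets_def)
  then show "\<exists>B\<in>bases N. I \<subseteq> B" using B by blast
next
  assume "\<exists>B\<in>bases N. I \<subseteq> B"
  then show "I \<in> indep N"
    using indep_subset[OF assms] by (auto simp: bases_def maximal_sets_def)
qed

text \<open>
  A subset of \<open>(B - e) + e'\<close> contains no other element of the class of \<open>e\<close>, so the projection is
  injective on it; conversely an independent set meeting \<open>S\<close> does so in one element \<open>e'\<close> and avoids
  \<open>e\<close>.
\<close>

lemma blow_up_element_eq_parallel_extension:
  assumes N: "matroid N" and e: "e \<in> ground N" and S: "S \<inter> ground N = {}"
  shows "blow_up_element e S N = parallel_extension N (ground N \<union> S) (\<lambda>x. if x \<in> S then e else x)"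
    (is "_ = parallel_extension N _ ?p")
proof -
  have base: "B \<in> indep N" "B \<subseteq> ground N" if "B \<in> bases N" for B
    using that indep_subset_ground[OF N] by (auto simp: bases_def maximal_sets_def)
  have "(\<exists>B \<in> bases N \<union> {insert e' (B - {e}) |B e'. B \<in> bases N \<and> e \<in> B \<and> e' \<in> S}. I \<subseteq> B) \<longleftrightarrow>
        I \<subseteq> ground N \<union> S \<and> inj_on ?p I \<and> ?p ` I \<in> indep N" (is "?L I \<longleftrightarrow> ?R I") for I
  proof
    assume "?L I"
    then consider B where "B \<in> bases N" "I \<subseteq> B"
      | B e' where "B \<in> bases N" "e \<in> B" "e' \<in> S" "I \<subseteq> insert e' (B - {e})" by blast
    then show "?R I"
    proof cases
      case 1
      then have "I \<subseteq> ground N" using base by blast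
      then have p: "?p x = x" if "x \<in> I" for x using that S by auto
      then have "inj_on ?p I" "?p ` I = I" by (auto simp: inj_on_def)
      then show ?thesis using 1 \<open>I \<subseteq> ground N\<close> indep_iff_subset_base[OF N] by auto
    next
      case 2
      have p: "?p x = x" "x \<noteq> e" if "x \<in> I" "x \<noteq> e'" for x
        using that 2 S base(2)[OF 2(1)] by auto
      have "inj_on ?p I" using p 2(3) unfolding inj_on_def by metis
      moreover have "?p ` I \<subseteq> B" using p 2 by auto
      ultimately show ?thesis using 2 base indep_iff_subset_base[OF N] by blast
    qed
  next
    assume R: "?R I"
    then obtain B where B: "B \<in> bases N" "?p ` I \<subseteq> B" using indep_iff_subset_base[OF N] by blast
    show "?L I"
    proof (cases "I \<inter> S = {}")
      case True
      then have "?p ` I = I" by (auto simp: image_iff)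
      then show ?thesis using B by blast
    next
      case False
      then obtain e' where e': "e' \<in> I" "e' \<in> S" by blast
      have "x = e'" if "x \<in> I" "?p x = e" for x
        using R e' that inj_onD[of ?p I x e'] by simp
      then have other: "x \<notin> S" "x \<noteq> e" if "x \<in> I" "x \<noteq> e'" for x using that by auto
      then have "I \<subseteq> insert e' (B - {e})" using B by fastforce
      moreover have "e \<in> B" using B e' by auto
      ultimately show ?thesis using B e' by blast
    qed
  qed
  then show ?thesis by (simp add: blow_up_element_def parallel_extension_def)
qed

text \<open>
  Blowing up one element after the other composes the corresponding maps. The fibre of the composite
  over the first element is the disjoint union of the singleton fibres over the elements it was
  replaced by.
\<close>

lemma blow_up_elements_imp_parallel_extension:
  assumes "matroid N" "distinct es" "set es \<subseteq> ground N" "0 < k" "blow_up_elements k es N L"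
  shows "\<exists>\<pi>. L = parallel_extension N (ground L) \<pi> \<and> finite (ground L) \<and> \<pi> ` ground L \<subseteq> ground N \<and>
           (\<forall>e\<in>ground N. card {x \<in> ground L. \<pi> x = e} = (if e \<in> set es then k else 1))"
  using assms
proof (induction es arbitrary: N)
  case Nil
  have "parallel_extension N (ground N) (\<lambda>x. x) = N"
    using indep_subset_ground[OF Nil.prems(1)] by (auto simp: parallel_extension_def intro: set_system.equality)
  moreover have "{x \<in> ground N. x = e} = {e}" if "e \<in> ground N" for e using that by auto
  ultimately show ?case
    using Nil finite_ground[OF Nil.prems(1)] by (intro exI[of _ "\<lambda>x. x"]) auto
next
  case (Cons e es)
  obtain S where S: "finite S" "card S = k - 1" "S \<inter> ground N = {}"
    "blow_up_elements k es (blow_up_element e S N) L"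
    using Cons.prems(5) by auto
  let ?G = "ground N \<union> S"
  let ?p = "\<lambda>x. if x \<in> S then e else x"
  have e: "e \<in> ground N" "e \<notin> set es" using Cons.prems by auto
  have N': "blow_up_element e S N = parallel_extension N ?G ?p"
    using blow_up_element_eq_parallel_extension[OF Cons.prems(1) e(1) S(3)] .
  have "finite ?G" using S finite_ground[OF Cons.prems(1)] by simp
  then have mat: "matroid (blow_up_element e S N)"
    using matroid_parallel_extension[OF Cons.prems(1)] N' by simp
  have gr: "ground (blow_up_element e S N) = ?G" by (simp add: blow_up_element_def)
  have es: "set es \<subseteq> ground (blow_up_element e S N)" "distinct es" using Cons.prems gr by auto
  obtain \<rho> where "L = parallel_extension (blow_up_element e S N) (ground L) \<rho>" "finite (ground L)"
    "\<rho> ` ground L \<subseteq> ground (blow_up_element e S N)"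
    "\<forall>y\<in>ground (blow_up_element e S N). card {x \<in> ground L. \<rho> x = y} = (if y \<in> set es then k else 1)"
    using Cons.IH[OF mat es(2,1) Cons.prems(4) S(4)] by blast
  then have \<rho>: "L = parallel_extension (blow_up_element e S N) (ground L) \<rho>" "finite (ground L)"
    "\<rho> ` ground L \<subseteq> ?G" "\<And>y. y \<in> ?G \<Longrightarrow> card {x \<in> ground L. \<rho> x = y} = (if y \<in> set es then k else 1)"
    unfolding gr by blast+
  have "L = parallel_extension N (ground L) (?p \<circ> \<rho>)"
    using \<rho>(1) parallel_extension_comp[OF \<rho>(3), of N ?p] N' by simp
  moreover have "(?p \<circ> \<rho>) ` ground L \<subseteq> ground N" using \<rho>(3) e by auto
  moreover have "card {x \<in> ground L. (?p \<circ> \<rho>) x = a} = (if a \<in> set (e # es) then k else 1)"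
    if a: "a \<in> ground N" for a
  proof (cases "a = e")
    case True
    have "{x \<in> ground L. (?p \<circ> \<rho>) x = a} = {x \<in> ground L. \<rho> x \<in> insert e S}"
      using True by auto
    also have "card \<dots> = 1 * card (insert e S)"
    proof (rule card_fibres[OF Cons.prems(1) \<rho>(2)])
      show "finite (insert e S)" using S by simp
      show "card {x \<in> ground L. \<rho> x = y} = 1" if "y \<in> insert e S" for y
      proof -
        have "y \<notin> set es" "y \<in> ?G" using that e S Cons.prems(3) by auto
        then show ?thesis using \<rho>(4) by simp
      qed
    qed
    also have "\<dots> = k" using S e Cons.prems(4) by (subst card_insert_disjoint) auto
    finally show ?thesis using True by simp
  next
    case False
    have "{x \<in> ground L. (?p \<circ> \<rho>) x = a} = {x \<in> ground L. \<rho> x = a}"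
      using False a S(3) by auto
    then show ?thesis using \<rho>(4)[of a] a False by simp
  qed
  ultimately show ?case using \<rho>(2) by blast
qed

lemma blow_up_elements_parallel_extension:
  assumes "matroid N" "distinct es" "set es \<subseteq> ground N" "0 < k" "finite G" "ground N \<subseteq> G"
    and "\<pi> ` G \<subseteq> ground N" "\<And>e. e \<in> ground N \<Longrightarrow> \<pi> e = e"
    and "\<And>e. e \<in> ground N \<Longrightarrow> card {x \<in> G. \<pi> x = e} = (if e \<in> set es then k else 1)"
  shows "blow_up_elements k es N (parallel_extension N G \<pi>)"
  using assms
proof (induction es arbitrary: N \<pi>)
  case Nil
  have "x \<in> ground N" if x: "x \<in> G" for x
  proof -
    have px: "\<pi> x \<in> ground N" using Nil.prems(7) x by blast
    then have "card {y \<in> G. \<pi> y = \<pi> x} = 1" using Nil.prems(9) by simp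
    then obtain z where z: "{y \<in> G. \<pi> y = \<pi> x} = {z}" by (auto simp: card_1_singleton_iff)
    have "x \<in> {y \<in> G. \<pi> y = \<pi> x}" "\<pi> x \<in> {y \<in> G. \<pi> y = \<pi> x}"
      using x px Nil.prems(6,8) by auto
    then have "x = \<pi> x" unfolding z by simp
    then show ?thesis using px by simp
  qed
  then have G: "G = ground N" using Nil.prems(6) by blast
  have "parallel_extension N G \<pi> = parallel_extension N G id"
    using Nil.prems(8) G by (intro parallel_extension_cong) auto
  moreover have "parallel_extension N (ground N) id = N"
    using indep_subset_ground[OF Nil.prems(1)] by (auto simp: parallel_extension_def intro: set_system.equality)
  ultimately show ?case using G by simp
next
  case (Cons e es)
  have e: "e \<in> ground N" "e \<notin> set es" using Cons.prems by auto
  define S where "S = {x \<in> G. \<pi> x = e} - {e}"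
  have eG: "e \<in> {x \<in> G. \<pi> x = e}" using e Cons.prems(6,8) by auto
  have S: "finite S" "card S = k - 1" "S \<inter> ground N = {}"
  proof -
    show "finite S" using Cons.prems(5) by (simp add: S_def)
    show "card S = k - 1" unfolding S_def using eG Cons.prems(5) Cons.prems(9)[OF e(1)]
      by (subst card_Diff_singleton) auto
    show "S \<inter> ground N = {}" using Cons.prems(8) by (auto simp: S_def)
  qed
  let ?G = "ground N \<union> S"
  let ?p = "\<lambda>x. if x \<in> S then e else x"
  \<comment> \<open>Only the class of \<open>e\<close> is split off: \<open>\<pi>\<close> factors as \<open>?p \<circ> \<rho>\<close> on \<open>G\<close>.\<close>
  define \<rho> where "\<rho> = (\<lambda>x. if x \<in> S then x else \<pi> x)"
  have N': "blow_up_element e S N = parallel_extension N ?G ?p"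
    using blow_up_element_eq_parallel_extension[OF Cons.prems(1) e(1) S(3)] .
  have "finite ?G" using S finite_ground[OF Cons.prems(1)] by simp
  then have mat: "matroid (blow_up_element e S N)"
    using matroid_parallel_extension[OF Cons.prems(1)] N' by simp
  have gr: "ground (blow_up_element e S N) = ?G" by (simp add: blow_up_element_def)
  have \<rho>G: "\<rho> ` G \<subseteq> ?G" using Cons.prems(7) by (auto simp: \<rho>_def)
  have "blow_up_elements k es (blow_up_element e S N) (parallel_extension (blow_up_element e S N) G \<rho>)"
  proof (rule Cons.IH[OF mat])
    show "distinct es" "0 < k" "finite G" using Cons.prems by auto
    show "set es \<subseteq> ground (blow_up_element e S N)" using Cons.prems(3) gr by auto
    show "ground (blow_up_element e S N) \<subseteq> G" using Cons.prems(6) gr by (auto simp: S_def)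
    show "\<rho> ` G \<subseteq> ground (blow_up_element e S N)" using \<rho>G gr by simp
    show "\<rho> y = y" if "y \<in> ground (blow_up_element e S N)" for y
      using that gr Cons.prems(8) by (auto simp: \<rho>_def)
    show "card {x \<in> G. \<rho> x = y} = (if y \<in> set es then k else 1)"
      if y: "y \<in> ground (blow_up_element e S N)" for y
    proof (cases "y \<in> insert e S")
      case True
      have "{x \<in> G. \<rho> x = y} = {y}"
      proof (intro equalityI subsetI)
        fix x assume "x \<in> {x \<in> G. \<rho> x = y}"
        then have x: "x \<in> G" "\<rho> x = y" by auto
        show "x \<in> {y}"
        proof (cases "x \<in> S")
          case True
          then show ?thesis using x by (simp add: \<rho>_def)
        next
          case False
          then have px: "\<pi> x = y" using x by (simp add: \<rho>_def)
          then have "y \<in> ground N" using Cons.prems(7) x by blast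
          then have "y = e" using True S(3) by blast
          then show ?thesis using px False x by (auto simp: S_def)
        qed
      next
        fix x assume "x \<in> {y}"
        then show "x \<in> {x \<in> G. \<rho> x = y}"
          using True e S(3) Cons.prems(6,8) by (auto simp: \<rho>_def S_def)
      qed
      moreover have "y \<notin> set es" using True e S(3) Cons.prems(3) by auto
      ultimately show ?thesis by simp
    next
      case False
      then have "{x \<in> G. \<rho> x = y} = {x \<in> G. \<pi> x = y}" by (auto simp: \<rho>_def S_def)
      then show ?thesis using Cons.prems(9)[of y] y gr False by auto
    qed
  qed
  moreover have "parallel_extension (blow_up_element e S N) G \<rho> = parallel_extension N G (?p \<circ> \<rho>)"
    using parallel_extension_comp[OF \<rho>G, of N ?p] N' by simp
  moreover have "\<dots> = parallel_extension N G \<pi>"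
  proof (rule parallel_extension_cong)
    fix x assume "x \<in> G"
    then have "\<pi> x \<notin> S" using Cons.prems(7) S(3) by blast
    then show "(?p \<circ> \<rho>) x = \<pi> x" by (auto simp: \<rho>_def S_def)
  qed
  ultimately show ?case using S by auto
qed

section \<open>Balanced matroids and \<open>F\<^sub>\<delta>\<close>-matroids\<close>

text \<open>
  The congruence follows from the equation, as \<open>f - 1 = (\<delta> - 1) (card F - f)\<close>.
\<close>

lemma F_number_iff:
  assumes "2 \<le> \<delta>"
  shows "F_number \<delta> F f \<longleftrightarrow> (int \<delta> - 1) * int (card F) + 1 = int \<delta> * f"
proof -
  have "real (card F) = (real \<delta> * real_of_int f - 1) / (real \<delta> - 1) \<longleftrightarrow>
      (real \<delta> - 1) * real (card F) + 1 = real \<delta> * real_of_int f"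
    using assms by (auto simp: field_simps)
  also have "\<dots> \<longleftrightarrow> real_of_int ((int \<delta> - 1) * int (card F) + 1) = real_of_int (int \<delta> * f)"
    by simp
  also have "\<dots> \<longleftrightarrow> (int \<delta> - 1) * int (card F) + 1 = int \<delta> * f"
    by (simp only: of_int_eq_iff)
  finally have eq: "real (card F) = (real \<delta> * real_of_int f - 1) / (real \<delta> - 1) \<longleftrightarrow>
      (int \<delta> - 1) * int (card F) + 1 = int \<delta> * f" .
  have "[f = 1] (mod int \<delta> - 1)" if "(int \<delta> - 1) * int (card F) + 1 = int \<delta> * f"
  proof -
    have "f - 1 = (int \<delta> - 1) * (int (card F) - f)" using that by (simp add: algebra_simps)
    then show ?thesis by (simp add: cong_iff_dvd_diff)
  qed
  then show ?thesis unfolding F_number_def eq by blast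
qed

lemma circuit_minimal:
  assumes "C \<in> circuits M" "B \<subseteq> C" "B \<noteq> C"
  shows "B \<in> indep M"
proof (rule ccontr)
  assume "B \<notin> indep M"
  moreover have "C \<subseteq> ground M" using assms(1) by (simp add: circuits_def minimal_sets_def)
  ultimately have "B \<in> Pow (ground M) - indep M" using assms(2) by blast
  then show False using assms by (simp add: circuits_def minimal_sets_def)
qed

lemma circuitE:
  assumes "matroid M" "X \<subseteq> ground M" "X \<notin> indep M"
  obtains C where "C \<in> circuits M" "C \<subseteq> X"
proof -
  have "\<exists>C\<in>circuits M. C \<subseteq> X" using assms(2,3)
  proof (induction "card X" arbitrary: X rule: less_induct)
    case less
    show ?case
    proof (cases "X \<in> circuits M")
      case False
      then obtain Y where Y: "Y \<subseteq> X" "Y \<noteq> X" "Y \<in> Pow (ground M) - indep M"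
        using less.prems by (auto simp: circuits_def minimal_sets_def)
      have "finite X" using less.prems(1) finite_ground[OF assms(1)] finite_subset by blast
      then have "card Y < card X" using Y by (intro psubset_card_mono) auto
      then show ?thesis using less.hyps[of Y] Y by blast
    qed blast
  qed
  then show ?thesis using that by blast
qed

lemma circuits_eqI:
  assumes "matroid M" "\<And>C. C \<in> \<D> \<Longrightarrow> C \<subseteq> ground M \<and> C \<notin> indep M" "circuits M \<subseteq> \<D>"
  shows "circuits M = minimal_sets \<D>"
proof (intro equalityI subsetI)
  fix C assume "C \<in> circuits M"
  then show "C \<in> minimal_sets \<D>"
    using assms(2,3) by (auto simp: circuits_def minimal_sets_def)
next
  fix C assume C: "C \<in> minimal_sets \<D>"
  then have "C \<in> \<D>" by (simp add: minimal_sets_def)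
  then have "C \<subseteq> ground M" "C \<notin> indep M" using assms(2) by auto
  then obtain C' where C': "C' \<in> circuits M" "C' \<subseteq> C" by (rule circuitE[OF assms(1)])
  then have "C' \<in> \<D>" using assms(3) by blast
  then have "C' = C" using C C'(2) by (simp add: minimal_sets_def)
  then show "C \<in> circuits M" using C' by simp
qed

lemma minimal_setsE:
  assumes "X \<in> \<D>" "finite X"
  obtains C where "C \<in> minimal_sets \<D>" "C \<subseteq> X"
proof -
  have "\<exists>C\<in>minimal_sets \<D>. C \<subseteq> X" using assms
  proof (induction "card X" arbitrary: X rule: less_induct)
    case less
    show ?case
    proof (cases "X \<in> minimal_sets \<D>")
      case False
      then obtain Y where Y: "Y \<subseteq> X" "Y \<noteq> X" "Y \<in> \<D>"
        using less.prems by (auto simp: minimal_sets_def)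
      then have "card Y < card X" using less.prems(2) by (intro psubset_card_mono) auto
      then show ?thesis using less.hyps[of Y] Y less.prems(2) finite_subset by blast
    qed blast
  qed
  then show ?thesis using that by blast
qed

text \<open>
  Fix a basis \<open>I\<close> of a connected flat \<open>X\<close> and call a member \<open>T\<close> of the family tight if it contains the
  maximal possible number \<open>f\<close> of elements of \<open>I\<close>. Fundamental circuits show that tight sets cover
  \<open>X\<close>; since \<open>f\<close> is modular on intersecting pairs, the union of two intersecting tight sets is
  tight. A maximal tight set \<open>T\<close> then separates \<open>X\<close>: \<open>I \<inter> T\<close> spans \<open>T\<close>, and \<open>I - T\<close> spans \<open>X - T\<close>,
  which is covered by tight sets disjoint from \<open>T\<close>. Hence \<open>X = T\<close> and \<open>f\<close> is the rank of \<open>X\<close>.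
\<close>

lemma F_matroid_imp_balanced:
  fixes N :: "'a set_system"
  assumes \<delta>: "2 \<le> \<delta>" and "F_matroid \<delta> N"
  shows "balanced \<delta> (\<delta> - 1) N"
  unfolding balanced_def
proof (intro allI impI)
  define D :: "'a set set \<Rightarrow> 'a set set"
    where "D = (\<lambda>\<F>. {C. \<exists>F\<in>\<F>. \<exists>f. F_number \<delta> F f \<and> C \<subseteq> F \<and> int (card C) = f + 1})"
  obtain \<F> where N: "matroid N" and fam: "F_family \<delta> (ground N) \<F>"
    and circ: "circuits N = minimal_sets (D \<F>)"
    using assms(2) unfolding F_matroid_def D_def by blast
  have fin: "finite F" "F \<subseteq> ground N" if "F \<in> \<F>" for F
  proof -
    show "F \<subseteq> ground N" using fam that unfolding F_family_def by blast
    then show "finite F" using finite_ground[OF N] finite_subset by blast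
  qed
  have cap_cup: "F \<inter> G \<in> \<F>" "F \<union> G \<in> \<F>" if "F \<in> \<F>" "G \<in> \<F>" "F \<inter> G \<noteq> {}" for F G
    using fam that unfolding F_family_def by blast+
  have num: "\<exists>f. F_number \<delta> F f" if "F \<in> \<F>" for F
    using fam that unfolding F_family_def by blast
  have sing: "{e} \<in> \<F>" "F_number \<delta> {e} 1" if "e \<in> ground N" for e
    using fam that \<delta> unfolding F_family_def F_number_iff[OF \<delta>] by auto
  have pos: "0 < f" if "F_number \<delta> F f" for F f
  proof -
    have "0 \<le> (int \<delta> - 1) * int (card F)" using \<delta> by simp
    then have "0 < int \<delta> * f" using that unfolding F_number_iff[OF \<delta>] by linarith
    then show ?thesis by (simp add: zero_less_mult_iff)
  qed
  \<comment> \<open>A larger intersection would contain a member of \<open>D \<F>\<close>, hence a circuit.\<close>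
  have bound: "int (card (I \<inter> F)) \<le> f" if I: "I \<in> indep N" and F: "F \<in> \<F>" "F_number \<delta> F f" for I F f
  proof (rule ccontr)
    assume "\<not> ?thesis"
    then have "nat (f + 1) \<le> card (I \<inter> F)" by simp
    then obtain C where C: "C \<subseteq> I \<inter> F" "card C = nat (f + 1)" "finite C"
      by (metis obtain_subset_with_card_n)
    then have "C \<in> D \<F>" using F pos[OF F(2)] by (auto simp: D_def)
    then obtain C' where C': "C' \<in> minimal_sets (D \<F>)" "C' \<subseteq> C" using C(3) by (rule minimal_setsE)
    then have "C' \<notin> indep N" using circ by (auto simp: circuits_def minimal_sets_def)
    moreover have "C' \<subseteq> I" using C C' by blast
    ultimately show False using indep_subset[OF N I] by blast
  qed
  have nonloops: "nonloops N = ground N"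
  proof (intro equalityI subsetI)
    fix e assume e: "e \<in> ground N"
    show "e \<in> nonloops N"
    proof (rule ccontr)
      assume "e \<notin> nonloops N"
      then have "{e} \<notin> indep N" "{e} \<subseteq> ground N" using e by (auto simp: nonloops_def)
      then obtain C where C: "C \<in> circuits N" "C \<subseteq> {e}" using circuitE[OF N] by metis
      then have "C \<in> D \<F>" using circ by (auto simp: minimal_sets_def)
      then obtain F f where "F \<in> \<F>" "F_number \<delta> F f" "int (card C) = f + 1" unfolding D_def by blast
      moreover have "card C \<le> 1" using C(2) card_mono[of "{e}" C] by simp
      ultimately show False using pos by fastforce
    qed
  qed (use nonloops_subset_ground[OF N] in blast)
  fix X assume X: "connected_flat N X"
  then have flatX: "flat N X" and insep: "inseparable N X" by (simp_all add: connected_flat_def)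
  have X_ground: "X \<subseteq> ground N" using flatX nonloops by (simp add: flat_def)
  obtain I where I: "I \<in> indep N" "I \<subseteq> X" "card I = rank_of N X" using rank_witness[OF N] by blast
  have finI: "finite I" using finite_indep[OF N I(1)] .
  define tight where "tight = (\<lambda>T. T \<in> \<F> \<and> F_number \<delta> T (int (card (I \<inter> T))))"
  have tight_exists: "\<exists>T. tight T \<and> x \<in> T" if x: "x \<in> X" for x
  proof (cases "x \<in> I")
    case True
    then have "I \<inter> {x} = {x}" by blast
    then show ?thesis using sing[of x] x X_ground by (intro exI[of _ "{x}"]) (auto simp: tight_def)
  next
    case False
    \<comment> \<open>The member of the family that contains the fundamental circuit of \<open>x\<close> is tight.\<close>
    have "insert x I \<notin> indep N"
    proof
      assume "insert x I \<in> indep N"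
      then have "card (insert x I) \<le> rank_of N X" using I x by (intro card_le_rank[OF N]) auto
      then show False using False finI I by simp
    qed
    then obtain C where C: "C \<in> circuits N" "C \<subseteq> insert x I"
      using circuitE[OF N, of "insert x I"] x X_ground I by auto
    then have "C \<in> D \<F>" using circ by (auto simp: minimal_sets_def)
    then obtain F f where F: "F \<in> \<F>" "F_number \<delta> F f" "C \<subseteq> F" "int (card C) = f + 1"
      unfolding D_def by blast
    have "C \<notin> indep N" using C by (auto simp: circuits_def minimal_sets_def)
    then have "x \<in> C" using C indep_subset[OF N I(1), of C] by blast
    have finC: "finite C" using C finI finite_subset by blast
    then have "card (C - {x}) = card C - 1" using \<open>x \<in> C\<close> by simp
    moreover have "card (C - {x}) \<le> card (I \<inter> F)" using C F finI by (intro card_mono) auto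
    moreover have "0 < card C" using \<open>x \<in> C\<close> finC card_gt_0_iff by blast
    ultimately have "f \<le> int (card (I \<inter> F))" using F(4) by linarith
    then have "f = int (card (I \<inter> F))" using bound[OF I(1) F(1,2)] by simp
    then have "tight F" using F by (simp add: tight_def)
    then show ?thesis using \<open>x \<in> C\<close> F by blast
  qed
  have tight_Un: "tight (T \<union> U)" if T: "tight T" and U: "tight U" and TU: "T \<inter> U \<noteq> {}" for T U
  proof -
    have TU': "T \<inter> U \<in> \<F>" "T \<union> U \<in> \<F>" using cap_cup T U TU by (auto simp: tight_def)
    obtain f where f: "F_number \<delta> (T \<union> U) f" using num TU' by blast
    obtain g where g: "F_number \<delta> (T \<inter> U) g" using num TU' by blast
    have finTU: "finite T" "finite U" using fin T U by (auto simp: tight_def)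
    \<comment> \<open>The cardinality determines \<open>f\<close> affinely, so \<open>f\<close> is modular; both bounds must be attained.\<close>
    have "int (card T) + int (card U) = int (card (T \<union> U)) + int (card (T \<inter> U))"
      using card_Un_Int[OF finTU] by (simp flip: of_nat_add)
    then have "(int \<delta> - 1) * int (card T) + (int \<delta> - 1) * int (card U)
        = (int \<delta> - 1) * int (card (T \<union> U)) + (int \<delta> - 1) * int (card (T \<inter> U))"
      by (simp flip: distrib_left)
    then have "int \<delta> * int (card (I \<inter> T)) + int \<delta> * int (card (I \<inter> U)) = int \<delta> * f + int \<delta> * g"
      using T U f g unfolding tight_def F_number_iff[OF \<delta>] by linarith
    then have "int \<delta> * (int (card (I \<inter> T)) + int (card (I \<inter> U))) = int \<delta> * (f + g)"
      by (simp add: distrib_left)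
    then have "int (card (I \<inter> T)) + int (card (I \<inter> U)) = f + g" using \<delta> by simp
    moreover have "card (I \<inter> T) + card (I \<inter> U) = card (I \<inter> (T \<union> U)) + card (I \<inter> (T \<inter> U))"
      using card_Un_Int[of "I \<inter> T" "I \<inter> U"] finI by (simp add: Int_Un_distrib Int_assoc Int_left_commute)
    ultimately have "f = int (card (I \<inter> (T \<union> U)))"
      using bound[OF I(1) TU'(2) f] bound[OF I(1) TU'(1) g] by linarith
    then show ?thesis using f TU' by (simp add: tight_def)
  qed
  have tight_rank: "rank_of N T \<le> card (I \<inter> T)" if T: "tight T" for T
  proof -
    obtain J where J: "J \<in> indep N" "J \<subseteq> T" "card J = rank_of N T" using rank_witness[OF N] by blast
    have "int (card (J \<inter> T)) \<le> int (card (I \<inter> T))"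
      using T unfolding tight_def by (intro bound[OF J(1)]) auto
    moreover have "J \<inter> T = J" using J by blast
    ultimately show ?thesis using J by simp
  qed
  have tight_spanned: "rank_of N (insert e A) = rank_of N A"
    if T: "tight T" "e \<in> T" and A: "I \<inter> T \<subseteq> A" for e T A
  proof (rule rank_absorb_mono[OF N _ A])
    have "rank_of N (insert e (I \<inter> T)) \<le> rank_of N T" using T by (intro rank_mono[OF N]) auto
    also have "\<dots> \<le> card (I \<inter> T)" by (rule tight_rank[OF T(1)])
    also have "\<dots> = rank_of N (I \<inter> T)"
      using rank_indep[OF N indep_subset[OF N I(1), of "I \<inter> T"]] by simp
    finally show "rank_of N (insert e (I \<inter> T)) = rank_of N (I \<inter> T)"
      using rank_mono[OF N subset_insertI[of "I \<inter> T" e]] by simp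
  qed
  have tight_subset: "T \<subseteq> X" if T: "tight T" for T
  proof
    fix e assume e: "e \<in> T"
    then have "rank_of N (insert e X) = rank_of N X" using tight_spanned[OF T e, of X] I by blast
    moreover have "e \<in> nonloops N" using T e fin nonloops by (auto simp: tight_def)
    ultimately show "e \<in> X" using flat_absorbs[OF N flatX] by blast
  qed
  obtain x0 where x0: "x0 \<in> X" using inseparable_nonempty[OF N insep] by blast
  define \<T> where "\<T> = {T. tight T \<and> x0 \<in> T}"
  have "\<T> \<subseteq> Pow X" unfolding \<T>_def using tight_subset by blast
  then have finT: "finite \<T>" using flat_finite[OF N flatX] finite_subset by blast
  have neT: "\<T> \<noteq> {}" unfolding \<T>_def using tight_exists[OF x0] by blast
  obtain T where "T \<in> \<T>" and maxT': "\<forall>U\<in>\<T>. T \<subseteq> U \<longrightarrow> T = U"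
    using finite_has_maximal[OF finT neT] by blast
  then have T: "tight T" "x0 \<in> T" by (simp_all add: \<T>_def)
  have maxT: "T = U" if "tight U" "T \<subseteq> U" for U
    using maxT' that T by (auto simp: \<T>_def)
  have disjoint: "T \<inter> U = {}" if "tight U" "\<not> U \<subseteq> T" for U
  proof (rule ccontr)
    assume "T \<inter> U \<noteq> {}"
    then have "tight (T \<union> U)" by (rule tight_Un[OF T(1) that(1)])
    then have "T = T \<union> U" by (rule maxT) simp
    then show False using that by blast
  qed
  have "rank_of N ((I - T) \<union> (X - T)) = rank_of N (I - T)"
  proof (rule rank_absorb[OF N])
    fix x assume x: "x \<in> X - T"
    then obtain U where U: "tight U" "x \<in> U" using tight_exists[of x] by blast
    have "T \<inter> U = {}" using x U(2) by (intro disjoint[OF U(1)]) blast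
    then have "I \<inter> U \<subseteq> I - T" by blast
    then show "rank_of N (insert x (I - T)) = rank_of N (I - T)" by (rule tight_spanned[OF U])
  qed
  moreover have "rank_of N (X - T) \<le> rank_of N ((I - T) \<union> (X - T))" by (intro rank_mono[OF N]) auto
  ultimately have "rank_of N (X - T) \<le> card (I - T)"
    using rank_indep[OF N indep_subset[OF N I(1), of "I - T"]] by simp
  moreover have "rank_of N T \<le> card (I \<inter> T)" using tight_rank[OF T(1)] .
  moreover have "card (I \<inter> T) + card (I - T) = card I" using card_Int_Diff[OF finI, of T] by simp
  ultimately have "rank_of N T + rank_of N (X - T) \<le> rank_of N X" using I by simp
  then have "T = {} \<or> X - T = {}"
    using inseparableD[OF N insep, of T "X - T"] tight_subset[OF T(1)] by blast
  then have "X = T" using T tight_subset[OF T(1)] by blast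
  then have "F_number \<delta> X (int (rank_of N X))" using T I by (simp add: tight_def Int_absorb2)
  then have "int (\<delta> - 1) * int (card X) + 1 = int \<delta> * int (rank_of N X)"
    using \<delta> unfolding F_number_iff[OF \<delta>] by (simp add: of_nat_diff)
  then show "(\<delta> - 1) * card X + 1 = \<delta> * rank_of N X"
    by (metis of_nat_1 of_nat_add of_nat_eq_iff of_nat_mult)
qed

text \<open>
  The defect \<open>\<delta> * rank X - c * card X\<close> is additive over separations and equals \<open>1\<close> on connected
  flats, so on a flat it counts the connected components.
\<close>

lemma balanced_flat_defect:
  assumes M: "matroid M" and bal: "balanced \<delta> c M"
    and "flat M X" "X \<noteq> {}"
  shows "if inseparable M X then c * card X + 1 = \<delta> * rank_of M X
         else c * card X + 2 \<le> \<delta> * rank_of M X"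
  using assms(3,4)
proof (induction "card X" arbitrary: X rule: less_induct)
  case less
  show ?case
  proof (cases "inseparable M X")
    case True
    then show ?thesis using bal less.prems by (simp add: balanced_def connected_flat_def)
  next
    case False
    obtain Y Z where YZ: "Y \<union> Z = X" "Y \<inter> Z = {}" "Y \<noteq> {}" "Z \<noteq> {}"
      "rank_of M Y + rank_of M Z = rank_of M X"
      using separableE[OF M less.prems(2) False] by metis
    have finX: "finite X" using flat_finite[OF M less.prems(1)] .
    have flats: "flat M Y" "flat M Z"
      using flat_separation_part[OF M less.prems(1) YZ(1,2,5)]
        flat_separation_part[OF M less.prems(1), of Z Y] YZ by (auto simp: Un_commute Int_commute add.commute)
    have "card Y < card X" "card Z < card X" using YZ finX by (auto intro!: psubset_card_mono)
    then have "c * card Y + 1 \<le> \<delta> * rank_of M Y" "c * card Z + 1 \<le> \<delta> * rank_of M Z"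
      using less.hyps[of Y] less.hyps[of Z] flats YZ(3,4) by (auto split: if_splits)
    moreover have "card X = card Y + card Z" using YZ finX by (metis card_Un_disjoint finite_Un)
    moreover have "\<delta> * rank_of M X = \<delta> * rank_of M Y + \<delta> * rank_of M Z"
      using YZ(5) by (simp flip: distrib_left)
    ultimately show ?thesis using False by (simp add: distrib_left)
  qed
qed

text \<open>
  For \<open>c = 1\<close> this is what \<open>independent_decomposition\<close> requires in order to write the indicator vector
  of the nonloops as a sum of \<open>\<delta>\<close> independent sets.
\<close>

lemma balanced_card_le:
  assumes M: "matroid M" and bal: "balanced \<delta> c M" and A: "A \<subseteq> nonloops M"
  shows "c * card A \<le> \<delta> * rank_of M A"
proof (cases "A = {}")
  case False
  have "flat M (span_of M A)" using flat_span_of[OF M A] .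
  moreover have sub: "A \<subseteq> span_of M A" using subset_span_of[OF M A] .
  moreover have "span_of M A \<noteq> {}" using sub False by blast
  ultimately have "c * card (span_of M A) \<le> \<delta> * rank_of M (span_of M A)"
    using balanced_flat_defect[OF M bal, of "span_of M A"] by (simp split: if_splits)
  moreover have "card A \<le> card (span_of M A)"
    using sub flat_finite[OF M flat_span_of[OF M A]] by (intro card_mono)
  ultimately show ?thesis
    using rank_span_of[OF M A] by (metis mult_le_mono2 order_trans)
qed simp

text \<open>
  Submodularity of the rank and the size of the span of the union make the defect submodular; both
  the intersection and the span of the union have defect at least \<open>1\<close>, so nothing is lost: both have
  defect exactly \<open>1\<close> and the union spans no further element.
\<close>

lemma connected_flat_Int_Un:
  assumes M: "matroid M" and bal: "balanced \<delta> c M" and c: "0 < c"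
    and F: "connected_flat M F" and G: "connected_flat M G" and meet: "F \<inter> G \<noteq> {}"
  shows "connected_flat M (F \<inter> G) \<and> connected_flat M (F \<union> G)"
proof -
  have flats: "flat M F" "flat M G" using F G by (simp_all add: connected_flat_def)
  define U where "U = span_of M (F \<union> G)"
  have nl: "F \<union> G \<subseteq> nonloops M" using flats by (simp add: flat_def)
  have U: "flat M U" "F \<union> G \<subseteq> U" "rank_of M U = rank_of M (F \<union> G)"
    using flat_span_of[OF M nl] subset_span_of[OF M nl] rank_span_of[OF M nl] by (simp_all add: U_def)
  have I: "flat M (F \<inter> G)" using flat_Int[OF M flats] .
  have finU: "finite U" using flat_finite[OF M U(1)] .
  have eF: "c * card F + 1 = \<delta> * rank_of M F" and eG: "c * card G + 1 = \<delta> * rank_of M G"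
    using bal F G by (simp_all add: balanced_def)
  have dI: "if inseparable M (F \<inter> G) then c * card (F \<inter> G) + 1 = \<delta> * rank_of M (F \<inter> G)
         else c * card (F \<inter> G) + 2 \<le> \<delta> * rank_of M (F \<inter> G)"
    by (rule balanced_flat_defect[OF M bal I meet])
  have dU: "if inseparable M U then c * card U + 1 = \<delta> * rank_of M U
         else c * card U + 2 \<le> \<delta> * rank_of M U"
    using U meet by (intro balanced_flat_defect[OF M bal]) auto
  have "\<delta> * rank_of M (F \<union> G) + \<delta> * rank_of M (F \<inter> G) \<le> \<delta> * rank_of M F + \<delta> * rank_of M G"
    using rank_submodular[OF M, of F G] by (simp flip: distrib_left)
  moreover have "c * card F + c * card G = c * card (F \<union> G) + c * card (F \<inter> G)"
    using card_Un_Int[of F G] flat_finite[OF M flats(1)] flat_finite[OF M flats(2)]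
    by (simp flip: distrib_left)
  moreover have cU: "c * card (F \<union> G) \<le> c * card U"
    using U finU by (intro mult_le_mono2 card_mono)
  ultimately have *: "\<delta> * rank_of M U + \<delta> * rank_of M (F \<inter> G) \<le> c * card (F \<union> G) + c * card (F \<inter> G) + 2"
    unfolding U(3) using eF eG by linarith
  have dI1: "c * card (F \<inter> G) + 1 \<le> \<delta> * rank_of M (F \<inter> G)" and dU1: "c * card U + 1 \<le> \<delta> * rank_of M U"
    using dI dU by (simp_all split: if_splits)
  have insep: "inseparable M (F \<inter> G)" "inseparable M U" "c * card U = c * card (F \<union> G)"
  proof -
    show "inseparable M (F \<inter> G)"
    proof (rule ccontr)
      assume "\<not> ?thesis"
      with dI have "c * card (F \<inter> G) + 2 \<le> \<delta> * rank_of M (F \<inter> G)" by simp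
      then show False using * dU1 cU by linarith
    qed
    show "inseparable M U"
    proof (rule ccontr)
      assume "\<not> ?thesis"
      with dU have "c * card U + 2 \<le> \<delta> * rank_of M U" by simp
      then show False using * dI1 cU by linarith
    qed
    show "c * card U = c * card (F \<union> G)" using * dI1 dU1 cU by linarith
  qed
  then have "card (F \<union> G) = card U" using c by simp
  then have "F \<union> G = U" using U finU by (intro card_subset_eq) auto
  then show ?thesis using insep U I by (simp add: connected_flat_def)
qed

text \<open>
  The parallel class of \<open>e\<close> is connected, since the ranks of two nonempty sets of nonloops add up to
  at least \<open>2\<close>.
\<close>

lemma rank_one_connected_flat:
  assumes M: "matroid M" and e: "e \<in> nonloops M"
  shows "connected_flat M (span_of M {e})" and "rank_of M (span_of M {e}) = 1"
proof -
  have sub: "{e} \<subseteq> nonloops M" using e by simp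
  show r: "rank_of M (span_of M {e}) = 1"
    using rank_span_of[OF M sub] rank_nonloop[OF M e] by simp
  have nl: "span_of M {e} \<subseteq> nonloops M" by (auto simp: span_of_def)
  have "inseparable M (span_of M {e})"
  proof (rule ccontr)
    assume "\<not> ?thesis"
    moreover have "span_of M {e} \<noteq> {}" using subset_span_of[OF M sub] by blast
    ultimately obtain Y Z where YZ: "Y \<union> Z = span_of M {e}" "Y \<noteq> {}" "Z \<noteq> {}"
      "rank_of M Y + rank_of M Z = 1"
      using separableE[OF M] r by metis
    obtain y z where "y \<in> Y" "z \<in> Z" using YZ by blast
    moreover have "y \<in> nonloops M" "z \<in> nonloops M" using calculation YZ(1) nl by blast+
    ultimately have "0 < rank_of M Y" "0 < rank_of M Z" using rank_pos[OF M, of y Y] rank_pos[OF M, of z Z] by simp_all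
    then show False using YZ by simp
  qed
  then show "connected_flat M (span_of M {e})" using flat_span_of[OF M sub] by (simp add: connected_flat_def)
qed

text \<open>
  The connected flats form the family. The span \<open>F\<close> of a circuit \<open>C\<close> is a connected flat of rank
  \<open>card C - 1\<close>: a separation of \<open>F\<close> would separate \<open>C\<close>, so one of its parts would contain \<open>C\<close> and hence
  leave rank \<open>0\<close> for the other one.
\<close>

lemma balanced_imp_F_matroid:
  assumes M: "matroid M" and nonloops: "nonloops M = ground M" and \<delta>: "2 \<le> \<delta>"
    and bal: "balanced \<delta> (\<delta> - 1) M"
  shows "F_matroid \<delta> M"
proof -
  let ?F = "{F. connected_flat M F}"
  have num: "F_number \<delta> F f \<longleftrightarrow> f = int (rank_of M F)" if "connected_flat M F" for F f
  proof -
    have "(\<delta> - 1) * card F + 1 = \<delta> * rank_of M F" using bal that by (simp add: balanced_def)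
    then have "int ((\<delta> - 1) * card F + 1) = int (\<delta> * rank_of M F)" by (rule arg_cong)
    then have "(int \<delta> - 1) * int (card F) + 1 = int \<delta> * int (rank_of M F)"
      using \<delta> by (simp add: of_nat_diff)
    then show ?thesis using \<delta> unfolding F_number_iff[OF \<delta>] by auto
  qed
  have ground: "F \<subseteq> ground M" if "connected_flat M F" for F
    using that nonloops by (simp add: connected_flat_def flat_def)
  have "F_family \<delta> (ground M) ?F"
    unfolding F_family_def
  proof (intro conjI ballI impI)
    show "finite (ground M)" using finite_ground[OF M] .
    show "?F \<subseteq> Pow (ground M)" using ground by blast
  next
    fix e assume "e \<in> ground M"
    then have e: "e \<in> nonloops M" using nonloops by simp
    note con = rank_one_connected_flat[OF M e]
    have "(\<delta> - 1) * card (span_of M {e}) + 1 = \<delta> * 1"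
      using bal con unfolding balanced_def by metis
    then have "(\<delta> - 1) * card (span_of M {e}) = (\<delta> - 1) * 1" using \<delta> by linarith
    then have "card (span_of M {e}) = 1" using \<delta> by (subst (asm) mult_cancel1) auto
    moreover have "e \<in> span_of M {e}" using subset_span_of[OF M, of "{e}"] e by simp
    ultimately have "span_of M {e} = {e}" by (metis card_1_singletonE singletonD)
    then show "{e} \<in> ?F" using con by simp
  next
    fix F G assume "F \<in> ?F" "G \<in> ?F" "F \<inter> G \<noteq> {}"
    then show "F \<inter> G \<in> ?F" "F \<union> G \<in> ?F"
      using connected_flat_Int_Un[OF M bal, of F G] \<delta> by auto
  next
    fix F assume "F \<in> ?F"
    then show "\<exists>f. F_number \<delta> F f" using num by blast
  qed
  moreover have "circuits M =
      minimal_sets {C. \<exists>F\<in>?F. \<exists>f. F_number \<delta> F f \<and> C \<subseteq> F \<and> int (card C) = f + 1}"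
  proof (rule circuits_eqI[OF M])
    fix C assume "C \<in> {C. \<exists>F\<in>?F. \<exists>f. F_number \<delta> F f \<and> C \<subseteq> F \<and> int (card C) = f + 1}"
    then obtain F where F: "connected_flat M F" "C \<subseteq> F" "card C = rank_of M F + 1"
      using num by force
    then have "C \<notin> indep M" using card_le_rank[OF M, of C F] by auto
    then show "C \<subseteq> ground M \<and> C \<notin> indep M" using F ground by blast
  next
    show "circuits M \<subseteq> {C. \<exists>F\<in>?F. \<exists>f. F_number \<delta> F f \<and> C \<subseteq> F \<and> int (card C) = f + 1}"
    proof
      fix C assume C: "C \<in> circuits M"
      have Cg: "C \<subseteq> nonloops M" and dep: "C \<notin> indep M"
        using C nonloops by (auto simp: circuits_def minimal_sets_def)
      have min: "B \<in> indep M" if "B \<subseteq> C" "B \<noteq> C" for B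
        using circuit_minimal[OF C that] .
      have finC: "finite C" using Cg finite_nonloops[OF M] finite_subset by blast
      have "C \<noteq> {}" using dep empty_indep[OF M] by auto
      then obtain x where x: "x \<in> C" by blast
      have "C - {x} \<in> indep M" using x by (intro min) auto
      then have "card (C - {x}) \<le> rank_of M C" by (intro card_le_rank[OF M]) auto
      moreover have "rank_of M C \<noteq> card C" using dep finC indep_iff_rank[OF M, of C] by blast
      ultimately have rC: "rank_of M C + 1 = card C"
        using rank_le_card[OF M finC] x finC card_Diff_singleton[of x C] card_gt_0_iff[of C] by auto
      let ?S = "span_of M C"
      have S: "flat M ?S" "C \<subseteq> ?S" "rank_of M ?S = rank_of M C"
        using flat_span_of[OF M Cg] subset_span_of[OF M Cg] rank_span_of[OF M Cg] by simp_all
      have "inseparable M ?S"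
      proof (rule ccontr)
        assume "\<not> ?thesis"
        moreover have "?S \<noteq> {}" using S \<open>C \<noteq> {}\<close> by blast
        ultimately obtain Y Z where YZ: "Y \<union> Z = ?S" "Y \<inter> Z = {}" "Y \<noteq> {}" "Z \<noteq> {}"
          "rank_of M Y + rank_of M Z = rank_of M ?S"
          using separableE[OF M] by metis
        have flats: "flat M Y" "flat M Z"
          using flat_separation_part[OF M S(1) YZ(1,2,5)]
            flat_separation_part[OF M S(1), of Z Y] YZ by (auto simp: Un_commute Int_commute add.commute)
        then have pos: "0 < rank_of M Y" "0 < rank_of M Z"
          using YZ(3,4) flat_rank_pos[OF M flats(1)] flat_rank_pos[OF M flats(2)] by simp_all
        have "\<not> C \<subseteq> Y"
        proof
          assume "C \<subseteq> Y"
          then have "rank_of M C \<le> rank_of M Y" by (rule rank_mono[OF M])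
          then show False using YZ(5) S(3) pos by simp
        qed
        moreover have "\<not> C \<subseteq> Z"
        proof
          assume "C \<subseteq> Z"
          then have "rank_of M C \<le> rank_of M Z" by (rule rank_mono[OF M])
          then show False using YZ(5) S(3) pos by simp
        qed
        ultimately have ind: "C \<inter> Y \<in> indep M" "C \<inter> Z \<in> indep M" by (auto intro!: min)
        have "card C = card (C \<inter> Y) + card (C \<inter> Z)"
        proof -
          have "C = (C \<inter> Y) \<union> (C \<inter> Z)" using S(2) YZ(1) by blast
          moreover have "(C \<inter> Y) \<inter> (C \<inter> Z) = {}" using YZ(2) by blast
          ultimately show ?thesis using card_Un_disjoint[of "C \<inter> Y" "C \<inter> Z"] finC by simp
        qed
        also have "\<dots> \<le> rank_of M Y + rank_of M Z"
          using ind by (intro add_mono card_le_rank[OF M]) auto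
        finally show False using YZ(5) S(3) rC by simp
      qed
      then have con: "connected_flat M ?S" using S by (simp add: connected_flat_def)
      moreover have "int (card C) = int (rank_of M ?S) + 1" using rC S(3) by simp
      ultimately show "C \<in> {C. \<exists>F\<in>?F. \<exists>f. F_number \<delta> F f \<and> C \<subseteq> F \<and> int (card C) = f + 1}"
        using num[OF con] S(2) by blast
    qed
  qed
  ultimately show ?thesis using M unfolding F_matroid_def by blast
qed

section \<open>The combinatorial characterization\<close>

lemma parallel_class_eq:
  assumes M: "matroid M" and e: "e \<in> nonloops M" and f: "f \<in> span_of M {e}"
  shows "span_of M {f} = span_of M {e}"
proof -
  have half: "span_of M {y} \<subseteq> span_of M {x}" if x: "x \<in> nonloops M" and y: "y \<in> span_of M {x}" for x y
  proof
    fix z assume z: "z \<in> span_of M {y}"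
    then have "rank_of M (insert z (span_of M {x})) = rank_of M (span_of M {x})"
      using y rank_absorb_mono[OF M, of z "{y}" "span_of M {x}"] by (simp add: span_of_def)
    moreover have "flat M (span_of M {x})" using x by (intro flat_span_of[OF M]) simp
    moreover have "z \<in> nonloops M" using z by (simp add: span_of_def)
    ultimately show "z \<in> span_of M {x}" using flat_absorbs[OF M, of "span_of M {x}" z] by simp
  qed
  have f': "f \<in> nonloops M" "rank_of M {f, e} = rank_of M {e}" using f by (auto simp: span_of_def)
  then have "rank_of M {e, f} = rank_of M {f}"
    using rank_nonloop[OF M e] rank_nonloop[OF M f'(1)] by (simp add: insert_commute)
  then have "e \<in> span_of M {f}" using e by (simp add: span_of_def)
  then show ?thesis using half[OF e f] half[OF f'(1)] by blast
qed

text \<open>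
  The simplification of \<open>M\<close>: all parallel classes are connected flats of rank \<open>1\<close>, hence have
  \<open>\<delta> - 1\<close> elements, and \<open>M\<close> is recovered from a system of representatives by blowing up.
\<close>

lemma balanced_connected_imp_blow_up:
  assumes M: "matroid M" and nonloops: "nonloops M = ground M" and insep: "inseparable M (ground M)"
    and \<delta>: "2 \<le> \<delta>" and bal: "balanced \<delta> 1 M"
  shows "\<exists>N. matroid_connected N \<and> F_matroid \<delta> N \<and> is_blow_up (\<delta> - 1) N M"
proof -
  define P where "P = (\<lambda>e. span_of M {e})"
  define rep where "rep = (\<lambda>e. SOME x. x \<in> P e)"
  define R where "R = rep ` ground M"
  define N where "N = restriction M R"
  have self: "e \<in> P e" if "e \<in> ground M" for e
    using subset_span_of[OF M, of "{e}"] that nonloops by (simp add: P_def)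
  have P_ground: "P e \<subseteq> ground M" for e using nonloops by (auto simp: P_def span_of_def)
  have P_eq: "P f = P e" if "e \<in> ground M" "f \<in> P e" for e f
    using parallel_class_eq[OF M, of e f] that nonloops by (simp add: P_def)
  have rep: "rep e \<in> P e" if "e \<in> ground M" for e
    unfolding rep_def using self[OF that] by (rule someI)
  have P_rep: "P (rep e) = P e" if "e \<in> ground M" for e using P_eq[OF that rep[OF that]] .
  have rep_rep: "rep (rep e) = rep e" if "e \<in> ground M" for e
    using P_rep[OF that] by (simp add: rep_def)
  have R: "R \<subseteq> ground M" using rep P_ground by (auto simp: R_def)
  have N: "matroid N" unfolding N_def by (rule matroid_restriction[OF M R])
  have groundN: "ground N = R" by (simp add: N_def restriction_def)
  have absorb: "rank_of M (insert y A) = rank_of M A" if "x \<in> A" "y \<in> P x" for x y A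
    using that rank_absorb_mono[OF M, of y "{x}" A] by (simp add: P_def span_of_def)
  have rank_rep: "rank_of M (rep ` I) = rank_of M I" if I: "I \<subseteq> ground M" for I
  proof -
    have "rank_of M (I \<union> rep ` I) = rank_of M I"
      using I rep absorb by (intro rank_absorb[OF M]) blast
    moreover have "rank_of M (rep ` I \<union> I) = rank_of M (rep ` I)"
    proof (rule rank_absorb[OF M])
      fix x assume x: "x \<in> I"
      then have "x \<in> P (rep x)" using P_rep[of x] self[of x] I by auto
      then show "rank_of M (insert x (rep ` I)) = rank_of M (rep ` I)" using x absorb[of "rep x"] by blast
    qed
    ultimately show ?thesis by (simp add: Un_commute)
  qed
  have inj: "inj_on rep I" if I: "I \<in> indep M" for I
  proof (rule inj_onI, rule ccontr)
    fix x y assume xy: "x \<in> I" "y \<in> I" "rep x = rep y" "x \<noteq> y"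
    have g: "x \<in> ground M" "y \<in> ground M" using xy indep_subset_ground[OF M I] by auto
    then have "y \<in> P x" using P_rep[of x] P_rep[of y] self[of y] xy by simp
    then have "rank_of M {y, x} = rank_of M {x}" using absorb[of x "{x}" y] by simp
    also have "\<dots> = 1" using rank_nonloop[OF M] g nonloops by blast
    finally have "rank_of M {y, x} = 1" .
    moreover have "{y, x} \<in> indep M" using xy by (intro indep_subset[OF M I]) auto
    then have "rank_of M {y, x} = card {y, x}" by (rule rank_indep[OF M])
    ultimately show False using xy by simp
  qed
  have "I \<in> indep M \<longleftrightarrow> I \<subseteq> ground M \<and> inj_on rep I \<and> rep ` I \<in> indep N" for I
  proof (cases "I \<subseteq> ground M")
    case True
    then have fin: "finite I" using finite_ground[OF M] finite_subset by blast
    have "rep ` I \<in> indep N \<longleftrightarrow> rep ` I \<in> indep M" using True by (auto simp: N_def restriction_def R_def)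
    also have "\<dots> \<longleftrightarrow> rank_of M I = card (rep ` I)"
      using indep_iff_rank[OF M, of "rep ` I"] rank_rep[OF True] fin by simp
    finally have "rep ` I \<in> indep N \<longleftrightarrow> rank_of M I = card (rep ` I)" .
    moreover have "I \<in> indep M \<longleftrightarrow> rank_of M I = card I" using indep_iff_rank[OF M] fin by blast
    ultimately show ?thesis using inj[of I] True card_image[of rep I] by auto
  next
    case False
    then show ?thesis using indep_subset_ground[OF M] by blast
  qed
  then have Mext: "M = parallel_extension N (ground M) rep"
    by (auto simp: parallel_extension_def intro: set_system.equality)
  have finM: "finite (ground M)" using finite_ground[OF M] .
  have fibre: "card {x \<in> ground M. rep x = e} = \<delta> - 1" if e: "e \<in> R" for e
  proof -
    obtain z where z: "z \<in> ground M" "e = rep z" using e by (auto simp: R_def)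
    have eM: "e \<in> ground M" "rep e = e" using e R rep_rep z by auto
    have "{x \<in> ground M. rep x = e} = P e"
    proof (intro equalityI subsetI)
      fix x assume "x \<in> {x \<in> ground M. rep x = e}"
      then show "x \<in> P e" using P_rep[of x] self[of x] by auto
    next
      fix x assume x: "x \<in> P e"
      then have "rep x = rep e" using P_eq[OF eM(1) x] by (simp add: rep_def)
      then show "x \<in> {x \<in> ground M. rep x = e}" using x P_ground eM by auto
    qed
    moreover have "card (P e) + 1 = \<delta> * 1"
      using rank_one_connected_flat[OF M, of e] bal eM nonloops unfolding balanced_def P_def by (metis mult_1)
    ultimately show ?thesis by simp
  qed
  have nonloopsN: "nonloops N = ground N"
  proof -
    have "e \<in> nonloops N" if "e \<in> R" for e
      using that R nonloops by (auto simp: N_def restriction_def nonloops_def)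
    then show ?thesis using nonloops_subset_ground[OF N] groundN by blast
  qed
  have balN: "balanced \<delta> (\<delta> - 1) N"
    using balanced_parallel_extension[OF N finM, of "\<delta> - 1" rep \<delta>] Mext bal fibre nonloopsN groundN \<delta> by auto
  have "inseparable (parallel_extension N (ground M) rep) (ground M)" using insep Mext by simp
  moreover have "ground M \<subseteq> nonloops (parallel_extension N (ground M) rep)" using nonloops Mext by simp
  ultimately have "inseparable N (ground N)"
    using inseparable_parallel_extension[OF N finM, of "ground M" rep] groundN by (simp add: R_def)
  then have "matroid_connected N" by (rule inseparable_imp_matroid_connected[OF N])
  moreover have "F_matroid \<delta> N" by (rule balanced_imp_F_matroid[OF N nonloopsN \<delta> balN])
  moreover have "is_blow_up (\<delta> - 1) N M"
  proof -
    obtain es where es: "set es = ground N" "distinct es"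
      using finite_distinct_list[OF finite_ground[OF N]] by blast
    have "blow_up_elements (\<delta> - 1) es N (parallel_extension N (ground M) rep)"
    proof (rule blow_up_elements_parallel_extension[OF N es(2) _ _ finM])
      show "set es \<subseteq> ground N" "0 < \<delta> - 1" using es \<delta> by auto
      show "ground N \<subseteq> ground M" "rep ` ground M \<subseteq> ground N" using R groundN by (auto simp: R_def)
      show "rep e = e" if "e \<in> ground N" for e using that groundN rep_rep by (auto simp: R_def)
      show "card {x \<in> ground M. rep x = e} = (if e \<in> set es then \<delta> - 1 else 1)" if "e \<in> ground N" for e
        using that groundN es fibre by simp
    qed
    then show ?thesis using es Mext unfolding is_blow_up_def by auto
  qed
  ultimately show ?thesis by blast
qed

text \<open>
  A connected matroid with a loop \<open>e\<close> has no other element, because \<open>e\<close> adds no rank to the rest.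
\<close>

lemma balanced_iff_direct_sum:
  assumes M: "matroid M" and \<delta>: "2 \<le> \<delta>"
  shows "balanced \<delta> 1 M \<longleftrightarrow>
    (\<exists>Ms. pairwise_disjoint_grounds Ms \<and> M = direct_sum Ms \<and>
       (\<forall>L \<in> set Ms. (\<exists>e. L = loop e) \<or>
          (\<exists>N. matroid_connected N \<and> F_matroid \<delta> N \<and> is_blow_up (\<delta> - 1) N L)))"
    (is "_ \<longleftrightarrow> (\<exists>Ms. _ \<and> _ \<and> (\<forall>L \<in> set Ms. ?summand L))")
proof
  assume bal: "balanced \<delta> 1 M"
  obtain Ms where Ms: "pairwise_disjoint_grounds Ms" "M = direct_sum Ms"
    and L: "\<forall>L\<in>set Ms. matroid L \<and> inseparable L (ground L)"
    using connected_decomposition[OF M] by blast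
  have "?summand L" if LMs: "L \<in> set Ms" for L
  proof -
    have matL: "matroid L" and insepL: "inseparable L (ground L)" using L LMs by auto
    have "balanced \<delta> 1 L" using balanced_direct_sum[OF Ms(1), of \<delta> 1] L LMs bal Ms(2) by blast
    show ?thesis
    proof (cases "nonloops L = ground L")
      case True
      then show ?thesis
        using balanced_connected_imp_blow_up[OF matL True insepL \<delta> \<open>balanced \<delta> 1 L\<close>] by blast
    next
      case False
      then obtain e where e: "e \<in> ground L" "e \<notin> nonloops L" using nonloops_subset_ground[OF matL] by blast
      then have g: "ground L = {e}" by (rule inseparable_nonloops_unless_singleton[OF matL insepL])
      have "indep L \<subseteq> {{}}"
      proof
        fix I assume "I \<in> indep L"
        then have "I \<subseteq> nonloops L" "I \<subseteq> {e}" using indep_subset_nonloops[OF matL] indep_subset_ground[OF matL] g by auto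
        then show "I \<in> {{}}" using e by blast
      qed
      then have "indep L = {{}}" using empty_indep[OF matL] by blast
      then have "L = loop e" using g by (simp add: loop_def)
      then show ?thesis by blast
    qed
  qed
  then show "\<exists>Ms. pairwise_disjoint_grounds Ms \<and> M = direct_sum Ms \<and> (\<forall>L \<in> set Ms. ?summand L)"
    using Ms by blast
next
  assume "\<exists>Ms. pairwise_disjoint_grounds Ms \<and> M = direct_sum Ms \<and> (\<forall>L \<in> set Ms. ?summand L)"
  then obtain Ms where Ms: "pairwise_disjoint_grounds Ms" "M = direct_sum Ms"
    and L: "\<forall>L \<in> set Ms. ?summand L" by blast
  have *: "matroid L \<and> balanced \<delta> 1 L" if LMs: "L \<in> set Ms" for L
  proof -
    consider e where "L = loop e" | N where "F_matroid \<delta> N" "is_blow_up (\<delta> - 1) N L"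
      using L LMs by blast
    then show ?thesis
    proof cases
      case 1
      then show ?thesis by (simp add: matroid_loop balanced_loop)
    next
      case 2
      have N: "matroid N" using 2 by (simp add: F_matroid_def)
      obtain es where es: "distinct es" "set es = ground N" "blow_up_elements (\<delta> - 1) es N L"
        using 2 unfolding is_blow_up_def by blast
      have sub: "set es \<subseteq> ground N" "0 < \<delta> - 1" using es \<delta> by auto
      obtain \<pi> where \<pi>: "L = parallel_extension N (ground L) \<pi>" "finite (ground L)"
        "\<forall>e\<in>ground N. card {x \<in> ground L. \<pi> x = e} = (if e \<in> set es then \<delta> - 1 else 1)"
        using blow_up_elements_imp_parallel_extension[OF N es(1) sub es(3)] by blast
      have "card {x \<in> ground L. \<pi> x = e} = \<delta> - 1" if "e \<in> nonloops N" for e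
        using that nonloops_subset_ground[OF N] \<pi>(3) es(2) by auto
      then have "balanced \<delta> 1 (parallel_extension N (ground L) \<pi>)"
        using balanced_parallel_extension[OF N \<pi>(2) sub(2), of \<pi> \<delta>] F_matroid_imp_balanced[OF \<delta> 2(1)] by blast
      moreover have "matroid (parallel_extension N (ground L) \<pi>)"
        by (rule matroid_parallel_extension[OF N \<pi>(2)])
      ultimately show ?thesis using \<pi>(1) by simp
    qed
  qed
  then show "balanced \<delta> 1 M" using balanced_direct_sum[OF Ms(1), of \<delta> 1] Ms(2) by blast
qed

section \<open>The independence polytope\<close>

definition indicator_vec :: "'n::finite set \<Rightarrow> real ^ 'n" where
  "indicator_vec I = (\<Sum>e\<in>I. axis e 1)"

lemma indicator_vec_nth: "indicator_vec I $ i = of_bool (i \<in> I)"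
  unfolding indicator_vec_def by (simp add: axis_def if_distrib sum.If_cases)

lemma indicator_vec_singleton: "indicator_vec {e} = axis e 1"
  by (simp add: indicator_vec_def)

lemma indicator_vec_empty: "indicator_vec {} = 0"
  by (simp add: indicator_vec_def)

lemma sum_indicator_vec:
  fixes A :: "'n::finite set"
  shows "(\<Sum>i\<in>A. indicator_vec I $ i) = real (card (A \<inter> I))"
  by (simp add: indicator_vec_nth sum_of_bool_eq Int_def)

lemma indicator_vec_lattice: "indicator_vec I \<in> lattice_points"
  by (auto simp: lattice_points_def indicator_vec_nth of_bool_def)

lemma inner_indicator_vec: "indicator_vec A \<bullet> x = (\<Sum>i\<in>A. x $ i)"
proof -
  have "indicator_vec A \<bullet> x = (\<Sum>i\<in>UNIV. if i \<in> A then x $ i else 0)"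
    unfolding inner_vec_def by (intro sum.cong) (auto simp: indicator_vec_nth)
  then show ?thesis by (simp add: sum.If_cases)
qed

context
  fixes M :: "'n::finite set_system"
  assumes M: "matroid M"
begin

lemma independence_polytope_eq: "independence_polytope M = convex hull (indicator_vec ` indep M)"
  by (simp add: independence_polytope_def indicator_vec_def[abs_def])

lemma indicator_vec_in_polytope: "I \<in> indep M \<Longrightarrow> indicator_vec I \<in> independence_polytope M"
  unfolding independence_polytope_eq by (intro hull_inc) simp

lemma convex_independence_polytope: "convex (independence_polytope M)"
  unfolding independence_polytope_eq by (rule convex_convex_hull)

lemma rank_outside_nonloops: "A \<inter> nonloops M = {} \<Longrightarrow> rank_of M A = 0"
  using rank_Int_nonloops[OF M, of A] rank_empty[OF M] by simp

lemma lattice_point_decomposition: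
  assumes x: "x \<in> lattice_points" "\<And>i. 0 \<le> x $ i" "\<And>A. (\<Sum>i\<in>A. x $ i) \<le> real k * real (rank_of M A)"
  shows "\<exists>I. (\<forall>i<k. I i \<in> indep M) \<and> x = (\<Sum>i<k. indicator_vec (I i))"
proof -
  define y where "y = (\<lambda>e. nat \<lfloor>x $ e\<rfloor>)"
  have y: "real (y e) = x $ e" for e
    using x(1,2) by (auto simp: y_def lattice_points_def)
  have "sum y A \<le> k * rank_of M A" for A
  proof -
    have "real (sum y A) \<le> real (k * rank_of M A)" using x(3)[of A] y by simp
    then show ?thesis by (simp only: of_nat_le_iff)
  qed
  then obtain I where I: "\<And>i. i < k \<Longrightarrow> I i \<in> indep M"
    "\<And>e. e \<in> ground M \<Longrightarrow> y e = (\<Sum>i<k. of_bool (e \<in> I i))"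
    using independent_decomposition[OF M, of y k] by blast
  have "x $ e = (\<Sum>i<k. indicator_vec (I i)) $ e" for e
  proof (cases "e \<in> ground M")
    case True
    have "x $ e = real (\<Sum>i<k. of_bool (e \<in> I i))" using y I(2)[OF True] by metis
    then show ?thesis by (simp add: sum_component indicator_vec_nth)
  next
    case False
    then have "{e} \<inter> nonloops M = {}" using nonloops_subset_ground[OF M] by blast
    then have "x $ e \<le> 0" using x(3)[of "{e}"] rank_outside_nonloops by simp
    moreover have "e \<notin> I i" if "i < k" for i using indep_subset_ground[OF M I(1)[OF that]] False by blast
    ultimately show ?thesis using x(2)[of e] by (simp add: sum_component indicator_vec_nth)
  qed
  then have "x = (\<Sum>i<k. indicator_vec (I i))" by (simp add: vec_eq_iff)
  then show ?thesis using I(1) by blast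
qed

text \<open>
  A point satisfying the inequalities is the limit of the rational points obtained by rounding its
  coordinates down, which satisfy them too; by integer decomposition a rational point with
  denominator \<open>k\<close> is the mean of \<open>k\<close> indicator vectors of independent sets.
\<close>

lemma independence_polytope_inequalities:
  "independence_polytope M =
     {x. (\<forall>i. 0 \<le> x $ i) \<and> (\<forall>A. (\<Sum>i\<in>A. x $ i) \<le> real (rank_of M A))}" (is "_ = ?R")
proof
  have "convex ?R"
  proof (rule convexI)
    fix x y :: "real ^ 'n" and u v :: real
    assume x: "x \<in> ?R" and y: "y \<in> ?R" and uv: "0 \<le> u" "0 \<le> v" "u + v = 1"
    have "(\<Sum>i\<in>A. (u *\<^sub>R x + v *\<^sub>R y) $ i) \<le> real (rank_of M A)" for A
    proof -
      have "(\<Sum>i\<in>A. (u *\<^sub>R x + v *\<^sub>R y) $ i) = u * (\<Sum>i\<in>A. x $ i) + v * (\<Sum>i\<in>A. y $ i)"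
        by (simp add: sum.distrib sum_distrib_left)
      also have "\<dots> \<le> u * real (rank_of M A) + v * real (rank_of M A)"
        using x y uv by (intro add_mono mult_left_mono) auto
      also have "\<dots> = real (rank_of M A)" using uv(3) by (simp flip: distrib_right)
      finally show ?thesis .
    qed
    then show "u *\<^sub>R x + v *\<^sub>R y \<in> ?R" using x y uv by simp
  qed
  moreover have "indicator_vec I \<in> ?R" if I: "I \<in> indep M" for I
  proof -
    have "card (A \<inter> I) \<le> rank_of M A" for A
      by (rule card_le_rank[OF M indep_subset[OF M I]]) auto
    then show ?thesis by (simp add: sum_indicator_vec) (simp add: indicator_vec_nth)
  qed
  ultimately show "independence_polytope M \<subseteq> ?R"
    unfolding independence_polytope_eq by (intro hull_minimal) auto
next
  show "?R \<subseteq> independence_polytope M"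
  proof
    fix x assume x: "x \<in> ?R"
    define y where "y = (\<lambda>k. (\<chi> i. of_int \<lfloor>real (Suc k) * x $ i\<rfloor> / real (Suc k)) :: real ^ 'n)"
    have y_in: "y k \<in> independence_polytope M" for k
    proof -
      let ?z = "real (Suc k) *\<^sub>R y k"
      have z: "?z $ i = of_int \<lfloor>real (Suc k) * x $ i\<rfloor>" for i by (simp add: y_def)
      have "?z \<in> lattice_points" unfolding lattice_points_def mem_Collect_eq z by simp
      moreover have "0 \<le> ?z $ i" for i
      proof -
        have "0 \<le> real (Suc k) * x $ i" using x by simp
        then show ?thesis unfolding z by simp
      qed
      moreover have "(\<Sum>i\<in>A. ?z $ i) \<le> real (Suc k) * real (rank_of M A)" for A
      proof -
        have "(\<Sum>i\<in>A. ?z $ i) \<le> (\<Sum>i\<in>A. real (Suc k) * x $ i)"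
          unfolding z by (intro sum_mono of_int_floor_le)
        also have "\<dots> = real (Suc k) * (\<Sum>i\<in>A. x $ i)" by (simp only: sum_distrib_left)
        also have "\<dots> \<le> real (Suc k) * real (rank_of M A)" using x by (intro mult_left_mono) auto
        finally show ?thesis .
      qed
      ultimately obtain I where I: "\<forall>i<Suc k. I i \<in> indep M" "?z = (\<Sum>i<Suc k. indicator_vec (I i))"
        using lattice_point_decomposition[of ?z "Suc k"] by blast
      have "y k = (1 / real (Suc k)) *\<^sub>R ?z" by simp
      also have "\<dots> = (\<Sum>i\<in>{..<Suc k}. (1 / real (Suc k)) *\<^sub>R indicator_vec (I i))"
        unfolding I(2) by (rule scaleR_sum_right)
      also have "\<dots> \<in> independence_polytope M"
        using I(1) by (intro convex_sum convex_independence_polytope indicator_vec_in_polytope) auto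
      finally show ?thesis .
    qed
    have "y \<longlonglongrightarrow> x"
    proof (rule vec_tendstoI)
      fix i
      have bound: "\<bar>y k $ i - x $ i\<bar> \<le> inverse (real (Suc k))" for k
      proof -
        have "\<bar>of_int \<lfloor>real (Suc k) * x $ i\<rfloor> - real (Suc k) * x $ i\<bar> \<le> 1" by linarith
        then have "\<bar>of_int \<lfloor>real (Suc k) * x $ i\<rfloor> - real (Suc k) * x $ i\<bar> / real (Suc k) \<le> 1 / real (Suc k)"
          by (intro divide_right_mono) auto
        moreover have "y k $ i - x $ i = (of_int \<lfloor>real (Suc k) * x $ i\<rfloor> - real (Suc k) * x $ i) / real (Suc k)"
          by (simp add: y_def diff_divide_distrib)
        ultimately show ?thesis by (simp add: abs_divide inverse_eq_divide)
      qed
      have "(\<lambda>k. y k $ i - x $ i) \<longlonglongrightarrow> 0"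
        by (rule Lim_null_comparison[OF _ LIMSEQ_inverse_real_of_nat]) (use bound in auto)
      then show "(\<lambda>k. y k $ i) \<longlonglongrightarrow> x $ i" by (simp add: LIM_zero_iff)
    qed
    moreover have "closed (independence_polytope M)"
      unfolding independence_polytope_eq
      by (intro compact_imp_closed finite_imp_compact_convex_hull finite_imageI finite_indeps[OF M])
    ultimately show "x \<in> independence_polytope M"
      using y_in closed_sequentially by blast
  qed
qed

lemma polytope_nonneg: "x \<in> independence_polytope M \<Longrightarrow> 0 \<le> x $ i"
  and polytope_sum_le: "x \<in> independence_polytope M \<Longrightarrow> (\<Sum>i\<in>A. x $ i) \<le> real (rank_of M A)"
  by (auto simp: independence_polytope_inequalities)

lemma polytope_loop_zero: "x \<in> independence_polytope M \<Longrightarrow> i \<notin> nonloops M \<Longrightarrow> x $ i = 0"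
  using polytope_nonneg[of x i] polytope_sum_le[of x "{i}"] rank_outside_nonloops[of "{i}"] by simp

lemma lattice_polytope_independence_polytope: "lattice_polytope (independence_polytope M)"
  unfolding lattice_polytope_def independence_polytope_eq
  using finite_indeps[OF M] indicator_vec_lattice
  by (intro exI[of _ "indicator_vec ` indep M"]) auto

lemma integer_decomposition_independence_polytope:
  "integer_decomposition_property (independence_polytope M)"
  unfolding integer_decomposition_property_def
proof (intro allI impI ballI)
  fix k :: nat and x assume "0 < k" and x: "x \<in> dilate k (independence_polytope M) \<inter> lattice_points"
  then obtain p where p: "p \<in> independence_polytope M" "x = real k *\<^sub>R p" by (auto simp: dilate_def)
  have "0 \<le> x $ i" for i using polytope_nonneg[OF p(1)] p(2) by simp
  moreover have "(\<Sum>i\<in>A. x $ i) \<le> real k * real (rank_of M A)" for A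
    using polytope_sum_le[OF p(1), of A] unfolding p(2)
    by (simp add: mult_left_mono flip: sum_distrib_left)
  ultimately obtain I where "\<forall>i<k. I i \<in> indep M" "x = (\<Sum>i<k. indicator_vec (I i))"
    using lattice_point_decomposition[of x k] x by blast
  then show "\<exists>p. (\<forall>i<k. p i \<in> independence_polytope M \<inter> lattice_points) \<and> x = (\<Sum>i<k. p i)"
    using indicator_vec_in_polytope indicator_vec_lattice by (intro exI[of _ "\<lambda>i. indicator_vec (I i)"]) auto
qed

end

section \<open>Faces and forms\<close>

text \<open>
  If every inequality that is tight on the face were tight on the whole polyhedron, a relative
  interior point of the face could be moved a little away from any other point of the polyhedron and
  would be a relative interior point of the polyhedron.
\<close>

lemma proper_face_tight_inequality:
  fixes P Q :: "'a::euclidean_space set" and f :: "'c \<Rightarrow> 'a \<Rightarrow> real"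
  assumes C: "finite C" and P: "P = {x. \<forall>c\<in>C. 0 \<le> f c x}"
    and affine: "\<And>c x y e. f c ((1 - e) *\<^sub>R x + e *\<^sub>R y) = (1 - e) * f c x + e * f c y"
    and convex: "convex P" and face: "Q face_of P" "Q \<noteq> {}" "Q \<noteq> P"
  shows "\<exists>c\<in>C. (\<forall>x\<in>Q. f c x = 0) \<and> (\<exists>x\<in>P. f c x \<noteq> 0)"
proof (rule ccontr)
  assume "\<not> ?thesis"
  then have contra: "f c x = 0" if "c \<in> C" "\<forall>x\<in>Q. f c x = 0" "x \<in> P" for c x using that by blast
  have QP: "Q \<subseteq> P" and convQ: "convex Q" using face face_of_imp_subset face_of_imp_convex by blast+
  obtain y where y: "y \<in> rel_interior Q" using rel_interior_eq_empty[OF convQ] face(2) by blast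
  then have yQ: "y \<in> Q" using rel_interior_subset by blast
  have zero: "f c x = 0" if c: "c \<in> C" "f c y = 0" and x: "x \<in> P" for c x
  proof (rule contra[OF c(1) _ x], rule ballI)
    fix q assume q: "q \<in> Q"
    then obtain e where e: "1 < e" "(1 - e) *\<^sub>R q + e *\<^sub>R y \<in> Q"
      using y convex_rel_interior_iff[OF convQ face(2)] by blast
    then have "0 \<le> f c ((1 - e) *\<^sub>R q + e *\<^sub>R y)" using QP P c by blast
    then have "0 \<le> (1 - e) * f c q" using affine c by simp
    then have "f c q \<le> 0" using e by (simp add: zero_le_mult_iff)
    moreover have "0 \<le> f c q" using q QP P c by blast
    ultimately show "f c q = 0" by simp
  qed
  have "\<exists>e>1. (1 - e) *\<^sub>R p + e *\<^sub>R y \<in> P" if p: "p \<in> P" for p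
  proof -
    \<comment> \<open>An inequality strict at \<open>y\<close> stays valid for all \<open>e > 1\<close> close to \<open>1\<close>; there are finitely many.\<close>
    have "\<forall>\<^sub>F e in at_right 1. 0 \<le> f c ((1 - e) *\<^sub>R p + e *\<^sub>R y)" if c: "c \<in> C" for c
    proof (cases "f c y = 0")
      case True
      then have "f c p = 0" using zero c p by blast
      then show ?thesis using True affine by simp
    next
      case False
      then have "0 < f c y" using yQ QP P c by force
      have "((\<lambda>e. (1 - e) * f c p + e * f c y) \<longlongrightarrow> (1 - 1) * f c p + 1 * f c y) (at_right 1)"
        by (intro tendsto_intros)
      then have "\<forall>\<^sub>F e in at_right 1. 0 < (1 - e) * f c p + e * f c y"
        using \<open>0 < f c y\<close> by (intro order_tendstoD(1)) auto
      then show ?thesis unfolding affine by (rule eventually_mono) simp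
    qed
    then have "\<forall>\<^sub>F e in at_right 1. \<forall>c\<in>C. 0 \<le> f c ((1 - e) *\<^sub>R p + e *\<^sub>R y)"
      using C by (intro eventually_ball_finite) auto
    moreover have "\<forall>\<^sub>F e in at_right (1::real). 1 < e" by (rule eventually_at_right_less)
    ultimately have "\<forall>\<^sub>F e in at_right 1. 1 < e \<and> (\<forall>c\<in>C. 0 \<le> f c ((1 - e) *\<^sub>R p + e *\<^sub>R y))"
      by (rule eventually_conj[rotated])
    then obtain e where "1 < e" "\<forall>c\<in>C. 0 \<le> f c ((1 - e) *\<^sub>R p + e *\<^sub>R y)"
      using eventually_happens'[OF trivial_limit_at_right_real] by blast
    then show ?thesis using P by blast
  qed
  moreover have "P \<noteq> {}" using yQ QP by blast
  ultimately have "y \<in> rel_interior P" using convex_rel_interior_iff[OF convex] by blast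
  then show False using face_of_disjoint_rel_interior[OF face(1,3)] yQ by blast
qed

text \<open>
  Two nonnegative forms that are both onto \<open>\<int>\<close> on the lattice and proportional on the cone agree:
  the factor is an integer whose inverse is an integer, and it is positive.
\<close>

lemma proportional_forms_eq:
  fixes h g :: "(real ^ 'n) \<times> real \<Rightarrow> real"
  assumes h: "linear h" "h ` cone_lattice P = \<int>" "\<And>z. z \<in> P \<times> {1} \<Longrightarrow> 0 \<le> h z"
    and g: "linear g" "\<And>z. z \<in> cone_lattice P \<Longrightarrow> g z \<in> \<int>" "z0 \<in> cone_lattice P" "g z0 = 1"
    and proportional: "\<And>z. z \<in> P \<times> {1} \<Longrightarrow> h z = \<beta> * g z" and p: "p \<in> P \<times> {1}" "0 < g p"
    and z: "z \<in> cone_lattice P"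
  shows "h z = g z"
proof -
  have "linear (\<lambda>z. \<beta> * g z)" using linear_compose_scale_right[OF g(1), of \<beta>] by simp
  then have eq: "h w = \<beta> * g w" if "w \<in> cone_lattice P" for w
    using linear_eq_on[OF h(1), of "\<lambda>z. \<beta> * g z" w "P \<times> {1}"] proportional that by (simp add: cone_lattice_def)
  have "\<beta> = h z0" using eq[OF g(3)] g(4) by simp
  then have "\<beta> \<in> \<int>" using h(2) g(3) by blast
  moreover have "1 \<in> h ` cone_lattice P" using h(2) by simp
  then obtain w where w: "w \<in> cone_lattice P" "h w = 1" by force
  then have "\<beta> * g w = 1" "g w \<in> \<int>" using eq g(2) by auto
  ultimately obtain a b :: int where ab: "\<beta> = of_int a" "g w = of_int b" "\<beta> * g w = 1" by (auto elim!: Ints_cases)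
  then have "a * b = 1" by (simp flip: of_int_mult)
  then have "a = 1 \<or> a = -1" using zmult_eq_1_iff by blast
  moreover have "0 \<le> \<beta> * g p" using h(3)[OF p(1)] proportional[OF p(1)] by simp
  then have "0 \<le> \<beta>" using p(2) by (simp add: zero_le_mult_iff)
  ultimately have "\<beta> = 1" using ab by auto
  then show ?thesis using eq[OF z] by simp
qed

lemma cone_latticeI:
  "z \<in> span (P \<times> {1}) \<Longrightarrow> fst z \<in> lattice_points \<Longrightarrow> snd z \<in> \<int> \<Longrightarrow> z \<in> cone_lattice P"
  by (cases z) (simp add: cone_lattice_def)

lemma dilate_in_cone_lattice:
  assumes "v \<in> dilate \<delta> P \<inter> lattice_points"
  shows "(v, real \<delta>) \<in> cone_lattice P"
proof -
  obtain p where p: "p \<in> P" "v = real \<delta> *\<^sub>R p" using assms by (auto simp: dilate_def)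
  have "real \<delta> *\<^sub>R (p, 1::real) \<in> span (P \<times> {1})" using p by (intro span_scale span_base) auto
  then have "(v, real \<delta>) \<in> span (P \<times> {1})" using p by simp
  then show ?thesis using assms by (intro cone_latticeI) auto
qed

lemma facet_formI:
  assumes "linear h" "\<And>z. z \<in> cone_lattice P \<Longrightarrow> h z \<in> \<int>" "z0 \<in> cone_lattice P" "h z0 = 1"
    and "\<And>x. x \<in> P \<Longrightarrow> 0 \<le> h (x, 1)" "\<And>x. x \<in> Q \<Longrightarrow> h (x, 1) = 0"
  shows "facet_form P Q h"
proof -
  have "\<int> \<subseteq> h ` cone_lattice P"
  proof
    fix r :: real assume "r \<in> \<int>"
    then obtain m where m: "r = of_int m" by (auto elim: Ints_cases)
    have z0: "z0 \<in> span (P \<times> {1})" "fst z0 \<in> lattice_points" "snd z0 \<in> \<int>"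
      using assms(3) by (auto simp: cone_lattice_def)
    have "r *\<^sub>R z0 \<in> cone_lattice P"
    proof (rule cone_latticeI)
      show "r *\<^sub>R z0 \<in> span (P \<times> {1})" using z0 by (intro span_scale)
      show "fst (r *\<^sub>R z0) \<in> lattice_points" using z0(2) m by (auto simp: lattice_points_def)
      show "snd (r *\<^sub>R z0) \<in> \<int>" using z0(3) m by simp
    qed
    moreover have "h (r *\<^sub>R z0) = r" using linear_scale[OF assms(1)] assms(4) by simp
    ultimately show "r \<in> h ` cone_lattice P" by (metis imageI)
  qed
  then show ?thesis using assms unfolding facet_form_def by auto
qed

definition coordinate_form :: "'n::finite \<Rightarrow> (real ^ 'n) \<times> real \<Rightarrow> real" where
  "coordinate_form e z = fst z $ e"

definition rank_form :: "'n::finite set_system \<Rightarrow> 'n set \<Rightarrow> (real ^ 'n) \<times> real \<Rightarrow> real" where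
  "rank_form M F z = real (rank_of M F) * snd z - (\<Sum>i\<in>F. fst z $ i)"

lemma linear_coordinate_form: "linear (coordinate_form e)"
  by (rule linearI) (simp_all add: coordinate_form_def)

lemma linear_rank_form: "linear (rank_form M F)"
  by (rule linearI)
    (simp_all add: rank_form_def sum.distrib sum_distrib_left algebra_simps)

lemma coordinate_form_Ints: "z \<in> cone_lattice P \<Longrightarrow> coordinate_form e z \<in> \<int>"
  by (auto simp: coordinate_form_def cone_lattice_def lattice_points_def)

lemma rank_form_Ints: "z \<in> cone_lattice P \<Longrightarrow> rank_form M F z \<in> \<int>"
  by (auto simp: rank_form_def cone_lattice_def lattice_points_def intro!: Ints_diff Ints_mult Ints_sum)

section \<open>Gorenstein independence polytopes\<close>

lemma linear_form_expansion:
  fixes h :: "(real ^ 'n::finite) \<times> real \<Rightarrow> real"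
  assumes "linear h"
  shows "h (x, t) = t * h (0, 1) + (\<Sum>i\<in>UNIV. x $ i * h (axis i 1, 0))"
proof -
  have lin: "linear (\<lambda>x. h (x, 0))"
  proof (rule linearI)
    show "h (x + y, 0) = h (x, 0) + h (y, 0)" for x y using linear_add[OF assms, of "(x, 0)" "(y, 0)"] by simp
    show "h (r *\<^sub>R x, 0) = r *\<^sub>R h (x, 0)" for r x using linear_scale[OF assms, of r "(x, 0)"] by simp
  qed
  have "x = (\<Sum>i\<in>UNIV. x $ i *\<^sub>R axis i 1)"
    using basis_expansion[of x] by (simp add: scalar_mult_eq_scaleR)
  then have "h (x, 0) = h (\<Sum>i\<in>UNIV. x $ i *\<^sub>R axis i 1, 0)" by simp
  also have "\<dots> = (\<Sum>i\<in>UNIV. h (x $ i *\<^sub>R axis i 1, 0))"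
    by (rule linear_sum[OF lin])
  also have "\<dots> = (\<Sum>i\<in>UNIV. x $ i * h (axis i 1, 0))"
    by (intro sum.cong refl) (use linear_scale[OF lin] in simp)
  finally have "h (x, 0) = (\<Sum>i\<in>UNIV. x $ i * h (axis i 1, 0))" .
  moreover have "h (0, t) = t * h (0, 1)" using linear_scale[OF assms, of t "(0, 1)"] by simp
  moreover have "h (x, t) = h (x, 0) + h (0, t)" using linear_add[OF assms, of "(x, 0)" "(0, t)"] by simp
  ultimately show ?thesis by simp
qed

lemma linear_form_indicator_vec:
  fixes h :: "(real ^ 'n::finite) \<times> real \<Rightarrow> real"
  assumes "linear h"
  shows "h (indicator_vec I, 1) = h (0, 1) + (\<Sum>i\<in>I. h (axis i 1, 0))"
proof -
  have "(\<Sum>i\<in>UNIV. indicator_vec I $ i * h (axis i 1, 0)) = (\<Sum>i\<in>UNIV. if i \<in> I then h (axis i 1, 0) else 0)"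
    by (intro sum.cong) (auto simp: indicator_vec_nth)
  also have "\<dots> = (\<Sum>i\<in>I. h (axis i 1, 0))" by (simp add: sum.If_cases)
  finally show ?thesis using linear_form_expansion[OF assms, of "indicator_vec I" 1] by simp
qed

context
  fixes M :: "'n::finite set_system"
  assumes M: "matroid M"
begin

text \<open>
  The face contains the origin and the unit vectors of all other nonloops, which makes the constant
  term and all but one of the coefficients vanish.
\<close>

lemma forms_vanishing_on_coordinate_face:
  fixes h :: "(real ^ 'n) \<times> real \<Rightarrow> real"
  assumes h: "linear h" and e: "e \<in> nonloops M"
    and zero: "\<And>x. x \<in> independence_polytope M \<Longrightarrow> coordinate_form e (x, 1) = 0 \<Longrightarrow> h (x, 1) = 0"
  shows "\<exists>\<beta>. \<forall>x\<in>independence_polytope M. h (x, 1) = \<beta> * coordinate_form e (x, 1)"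
proof -
  have h0: "h (0, 1) = 0"
    using zero[OF indicator_vec_in_polytope[OF M empty_indep[OF M]]]
    by (simp add: coordinate_form_def indicator_vec_empty)
  have ha: "h (axis i 1, 0) = 0" if i: "i \<in> nonloops M" "i \<noteq> e" for i
  proof -
    have "{i} \<in> indep M" using i by (simp add: nonloops_def)
    then have "h (indicator_vec {i}, 1) = 0"
      using i by (intro zero indicator_vec_in_polytope[OF M]) (auto simp: coordinate_form_def indicator_vec_nth)
    then show ?thesis using linear_form_indicator_vec[OF h, of "{i}"] h0 by simp
  qed
  have "h (x, 1) = h (axis e 1, 0) * coordinate_form e (x, 1)" if x: "x \<in> independence_polytope M" for x
  proof -
    have "(\<Sum>i\<in>UNIV. x $ i * h (axis i 1, 0)) = (\<Sum>i\<in>{e}. x $ i * h (axis i 1, 0))"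
    proof (rule sum.mono_neutral_right)
      show "\<forall>i\<in>UNIV - {e}. x $ i * h (axis i 1, 0) = 0"
        using ha polytope_loop_zero[OF M x] by fastforce
    qed auto
    then show ?thesis using linear_form_expansion[OF h, of x 1] h0 by (simp add: coordinate_form_def)
  qed
  then show ?thesis by blast
qed

text \<open>
  Comparing bases \<open>B\<close> of \<open>F\<close> with \<open>B + i\<close> for \<open>i\<close> outside the flat \<open>F\<close> shows that the coefficients of
  the form vanish outside \<open>F\<close>; comparing bases that differ by an exchange shows that the coefficients
  on \<open>F\<close> cannot take two values, since then an exchange between elements with different
  coefficients would exist by connectedness.
\<close>

lemma forms_vanishing_on_rank_face:
  fixes h :: "(real ^ 'n) \<times> real \<Rightarrow> real"
  assumes h: "linear h" and F: "connected_flat M F"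
    and zero: "\<And>x. x \<in> independence_polytope M \<Longrightarrow> rank_form M F (x, 1) = 0 \<Longrightarrow> h (x, 1) = 0"
  shows "\<exists>\<beta>. \<forall>x\<in>independence_polytope M. h (x, 1) = \<beta> * rank_form M F (x, 1)"
proof -
  define a where "a = (\<lambda>i. h (axis i 1, 0))"
  have flat: "flat M F" and insep: "inseparable M F" using F by (simp_all add: connected_flat_def)
  have base: "h (0, 1) + sum a I = 0" if I: "I \<in> indep M" "card (F \<inter> I) = rank_of M F" for I
  proof -
    have "h (indicator_vec I, 1) = 0"
      using I by (intro zero indicator_vec_in_polytope[OF M]) (simp_all add: rank_form_def sum_indicator_vec)
    then show ?thesis using linear_form_indicator_vec[OF h, of I] by (simp add: a_def)
  qed
  obtain B where B: "B \<in> indep M" "B \<subseteq> F" "card B = rank_of M F" using rank_witness[OF M] by blast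
  have baseB: "h (0, 1) + sum a B = 0" using B by (intro base) (simp_all add: Int_absorb1)
  have outside: "a i = 0" if i: "i \<in> nonloops M - F" for i
  proof -
    have "rank_of M F < rank_of M (insert i F)" using flat i by (simp add: flat_def)
    moreover obtain D where D: "D \<in> indep M" "B \<subseteq> D" "D \<subseteq> insert i F" "card D = rank_of M (insert i F)"
      using extend_to_rank[OF M B(1), of "insert i F"] B(2) by blast
    moreover have "card (D \<inter> F) \<le> rank_of M F"
      by (rule card_le_rank[OF M indep_subset[OF M D(1)]]) auto
    ultimately have "\<not> D \<subseteq> F" by (metis Int_absorb2 leD)
    then have "i \<in> D" using D by blast
    then have "insert i B \<in> indep M" using D by (intro indep_subset[OF M D(1)]) auto
    moreover have "F \<inter> insert i B = B" using i B(2) by blast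
    ultimately have "h (0, 1) + sum a (insert i B) = 0" using B by (intro base) simp_all
    moreover have "sum a (insert i B) = a i + sum a B" using i B(2) by (intro sum.insert) auto
    ultimately show ?thesis using baseB by simp
  qed
  obtain f where f: "f \<in> F" using inseparable_nonempty[OF M insep] by blast
  have const: "a i = a f" if i: "i \<in> F" for i
  proof (rule ccontr)
    assume neq: "a i \<noteq> a f"
    let ?A = "{j \<in> F. a j = a f}" and ?C = "{j \<in> F. a j \<noteq> a f}"
    have "?A \<union> ?C = F" "?A \<inter> ?C = {}" "?A \<noteq> {}" "?C \<noteq> {}" using f i neq by auto
    then obtain B' k j where B': "B' \<in> indep M" "B' \<subseteq> F" "card B' = rank_of M F" "k \<in> ?A \<inter> B'" "j \<in> ?C - B'"
      "insert j (B' - {k}) \<in> indep M"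
      using exchange_across_nonseparator[OF M insep, of ?A ?C] by blast
    have sum': "h (0, 1) + sum a B' = 0" using B' by (intro base) (simp_all add: Int_absorb1)
    have "card (insert j (B' - {k})) = card B'"
    proof -
      have "card (insert j (B' - {k})) = Suc (card (B' - {k}))" using B'(5) by simp
      also have "\<dots> = card B'" using B'(4) by (intro card_Suc_Diff1) auto
      finally show ?thesis .
    qed
    moreover have "F \<inter> insert j (B' - {k}) = insert j (B' - {k})" using B' by auto
    ultimately have "h (0, 1) + sum a (insert j (B' - {k})) = 0"
      using B' by (intro base[OF B'(6)]) simp
    moreover have "sum a (insert j (B' - {k})) = a j + sum a (B' - {k})" using B'(5) by simp
    moreover have "sum a B' = a k + sum a (B' - {k})" using B'(4) by (intro sum.remove) auto
    ultimately have "a j = a k" using sum' by simp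
    then show False using B' by simp
  qed
  have h0: "h (0, 1) = - (a f * real (rank_of M F))"
  proof -
    have "sum a B = (\<Sum>i\<in>B. a f)" using const B(2) by (intro sum.cong) auto
    then have "sum a B = a f * real (rank_of M F)" using B(3) by simp
    then show ?thesis using baseB by linarith
  qed
  have "h (x, 1) = - a f * rank_form M F (x, 1)" if x: "x \<in> independence_polytope M" for x
  proof -
    have "(\<Sum>i\<in>UNIV. x $ i * a i) = (\<Sum>i\<in>F. x $ i * a i)"
    proof (rule sum.mono_neutral_right)
      show "\<forall>i\<in>UNIV - F. x $ i * a i = 0"
        using outside polytope_loop_zero[OF M x] by fastforce
    qed auto
    also have "\<dots> = (\<Sum>i\<in>F. x $ i * a f)" by (intro sum.cong) (auto dest: const)
    also have "\<dots> = a f * (\<Sum>i\<in>F. x $ i)" by (simp add: sum_distrib_left mult.commute)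
    finally have "(\<Sum>i\<in>UNIV. x $ i * a i) = a f * (\<Sum>i\<in>F. x $ i)" .
    moreover have "h (x, 1) = h (0, 1) + (\<Sum>i\<in>UNIV. x $ i * a i)"
      using linear_form_expansion[OF h, of x 1] by (simp add: a_def)
    ultimately show ?thesis unfolding h0 by (simp add: rank_form_def algebra_simps)
  qed
  then show ?thesis by blast
qed

text \<open>
  The face cut out by \<open>g\<close> lies in some facet. The form of that facet vanishes on the face, hence is
  proportional and therefore equal to \<open>g\<close>.
\<close>

lemma Gorenstein_point_form_value:
  fixes g :: "(real ^ 'n) \<times> real \<Rightarrow> real"
  assumes v: "v \<in> dilate \<delta> (independence_polytope M) \<inter> lattice_points"
    and facets: "\<And>Q. Q facet_of independence_polytope M \<Longrightarrow>
      \<exists>h. facet_form (independence_polytope M) Q h \<and> h (v, real \<delta>) = 1"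
    and g: "linear g" "\<And>z. z \<in> cone_lattice (independence_polytope M) \<Longrightarrow> g z \<in> \<int>"
      "z0 \<in> cone_lattice (independence_polytope M)" "g z0 = 1"
    and face: "{x \<in> independence_polytope M. g (x, 1) = 0} face_of independence_polytope M"
      "q \<in> independence_polytope M" "g (q, 1) = 0" "p \<in> independence_polytope M" "0 < g (p, 1)"
    and vanishing: "\<And>h :: (real ^ 'n) \<times> real \<Rightarrow> real. linear h \<Longrightarrow>
      (\<And>x. x \<in> independence_polytope M \<Longrightarrow> g (x, 1) = 0 \<Longrightarrow> h (x, 1) = 0) \<Longrightarrow>
      \<exists>\<beta>. \<forall>x\<in>independence_polytope M. h (x, 1) = \<beta> * g (x, 1)"
  shows "g (v, real \<delta>) = 1"
proof -
  let ?P = "independence_polytope M"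
  have "polyhedron ?P"
    unfolding independence_polytope_eq[OF M]
    by (intro polytope_imp_polyhedron polytope_convex_hull finite_imageI finite_indeps[OF M])
  moreover have "{x \<in> ?P. g (x, 1) = 0} \<noteq> {}" using face by blast
  moreover have "{x \<in> ?P. g (x, 1) = 0} \<noteq> ?P" using face(4,5) by force
  ultimately obtain Q where Q: "Q facet_of ?P" "{x \<in> ?P. g (x, 1) = 0} \<subseteq> Q"
    using face_of_polyhedron_subset_facet[OF _ face(1)] by metis
  obtain h where h: "facet_form ?P Q h" "h (v, real \<delta>) = 1" using facets[OF Q(1)] by blast
  have hl: "linear h" "h ` cone_lattice ?P = \<int>" "\<And>z. z \<in> ?P \<times> {1} \<Longrightarrow> 0 \<le> h z"
    and hQ: "\<And>z. z \<in> Q \<times> {1} \<Longrightarrow> h z = 0"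
    using h(1) unfolding facet_form_def by auto
  obtain \<beta> where \<beta>: "\<forall>x\<in>?P. h (x, 1) = \<beta> * g (x, 1)"
    using vanishing[OF hl(1)] hQ Q(2) by blast
  have "h (v, real \<delta>) = g (v, real \<delta>)"
  proof (rule proportional_forms_eq[OF hl g])
    show "h z = \<beta> * g z" if "z \<in> ?P \<times> {1}" for z using that \<beta> by auto
    show "(p, 1) \<in> ?P \<times> {1}" using face(4) by simp
    show "0 < g (p, 1)" by (rule face(5))
    show "(v, real \<delta>) \<in> cone_lattice ?P" by (rule dilate_in_cone_lattice[OF v])
  qed
  then show ?thesis using h(2) by simp
qed

lemma axis_in_polytope: "e \<in> nonloops M \<Longrightarrow> axis e 1 \<in> independence_polytope M"
  using indicator_vec_in_polytope[OF M, of "{e}"] by (simp add: nonloops_def indicator_vec_singleton)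

lemma zero_in_polytope: "0 \<in> independence_polytope M"
  using indicator_vec_in_polytope[OF M empty_indep[OF M]] by (simp add: indicator_vec_empty)

lemma axis_in_cone_lattice:
  assumes "e \<in> nonloops M"
  shows "(axis e 1, 0) \<in> cone_lattice (independence_polytope M)"
proof (rule cone_latticeI)
  have "(axis e 1, 1) - (0, 1) \<in> span (independence_polytope M \<times> {1::real})"
    using axis_in_polytope[OF assms] zero_in_polytope by (intro span_diff span_base) auto
  then show "(axis e 1, 0) \<in> span (independence_polytope M \<times> {1::real})" by simp
  show "fst (axis e 1 :: real ^ 'n, 0 :: real) \<in> lattice_points"
    using indicator_vec_lattice[of "{e}"] by (simp add: indicator_vec_singleton)
qed simp

text \<open>
  The coordinate forms make all nonloop coordinates of \<open>v\<close> equal to \<open>1\<close>. The form of a connected flat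
  then takes the value \<open>\<delta> * rank F - card F\<close> at \<open>(v, \<delta>)\<close>.
\<close>

lemma delta_Gorenstein_imp_balanced:
  assumes "delta_Gorenstein \<delta> (independence_polytope M)"
  shows "balanced \<delta> 1 M"
proof -
  let ?P = "independence_polytope M"
  obtain v where v: "v \<in> dilate \<delta> ?P \<inter> lattice_points"
    and facets: "\<And>Q. Q facet_of ?P \<Longrightarrow> \<exists>h. facet_form ?P Q h \<and> h (v, real \<delta>) = 1"
    using assms unfolding delta_Gorenstein_def by blast
  have conv: "convex ?P" by (rule convex_independence_polytope[OF M])
  have v1: "v $ e = 1" if e: "e \<in> nonloops M" for e
  proof -
    have "coordinate_form e (v, real \<delta>) = 1"
    proof (rule Gorenstein_point_form_value[OF v facets linear_coordinate_form])
      show "coordinate_form e z \<in> \<int>" if "z \<in> cone_lattice ?P" for z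
        using that by (rule coordinate_form_Ints)
      show "(axis e 1, 0) \<in> cone_lattice ?P" by (rule axis_in_cone_lattice[OF e])
      show "coordinate_form e (axis e 1, 0) = 1" by (simp add: coordinate_form_def)
      have "?P \<inter> {x. axis e 1 \<bullet> x = 0} face_of ?P"
        using polytope_nonneg[OF M] by (intro face_of_Int_supporting_hyperplane_ge[OF conv]) (simp add: inner_axis')
      moreover have "?P \<inter> {x. axis e 1 \<bullet> x = 0} = {x \<in> ?P. coordinate_form e (x, 1) = 0}"
        by (auto simp: coordinate_form_def inner_axis')
      ultimately show "{x \<in> ?P. coordinate_form e (x, 1) = 0} face_of ?P" by simp
      show "0 \<in> ?P" "coordinate_form e (0, 1) = 0" using zero_in_polytope by (simp_all add: coordinate_form_def)
      show "axis e 1 \<in> ?P" "0 < coordinate_form e (axis e 1, 1)"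
        using axis_in_polytope[OF e] by (simp_all add: coordinate_form_def)
    qed (use forms_vanishing_on_coordinate_face[OF _ e] in blast)+
    then show ?thesis by (simp add: coordinate_form_def)
  qed
  show ?thesis
    unfolding balanced_def
  proof (intro allI impI)
    fix F assume F: "connected_flat M F"
    then have flat: "flat M F" and "F \<noteq> {}" by (auto simp: connected_flat_def inseparable_def)
    then obtain f where f: "f \<in> F" by blast
    have nl: "F \<subseteq> nonloops M" using flat by (simp add: flat_def)
    obtain B where B: "B \<in> indep M" "B \<subseteq> F" "card B = rank_of M F" using rank_witness[OF M] by blast
    have "rank_form M F (v, real \<delta>) = 1"
    proof (rule Gorenstein_point_form_value[OF v facets linear_rank_form])
      show "rank_form M F z \<in> \<int>" if "z \<in> cone_lattice ?P" for z
        using that by (rule rank_form_Ints)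
      have lat: "(axis f 1, 0) \<in> cone_lattice ?P" using f nl by (intro axis_in_cone_lattice) auto
      show "(- axis f 1, 0) \<in> cone_lattice ?P"
      proof (rule cone_latticeI)
        have "- (axis f 1, 0) \<in> span (?P \<times> {1::real})" using lat unfolding cone_lattice_def by (intro span_neg) simp
        then show "(- axis f 1, 0) \<in> span (?P \<times> {1::real})" by simp
        show "fst (- axis f 1 :: real ^ 'n, 0 :: real) \<in> lattice_points"
          using lat by (auto simp: cone_lattice_def lattice_points_def)
      qed simp
      show "rank_form M F (- axis f 1, 0) = 1"
        using f sum_indicator_vec[of "{f}" F] by (simp add: rank_form_def sum_negf indicator_vec_singleton)
      have "?P \<inter> {x. indicator_vec F \<bullet> x = real (rank_of M F)} face_of ?P"
        using polytope_sum_le[OF M] by (intro face_of_Int_supporting_hyperplane_le[OF conv]) (simp add: inner_indicator_vec)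
      moreover have "?P \<inter> {x. indicator_vec F \<bullet> x = real (rank_of M F)} = {x \<in> ?P. rank_form M F (x, 1) = 0}"
        by (auto simp: rank_form_def inner_indicator_vec)
      ultimately show "{x \<in> ?P. rank_form M F (x, 1) = 0} face_of ?P" by simp
      show "indicator_vec B \<in> ?P" by (rule indicator_vec_in_polytope[OF M B(1)])
      show "rank_form M F (indicator_vec B, 1) = 0"
        using B by (simp add: rank_form_def sum_indicator_vec Int_absorb1)
      show "0 \<in> ?P" by (rule zero_in_polytope)
      show "0 < rank_form M F (0, 1)"
        using flat_rank_pos[OF M flat \<open>F \<noteq> {}\<close>] by (simp add: rank_form_def)
    qed (use forms_vanishing_on_rank_face[OF _ F] in blast)+
    moreover have "(\<Sum>i\<in>F. v $ i) = real (card F)"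
      using v1 nl by (simp add: subset_iff)
    ultimately have "real (1 * card F + 1) = real (\<delta> * rank_of M F)"
      by (simp add: rank_form_def mult.commute)
    then show "1 * card F + 1 = \<delta> * rank_of M F" by (simp only: of_nat_eq_iff)
  qed
qed

text \<open>
  Both parts of a separation of a tight flat are tight flats, so a smallest tight flat is connected.
\<close>

lemma tight_flat_imp_tight_connected_flat:
  assumes Q: "Q \<subseteq> independence_polytope M" and "flat M F" "F \<noteq> {}"
    and "\<And>x. x \<in> Q \<Longrightarrow> (\<Sum>i\<in>F. x $ i) = real (rank_of M F)"
  shows "\<exists>F'. connected_flat M F' \<and> (\<forall>x\<in>Q. (\<Sum>i\<in>F'. x $ i) = real (rank_of M F'))"
  using assms(2-4)
proof (induction "card F" arbitrary: F rule: less_induct)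
  case less
  show ?case
  proof (cases "inseparable M F")
    case True
    then show ?thesis using less.prems by (auto simp: connected_flat_def)
  next
    case False
    obtain Y Z where YZ: "Y \<union> Z = F" "Y \<inter> Z = {}" "Y \<noteq> {}" "Z \<noteq> {}"
      "rank_of M Y + rank_of M Z = rank_of M F"
      using separableE[OF M less.prems(2) False] by metis
    have "card Y < card F" using YZ by (intro psubset_card_mono) auto
    moreover have "flat M Y" using flat_separation_part[OF M less.prems(1) YZ(1,2,5)] .
    moreover have "(\<Sum>i\<in>Y. x $ i) = real (rank_of M Y)" if x: "x \<in> Q" for x
    proof -
      have "(\<Sum>i\<in>F. x $ i) = (\<Sum>i\<in>Y. x $ i) + (\<Sum>i\<in>Z. x $ i)"
        unfolding YZ(1)[symmetric] using YZ(2) by (intro sum.union_disjoint) auto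
      moreover have "(\<Sum>i\<in>Y. x $ i) \<le> real (rank_of M Y)" "(\<Sum>i\<in>Z. x $ i) \<le> real (rank_of M Z)"
        using polytope_sum_le[OF M] x Q by blast+
      moreover have "real (rank_of M Y) + real (rank_of M Z) = real (rank_of M F)"
        using YZ(5) by (simp flip: of_nat_add)
      ultimately show ?thesis using less.prems(3)[OF x] by linarith
    qed
    ultimately show ?thesis using less.hyps[of Y] YZ(3) by blast
  qed
qed

text \<open>
  A facet satisfies one of the defining inequalities with equality. If this is the inequality of a
  set \<open>A\<close>, then the inequality of the flat spanned by \<open>A\<close> is tight as well.
\<close>

lemma facet_tight:
  assumes Q: "Q facet_of independence_polytope M"
  shows "(\<exists>e\<in>nonloops M. \<forall>x\<in>Q. x $ e = 0) \<or>
    (\<exists>F. connected_flat M F \<and> (\<forall>x\<in>Q. (\<Sum>i\<in>F. x $ i) = real (rank_of M F)))"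
proof -
  let ?P = "independence_polytope M"
  define f :: "'n + 'n set \<Rightarrow> real ^ 'n \<Rightarrow> real" where
    "f = (\<lambda>c x. case c of Inl i \<Rightarrow> x $ i | Inr A \<Rightarrow> real (rank_of M A) - (\<Sum>i\<in>A. x $ i))"
  have QP: "Q \<subseteq> ?P" using facet_of_imp_subset[OF Q] .
  have "\<exists>c\<in>UNIV. (\<forall>x\<in>Q. f c x = 0) \<and> (\<exists>x\<in>?P. f c x \<noteq> 0)"
  proof (rule proper_face_tight_inequality)
    show "finite (UNIV :: ('n + 'n set) set)" by simp
    show "?P = {x. \<forall>c\<in>UNIV. 0 \<le> f c x}"
      unfolding independence_polytope_inequalities[OF M] by (auto simp: f_def split: sum.splits)
    show "f c ((1 - e) *\<^sub>R x + e *\<^sub>R y) = (1 - e) * f c x + e * f c y" for c x y e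
      by (auto simp: f_def sum.distrib sum_distrib_left algebra_simps sum_subtractf split: sum.split)
    show "convex ?P" by (rule convex_independence_polytope[OF M])
    show "Q face_of ?P" "Q \<noteq> {}" "Q \<noteq> ?P" using Q by (auto simp: facet_of_def)
  qed
  then obtain c p where c: "\<And>x. x \<in> Q \<Longrightarrow> f c x = 0" "p \<in> ?P" "f c p \<noteq> 0" by blast
  show ?thesis
  proof (cases c)
    case (Inl e)
    then have "e \<in> nonloops M" using c(2,3) polytope_loop_zero[OF M, of p e] by (auto simp: f_def)
    then show ?thesis using c(1) Inl by (auto simp: f_def)
  next
    case (Inr A)
    have tight: "(\<Sum>i\<in>A. x $ i) = real (rank_of M A)" if "x \<in> Q" for x
      using c(1)[OF that] Inr by (simp add: f_def)
    have "rank_of M A \<noteq> 0"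
    proof
      assume r: "rank_of M A = 0"
      then have "(\<Sum>i\<in>A. p $ i) \<le> 0" using polytope_sum_le[OF M c(2), of A] by simp
      moreover have "0 \<le> (\<Sum>i\<in>A. p $ i)" using polytope_nonneg[OF M c(2)] by (intro sum_nonneg) auto
      ultimately show False using c(3) Inr r by (simp add: f_def)
    qed
    then have A: "A \<inter> nonloops M \<noteq> {}" using rank_outside_nonloops[OF M, of A] by auto
    let ?F = "span_of M (A \<inter> nonloops M)"
    have nl: "A \<inter> nonloops M \<subseteq> nonloops M" by blast
    have sub: "A \<inter> nonloops M \<subseteq> ?F" by (rule subset_span_of[OF M nl])
    have r: "rank_of M ?F = rank_of M A"
      using rank_span_of[OF M nl] rank_Int_nonloops[OF M, of A] by simp
    have "(\<Sum>i\<in>?F. x $ i) = real (rank_of M ?F)" if x: "x \<in> Q" for x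
    proof (rule antisym)
      have xP: "x \<in> ?P" using x QP by blast
      show "(\<Sum>i\<in>?F. x $ i) \<le> real (rank_of M ?F)" by (rule polytope_sum_le[OF M xP])
      have "(\<Sum>i\<in>A. x $ i) = (\<Sum>i\<in>A \<inter> nonloops M. x $ i)"
        using polytope_loop_zero[OF M xP] by (intro sum.mono_neutral_right) auto
      also have "\<dots> \<le> (\<Sum>i\<in>?F. x $ i)"
        using sub polytope_nonneg[OF M xP] by (intro sum_mono2) auto
      finally show "real (rank_of M ?F) \<le> (\<Sum>i\<in>?F. x $ i)" using tight[OF x] r by simp
    qed
    moreover have "?F \<noteq> {}" using A sub by blast
    ultimately show ?thesis
      using tight_flat_imp_tight_connected_flat[OF QP flat_span_of[OF M nl]] by blast
  qed
qed

text \<open>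
  The point is the indicator vector of the set of nonloops. It lies in the dilate because it is a sum
  of \<open>\<delta>\<close> independent sets.
\<close>

lemma balanced_imp_delta_Gorenstein:
  assumes \<delta>: "0 < \<delta>" and bal: "balanced \<delta> 1 M"
  shows "delta_Gorenstein \<delta> (independence_polytope M)"
proof -
  let ?P = "independence_polytope M"
  define v where "v = (indicator_vec (nonloops M) :: real ^ 'n)"
  have "v \<in> dilate \<delta> ?P"
  proof -
    have "(\<Sum>i\<in>A. v $ i) \<le> real \<delta> * real (rank_of M A)" for A
    proof -
      have "card (A \<inter> nonloops M) \<le> \<delta> * rank_of M (A \<inter> nonloops M)"
        using balanced_card_le[OF M bal, of "A \<inter> nonloops M"] by simp
      then have "real (card (A \<inter> nonloops M)) \<le> real (\<delta> * rank_of M A)"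
        unfolding rank_Int_nonloops[OF M] by (simp only: of_nat_le_iff)
      then show ?thesis unfolding v_def sum_indicator_vec by simp
    qed
    moreover have "0 \<le> v $ i" for i by (simp add: v_def indicator_vec_nth)
    ultimately obtain I where I: "\<forall>i<\<delta>. I i \<in> indep M" "v = (\<Sum>i<\<delta>. indicator_vec (I i))"
      using lattice_point_decomposition[OF M, of v \<delta>] indicator_vec_lattice by (auto simp: v_def)
    have "(1 / real \<delta>) *\<^sub>R v = (\<Sum>i\<in>{..<\<delta>}. (1 / real \<delta>) *\<^sub>R indicator_vec (I i))"
      unfolding I(2) by (rule scaleR_sum_right)
    also have "\<dots> \<in> ?P"
      using I(1) \<delta> by (intro convex_sum convex_independence_polytope[OF M] indicator_vec_in_polytope[OF M]) auto
    finally have "(1 / real \<delta>) *\<^sub>R v \<in> ?P" .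
    moreover have "v = real \<delta> *\<^sub>R ((1 / real \<delta>) *\<^sub>R v)" using \<delta> by simp
    ultimately show ?thesis unfolding dilate_def by blast
  qed
  then have v: "v \<in> dilate \<delta> ?P \<inter> lattice_points" using indicator_vec_lattice by (simp add: v_def)
  have lat: "(v, real \<delta>) \<in> cone_lattice ?P" by (rule dilate_in_cone_lattice[OF v])
  have "\<exists>h. facet_form ?P Q h \<and> h (v, real \<delta>) = 1" if Q: "Q facet_of ?P" for Q
    using facet_tight[OF Q]
  proof (elim disjE bexE exE conjE)
    fix e assume e: "e \<in> nonloops M" "\<forall>x\<in>Q. x $ e = 0"
    have one: "coordinate_form e (v, real \<delta>) = 1"
      using e by (simp add: coordinate_form_def v_def indicator_vec_nth)
    have "facet_form ?P Q (coordinate_form e)"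
      by (rule facet_formI[OF linear_coordinate_form coordinate_form_Ints lat one])
        (use e polytope_nonneg[OF M] in \<open>auto simp: coordinate_form_def\<close>)
    then show ?thesis using one by blast
  next
    fix F assume F: "connected_flat M F" "\<forall>x\<in>Q. (\<Sum>i\<in>F. x $ i) = real (rank_of M F)"
    have "card F + 1 = \<delta> * rank_of M F" using bal F(1) by (simp add: balanced_def)
    then have "real (card F) + 1 = real \<delta> * real (rank_of M F)" by (metis of_nat_1 of_nat_add of_nat_mult)
    moreover have "F \<inter> nonloops M = F" using F(1) by (auto simp: connected_flat_def flat_def)
    ultimately have one: "rank_form M F (v, real \<delta>) = 1"
      by (simp add: rank_form_def v_def sum_indicator_vec mult.commute)
    have "facet_form ?P Q (rank_form M F)"
      by (rule facet_formI[OF linear_rank_form rank_form_Ints lat one])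
        (use F(2) polytope_sum_le[OF M] in \<open>auto simp: rank_form_def\<close>)
    then show ?thesis using one by blast
  qed
  then show ?thesis
    using \<delta> v lattice_polytope_independence_polytope[OF M] integer_decomposition_independence_polytope[OF M]
    unfolding delta_Gorenstein_def by blast
qed

text \<open>
  A parallel class has \<open>\<delta> - 1\<close> elements, which forces \<open>\<delta> \<ge> 2\<close>; without nonloops the condition is
  void, and \<open>\<delta> = 2\<close> will do.
\<close>

lemma Gorenstein_iff_balanced:
  "Gorenstein (independence_polytope M) \<longleftrightarrow> (\<exists>\<delta>\<ge>2. balanced \<delta> 1 M)"
proof
  assume "Gorenstein (independence_polytope M)"
  then obtain \<delta> where \<delta>: "0 < \<delta>" "balanced \<delta> 1 M"
    using delta_Gorenstein_imp_balanced unfolding Gorenstein_def delta_Gorenstein_def by blast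
  show "\<exists>\<delta>\<ge>2. balanced \<delta> 1 M"
  proof (cases "nonloops M = {}")
    case True
    then have "balanced 2 1 M" by (auto simp: balanced_def connected_flat_def flat_def inseparable_def)
    then show ?thesis by blast
  next
    case False
    then obtain e where e: "e \<in> nonloops M" by blast
    note con = rank_one_connected_flat[OF M e]
    have "card (span_of M {e}) + 1 = \<delta>" using \<delta>(2) con by (simp add: balanced_def)
    moreover have "flat M (span_of M {e})" using con(1) by (simp add: connected_flat_def)
    then have "0 < card (span_of M {e})"
      using flat_finite[OF M] subset_span_of[OF M, of "{e}"] e by (auto simp: card_gt_0_iff)
    ultimately have "2 \<le> \<delta>" by linarith
    then show ?thesis using \<delta>(2) by blast
  qed
next
  assume "\<exists>\<delta>\<ge>2. balanced \<delta> 1 M"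
  then show "Gorenstein (independence_polytope M)"
    using balanced_imp_delta_Gorenstein unfolding Gorenstein_def by (metis less_le_trans zero_less_numeral)
qed

end

theorem theorem1p1:
  fixes M :: "'n::finite set_system"
  assumes "matroid M"
  shows "Gorenstein (independence_polytope M) \<longleftrightarrow>
    (\<exists>\<delta>\<ge>2. \<exists>Ms. pairwise_disjoint_grounds Ms \<and> M = direct_sum Ms \<and>
       (\<forall>L \<in> set Ms. (\<exists>e. L = loop e) \<or>
          (\<exists>N. matroid_connected N \<and> F_matroid \<delta> N \<and> is_blow_up (\<delta> - 1) N L)))"
  unfolding Gorenstein_iff_balanced[OF assms]
  using balanced_iff_direct_sum[OF assms] by (intro ex_cong1 conj_cong refl)

end
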